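(* Let $X$ be a standard Borel space equipped with a non-atomic probability measure $\mu$. The group $\mathrm{Aut}^\ast(X,\mu)$ of all measure class preserving automorphisms of $(X,\mu)$, equipped with the strong topology, is a Lévy group and therefore extremely amenable.
   Context: $\mathrm{Aut}^\ast(X,\mu)$ is the group of all non-singular Borel automorphisms $T$ of $(X,\mu)$ (i.e. $T$ preserves the class of $\mu$-null sets in both directions), where two automorphisms that agree $\mu$-almost everywhere are identified. To $T\in \mathrm{Aut}^\ast(X,\mu)$ one associates the linear isometry $\Phi(T)$ of $L^2(X,\mu)$ given by $$\Phi(T)f(x)=\left(\frac{d\,\mu\circ T^{-1}}{d\mu}(x)\right)^{1/2} f(T^{-1}x),\qquad x\in X.$$ The strong topology on $\mathrm{Aut}^\ast(X,\mu)$ is the topology induced, via $\Phi$, by the strong operator topology on the unitary group of $L^2(X,\mu)$ (it is also called the weak topology); it is a Polish group topology. An mm-space is a triple $(Y,d,\nu)$, where $d$ is a metric on a set $Y$ and $\nu$ is a (Borel) probability measure on $(Y,d)$. A net $(Y_\alpha,d_\alpha,\nu_\alpha)$ of mm-spaces forms a Lévy family if, whenever $A_\alpha\subseteq Y_\alpha$ are Borel subsets with $\liminf_\alpha \nu_\alpha(A_\alpha)>0$, one has for each $\epsilon>0$ that $\lim_\alpha \nu_\alpha((A_\alpha)_\epsilon)=1$, where $A_\epsilon$ denotes the $\epsilon$-neighbourhood of a set $A$. A metrizable topological group $G$ is a Lévy group if there is a net $(G_\alpha)_{\alpha\in A}$ of compact subgroups of $G$ with the following two properties. (1) The family of mm-spaces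 $(G,d,\mu_\alpha)$ is a Lévy family, where $d$ is any compatible right-invariant metric on $G$ and $\mu_\alpha$ denotes the normalized Haar measure on $G_\alpha$ (regarded as a probability measure on $G$). (2) For every finite collection $g_1,\dots,g_N\in G$ and every $\epsilon>0$ there is an $\alpha\in A$ such that for all $\beta\geq\alpha$ and all $i=1,\dots,N$ one has $d(g_i,G_\beta)<\epsilon$, where $d(g,G_\beta)=\inf_{h\in G_\beta}d(g,h)$. A topological group $G$ is extremely amenable if every continuous action of $G$ on a (non-empty) compact Hausdorff space has a fixed point. *)

theory Defs
  imports
    "HOL-Probability.Probability_Measure"
    "HOL-Algebra.Group_Action"
begin

section \<open>Borel spaces of abstract topologies\<close>

definition borel_of :: "'a topology \<Rightarrow> 'a measure" where
  "borel_of T = sigma (topspace T) {U. openin T U}"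

definition standard_borel :: "'a measure \<Rightarrow> bool" where
  "standard_borel M \<longleftrightarrow>
     (\<exists>T. completely_metrizable_space T \<and> second_countable T \<and> sets M = sets (borel_of T))"

text \<open>The absence of atoms, in the form appropriate for finite measures.\<close>

definition nonatomic :: "'a measure \<Rightarrow> bool" where
  "nonatomic M \<longleftrightarrow>
     (\<forall>A\<in>sets M. 0 < emeasure M A \<longrightarrow>
        (\<exists>B\<in>sets M. B \<subseteq> A \<and> 0 < emeasure M B \<and> emeasure M B < emeasure M A))"


section \<open>The group of measure class preserving automorphisms\<close>

definition nonsingular_automorphisms :: "'a measure \<Rightarrow> ('a \<Rightarrow> 'a) set" where
  "nonsingular_automorphisms M =
     {T. bij_betw T (space M) (space M) \<and> T \<in> measurable M M \<and>
         the_inv_into (space M) T \<in> measurable M M \<and>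
         (\<forall>A\<in>sets M. emeasure M (T ` A) = 0 \<longleftrightarrow> emeasure M A = 0)}"

definition ae_eq_on :: "'a measure \<Rightarrow> ('a \<Rightarrow> 'b) set \<Rightarrow> (('a \<Rightarrow> 'b) \<times> ('a \<Rightarrow> 'b)) set" where
  "ae_eq_on M S = {(f, g). f \<in> S \<and> g \<in> S \<and> (AE x in M. f x = g x)}"

text \<open>
  Operations on almost everywhere classes are defined through an arbitrary representative;
  none of the definitions below depends on its choice.
\<close>

definition rep :: "'c set \<Rightarrow> 'c" where
  "rep C = (SOME f. f \<in> C)"

definition aut_class :: "'a measure \<Rightarrow> ('a \<Rightarrow> 'a) \<Rightarrow> ('a \<Rightarrow> 'a) set" where
  "aut_class M T = ae_eq_on M (nonsingular_automorphisms M) `` {T}"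

definition Aut_star :: "'a measure \<Rightarrow> ('a \<Rightarrow> 'a) set monoid" where
  "Aut_star M =
     \<lparr>carrier = nonsingular_automorphisms M // ae_eq_on M (nonsingular_automorphisms M),
      mult = (\<lambda>S T. aut_class M (rep S \<circ> rep T)),
      one = aut_class M id\<rparr>"


section \<open>The Hilbert space of square integrable functions and its unitary group\<close>

definition square_integrable :: "'a measure \<Rightarrow> ('a \<Rightarrow> complex) set" where
  "square_integrable M =
     {f. f \<in> borel_measurable M \<and> integrable M (\<lambda>x. (cmod (f x))\<^sup>2)}"

definition L2_class :: "'a measure \<Rightarrow> ('a \<Rightarrow> complex) \<Rightarrow> ('a \<Rightarrow> complex) set" where
  "L2_class M f = ae_eq_on M (square_integrable M) `` {f}"

definition L2 :: "'a measure \<Rightarrow> ('a \<Rightarrow> complex) set set" where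
  "L2 M = square_integrable M // ae_eq_on M (square_integrable M)"

definition L2_add ::
    "'a measure \<Rightarrow> ('a \<Rightarrow> complex) set \<Rightarrow> ('a \<Rightarrow> complex) set \<Rightarrow> ('a \<Rightarrow> complex) set" where
  "L2_add M F G = L2_class M (\<lambda>x. rep F x + rep G x)"

definition L2_scale ::
    "'a measure \<Rightarrow> complex \<Rightarrow> ('a \<Rightarrow> complex) set \<Rightarrow> ('a \<Rightarrow> complex) set" where
  "L2_scale M c F = L2_class M (\<lambda>x. c * rep F x)"

definition L2_inner ::
    "'a measure \<Rightarrow> ('a \<Rightarrow> complex) set \<Rightarrow> ('a \<Rightarrow> complex) set \<Rightarrow> complex" where
  "L2_inner M F G = (LINT x|M. rep F x * cnj (rep G x))"

definition L2_dist ::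
    "'a measure \<Rightarrow> ('a \<Rightarrow> complex) set \<Rightarrow> ('a \<Rightarrow> complex) set \<Rightarrow> real" where
  "L2_dist M F G = sqrt (LINT x|M. (cmod (rep F x - rep G x))\<^sup>2)"

definition L2_topology :: "'a measure \<Rightarrow> ('a \<Rightarrow> complex) set topology" where
  "L2_topology M = Metric_space.mtopology (L2 M) (L2_dist M)"

definition unitary_operators ::
    "'a measure \<Rightarrow> (('a \<Rightarrow> complex) set \<Rightarrow> ('a \<Rightarrow> complex) set) set" where
  "unitary_operators M =
     {U \<in> L2 M \<rightarrow>\<^sub>E L2 M.
        bij_betw U (L2 M) (L2 M) \<and>
        (\<forall>F\<in>L2 M. \<forall>G\<in>L2 M. U (L2_add M F G) = L2_add M (U F) (U G)) \<and>
        (\<forall>c. \<forall>F\<in>L2 M. U (L2_scale M c F) = L2_scale M c (U F)) \<and>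
        (\<forall>F\<in>L2 M. \<forall>G\<in>L2 M. L2_inner M (U F) (U G) = L2_inner M F G)}"

text \<open>
  The strong operator topology is the topology of pointwise convergence in norm, i.e. the
  trace of the product topology indexed by the vectors of the Hilbert space.
\<close>

definition unitary_SOT ::
    "'a measure \<Rightarrow> (('a \<Rightarrow> complex) set \<Rightarrow> ('a \<Rightarrow> complex) set) topology" where
  "unitary_SOT M =
     subtopology (product_topology (\<lambda>_. L2_topology M) (L2 M)) (unitary_operators M)"

text \<open>
  The measure \<open>distr M M T\<close> is the push-forward, sending \<open>A\<close> to the measure of the preimage
  of \<open>A\<close> under \<open>T\<close>, and \<open>RN_deriv M N\<close> is the density of \<open>N\<close> with respect to \<open>M\<close>.
\<close>

definition koopman ::
    "'a measure \<Rightarrow> ('a \<Rightarrow> 'a) set \<Rightarrow> ('a \<Rightarrow> complex) set \<Rightarrow> ('a \<Rightarrow> complex) set" where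
  "koopman M T =
     (\<lambda>F\<in>L2 M. L2_class M
        (\<lambda>x. complex_of_real (sqrt (enn2real (RN_deriv M (distr M M (rep T)) x)))
              * rep F (the_inv_into (space M) (rep T) x)))"

definition strong_topology :: "'a measure \<Rightarrow> ('a \<Rightarrow> 'a) set topology" where
  "strong_topology M = pullback_topology (carrier (Aut_star M)) (koopman M) (unitary_SOT M)"


section \<open>Topological groups and extreme amenability\<close>

definition topological_group :: "('g, 'm) monoid_scheme \<Rightarrow> 'g topology \<Rightarrow> bool" where
  "topological_group G T \<longleftrightarrow>
     group G \<and> topspace T = carrier G \<and>
     continuous_map (prod_topology T T) T (\<lambda>(x, y). x \<otimes>\<^bsub>G\<^esub> y) \<and>
     continuous_map T T (\<lambda>x. inv\<^bsub>G\<^esub> x)"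

text \<open>
  The type argument is the type in which the points of the compact spaces live.  HOL cannot
  quantify over it inside the definition, so extreme amenability proper is the statement in
  which it is a type variable.
\<close>

definition extremely_amenable ::
    "'x itself \<Rightarrow> ('g, 'm) monoid_scheme \<Rightarrow> 'g topology \<Rightarrow> bool" where
  "extremely_amenable (point_type :: 'x itself) G T \<longleftrightarrow>
     topological_group G T \<and>
     (\<forall>(K :: 'x topology) \<phi>.
        compact_space K \<and> Hausdorff_space K \<and> topspace K \<noteq> {} \<and>
        group_action G (topspace K) \<phi> \<and>
        continuous_map (prod_topology T K) K (\<lambda>(g, x). \<phi> g x)
        \<longrightarrow> (\<exists>x\<in>topspace K. \<forall>g\<in>carrier G. \<phi> g x = x))"


section \<open>Levy families and Levy groups\<close>

definition directed_index :: "'i set \<Rightarrow> ('i \<Rightarrow> 'i \<Rightarrow> bool) \<Rightarrow> bool" where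
  "directed_index I preceq \<longleftrightarrow>
     I \<noteq> {} \<and> reflp_on I preceq \<and> transp_on I preceq \<and> (\<forall>i\<in>I. \<forall>j\<in>I. \<exists>k\<in>I. preceq i k \<and> preceq j k)"

text \<open>The filter of tails, along which limits and lower limits of nets are taken.\<close>

definition net_filter :: "'i set \<Rightarrow> ('i \<Rightarrow> 'i \<Rightarrow> bool) \<Rightarrow> 'i filter" where
  "net_filter I preceq = (INF i\<in>I. principal {j \<in> I. preceq i j})"

definition mm_space :: "'y set \<Rightarrow> ('y \<Rightarrow> 'y \<Rightarrow> real) \<Rightarrow> 'y measure \<Rightarrow> bool" where
  "mm_space Y d \<nu> \<longleftrightarrow>
     Metric_space Y d \<and> prob_space \<nu> \<and>
     sets \<nu> = sets (borel_of (Metric_space.mtopology Y d))"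

definition metric_nbhd :: "'y set \<Rightarrow> ('y \<Rightarrow> 'y \<Rightarrow> real) \<Rightarrow> 'y set \<Rightarrow> real \<Rightarrow> 'y set" where
  "metric_nbhd Y d A \<epsilon> = {y \<in> Y. \<exists>a\<in>A. d a y < \<epsilon>}"

definition levy_family ::
    "'i set \<Rightarrow> ('i \<Rightarrow> 'i \<Rightarrow> bool) \<Rightarrow> ('i \<Rightarrow> 'y set) \<Rightarrow> ('i \<Rightarrow> 'y \<Rightarrow> 'y \<Rightarrow> real) \<Rightarrow>
     ('i \<Rightarrow> 'y measure) \<Rightarrow> bool" where
  "levy_family I preceq Y d \<nu> \<longleftrightarrow>
     directed_index I preceq \<and> (\<forall>\<alpha>\<in>I. mm_space (Y \<alpha>) (d \<alpha>) (\<nu> \<alpha>)) \<and>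
     (\<forall>A. (\<forall>\<alpha>\<in>I. A \<alpha> \<in> sets (\<nu> \<alpha>)) \<and>
          Liminf (net_filter I preceq) (\<lambda>\<alpha>. ereal (measure (\<nu> \<alpha>) (A \<alpha>))) > 0
        \<longrightarrow> (\<forall>\<epsilon>>0. ((\<lambda>\<alpha>. measure (\<nu> \<alpha>) (metric_nbhd (Y \<alpha>) (d \<alpha>) (A \<alpha>) \<epsilon>)) \<longlongrightarrow> 1)
                     (net_filter I preceq)))"

text \<open>
  The normalized Haar measure of a compact group; regularity is automatic for the compact
  metrizable groups to which this is applied.
\<close>

definition normalized_haar ::
    "('g, 'm) monoid_scheme \<Rightarrow> 'g topology \<Rightarrow> 'g measure \<Rightarrow> bool" where
  "normalized_haar H S \<mu> \<longleftrightarrow>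
     prob_space \<mu> \<and> sets \<mu> = sets (borel_of S) \<and>
     (\<forall>h\<in>carrier H. \<forall>A\<in>sets \<mu>. emeasure \<mu> (h <#\<^bsub>H\<^esub> A) = emeasure \<mu> A)"

definition compatible_right_invariant_metric ::
    "('g, 'm) monoid_scheme \<Rightarrow> 'g topology \<Rightarrow> ('g \<Rightarrow> 'g \<Rightarrow> real) \<Rightarrow> bool" where
  "compatible_right_invariant_metric G T d \<longleftrightarrow>
     Metric_space (carrier G) d \<and> Metric_space.mtopology (carrier G) d = T \<and>
     (\<forall>x\<in>carrier G. \<forall>y\<in>carrier G. \<forall>z\<in>carrier G. d (x \<otimes>\<^bsub>G\<^esub> z) (y \<otimes>\<^bsub>G\<^esub> z) = d x y)"

text \<open>
  HOL cannot quantify existentially over the type of the index set of the net.  The type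
  \<open>'g set \<times> nat\<close> entails no restriction: a net as below over any directed set can be
  reindexed by the pairs of a finite set \<open>C\<close> of group elements and a natural number \<open>n\<close>, taking
  for \<open>(C, n)\<close> a member of the net that is \<open>1 / (n + 1)\<close>-close to all elements of \<open>C\<close> and
  whose concentration function at \<open>1 / (n + 1)\<close> is less than \<open>1 / (n + 1)\<close>.

  The metric \<open>d\<close> ranges over all compatible right-invariant metrics; such metrics exist by the
  Birkhoff--Kakutani theorem, and they all induce the same uniformity.
\<close>

definition levy_group :: "('g, 'm) monoid_scheme \<Rightarrow> 'g topology \<Rightarrow> bool" where
  "levy_group G T \<longleftrightarrow>
     topological_group G T \<and> metrizable_space T \<and>
     (\<exists>(I :: ('g set \<times> nat) set) preceq K \<mu>.
        directed_index I preceq \<and>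
        (\<forall>\<alpha>\<in>I. subgroup (K \<alpha>) G \<and> compactin T (K \<alpha>) \<and>
                normalized_haar (G\<lparr>carrier := K \<alpha>\<rparr>) (subtopology T (K \<alpha>)) (\<mu> \<alpha>)) \<and>
        (\<forall>d. compatible_right_invariant_metric G T d \<longrightarrow>
           levy_family I preceq (\<lambda>_. carrier G) (\<lambda>_. d)
             (\<lambda>\<alpha>. distr (\<mu> \<alpha>) (borel_of T) (\<lambda>x. x)) \<and>
           (\<forall>C \<epsilon>. finite C \<and> C \<subseteq> carrier G \<and> \<epsilon> > 0 \<longrightarrow>
              (\<exists>\<alpha>\<in>I. \<forall>\<beta>\<in>I. preceq \<alpha> \<beta> \<longrightarrow> (\<forall>g\<in>C. (INF h\<in>K \<beta>. d g h) < \<epsilon>)))))"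

end

theory Submission
  imports Defs "HOL-Probability.Probability" "HOL-Combinatorics.Permutations"
begin

text \<open>
  A finite set of automorphisms is approximated simultaneously by permutations of finitely many
  small disjoint cells.  Since an automorphism \<open>g\<close> need not preserve the measure, the cells are
  given sizes running through a long geometric progression, in such a way that in every set of a
  suitable finite algebra all sizes occupy nearly the same mass.  On a set where the Jacobian of
  \<open>g\<close> is nearly the power \<open>q\<^sup>k\<close> of the ratio \<open>q\<close> of the progression, \<open>g\<close> is approximated by
  matching the cells of each size with cells whose size differs by the factor \<open>q\<^sup>k\<close>; the two ends of
  the progression, where no partner exists, carry little mass.

  The full symmetric group of the cells acts on the space.  A permutation moving only cells of small
  total mass is close to the identity in the strong topology, so concentration follows from a
  variance bound for functions on the symmetric group that are Lipschitz with respect to a Hamming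
  distance weighted by the sizes of the cells.  The bound is obtained by conditioning on
  one value at a time, starting with the largest cell; a second moment is enough, because only
  sets of measure bounded away from zero have to be considered.

  If a group with this concentration property acted on a compact space without a fixed point, the
  space would be covered by finitely many open sets, each moved off itself, robustly, by some group
  element.  One of them contains a proportion of an orbit of the finite subgroup that is bounded
  below, so a slight enlargement contains more than half of the orbit and meets
  its own translate.
\<close>

section \<open>Concentration in symmetric groups with weighted Hamming distance\<close>

text \<open>Both conclusions are drawn from \<open>finite_concentration\<close>, which mentions only
  finite subgroups and neighbourhoods of the identity. Right-invariant compatible metrics are
  governed by such neighbourhoods, so one net serves all of them. The variance bound sees the cells
  only through the sum of their squared masses, which is at most the largest mass times the total
  mass. Uniform smallness is thus all that concentration asks for; neither the number of cells nor
  the spread of their sizes enters, and the sizes stay free for the approximation of automorphisms.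
  Closeness in the strong topology is tested on indicators. There the squared L2 distance is twice
  the mass of the set minus an overlap integral, so every approximation reduces to bounding one
  integral from below. The standard Borel hypothesis enters through an injective real code of the
  points. Its inverse has to be measurable, but only almost everywhere: a conull countable union of
  compact sets, on each of which the code is continuous, is enough.\<close>

lemma sum_diff_square:
  fixes s :: "'b \<Rightarrow> real"
  shows "(\<Sum>b\<in>B. \<Sum>c\<in>B. (s b - s c)\<^sup>2) = 2 * (real (card B) * (\<Sum>b\<in>B. (s b)\<^sup>2) - (\<Sum>b\<in>B. s b)\<^sup>2)"
proof -
  have "(\<Sum>b\<in>B. \<Sum>c\<in>B. (s b - s c)\<^sup>2)
      = (\<Sum>b\<in>B. \<Sum>c\<in>B. (s b)\<^sup>2) + (\<Sum>b\<in>B. \<Sum>c\<in>B. (s c)\<^sup>2) - 2 * (\<Sum>b\<in>B. \<Sum>c\<in>B. s b * s c)"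
    by (simp add: power2_diff sum.distrib sum_subtractf sum_distrib_left algebra_simps)
  also have "(\<Sum>b\<in>B. \<Sum>c\<in>B. s b * s c) = (\<Sum>b\<in>B. s b)\<^sup>2"
    by (simp add: power2_eq_square sum_product)
  finally show ?thesis by (simp add: sum_distrib_left)
qed

text \<open>The mass of the disagreement set. Composing both permutations on the left with a common
  one changes nothing, but the weights sit at the arguments, so composition on the right does not
  preserve this distance. The transfer to right-invariant neighbourhoods therefore passes through
  inverses.\<close>

definition weighted_hamming :: "('i \<Rightarrow> real) \<Rightarrow> 'i set \<Rightarrow> ('i \<Rightarrow> 'i) \<Rightarrow> ('i \<Rightarrow> 'i) \<Rightarrow> real" where
  "weighted_hamming w S p q = (\<Sum>k\<in>S. if p k \<noteq> q k then w k else 0)"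

text \<open>The two products can disagree only where \<open>q\<close> takes one of the values
  \<open>a\<close>, \<open>b\<close>, \<open>c\<close>, hence at no more than three points, and each
  of them weighs at most \<open>w a\<close>. This is why the heaviest element is singled
  out.\<close>

lemma weighted_hamming_transpose:
  assumes "finite S" "a \<notin> S" "q permutes S" "b \<in> insert a S" "c \<in> insert a S"
    and w: "\<And>k. 0 \<le> w k" "\<And>k. k \<in> S \<Longrightarrow> w k \<le> w a"
  shows "weighted_hamming w (insert a S) (Transposition.transpose a b \<circ> q) (Transposition.transpose a c \<circ> q) \<le> 3 * w a"
proof -
  let ?B = "{a, Hilbert_Choice.inv q b, Hilbert_Choice.inv q c} \<inter> insert a S"
  have "(if (Transposition.transpose a b \<circ> q) k \<noteq> (Transposition.transpose a c \<circ> q) k then w k else 0) \<le> (if k \<in> ?B then w a else 0)"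
    if "k \<in> insert a S" for k
  proof (cases "k \<in> ?B")
    case True
    then show ?thesis using that w by auto
  next
    case False
    then have "k \<noteq> a" "k \<noteq> Hilbert_Choice.inv q b" "k \<noteq> Hilbert_Choice.inv q c" "k \<in> S" using that by auto
    then have "q k \<noteq> b" "q k \<noteq> c" "q k \<noteq> a"
      using assms(2,3) by (auto simp: permutes_inverses permutes_in_image)
    then show ?thesis using w by (auto simp add: Transposition.transpose_def)
  qed
  then have "weighted_hamming w (insert a S) (Transposition.transpose a b \<circ> q) (Transposition.transpose a c \<circ> q)
      \<le> (\<Sum>k\<in>insert a S. if k \<in> ?B then w a else 0)"
    unfolding weighted_hamming_def by (rule sum_mono)
  also have "\<dots> = (\<Sum>k\<in>insert a S \<inter> ?B. w a)"
    using assms(1) by (intro sum.inter_restrict[symmetric]) auto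
  also have "insert a S \<inter> ?B = ?B" by blast
  also have "(\<Sum>k\<in>?B. w a) = real (card ?B) * w a" by simp
  also have "\<dots> \<le> 3 * w a"
  proof (rule mult_right_mono)
    have "card ?B \<le> card {a, Hilbert_Choice.inv q b, Hilbert_Choice.inv q c}" by (rule card_mono) auto
    also have "\<dots> \<le> 3" by (auto simp: card_insert_if)
    finally show "real (card ?B) \<le> 3" by simp
  qed (use w in auto)
  finally show ?thesis .
qed

lemma le_add_if_double_diff_le: "2 * (P - Q) \<le> Y \<Longrightarrow> X - P \<le> Z \<Longrightarrow> 0 \<le> Y \<Longrightarrow> X - Q \<le> Y + (Z::real)"
  unfolding right_diff_distrib by linarith

text \<open>The law of total variance with denominators cleared: the variance is at most nine times
  the sum of the squared weights. Every permutation of \<open>insert a S\<close> is the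
  transposition of \<open>a\<close> and \<open>b\<close> after a unique permutation \<open>q\<close>
  of \<open>S\<close>, and \<open>b\<close> is its value at \<open>a\<close>. Each fibre over
  \<open>b\<close> is covered by the induction hypothesis, and the means of two fibres differ by at
  most \<open>3 * w a\<close>. Elements are added in order of weight, so the one conditioned on is
  the heaviest.\<close>

lemma variance_permutations:
  fixes w :: "'i \<Rightarrow> real"
  assumes "finite S" and w: "\<And>k. 0 \<le> w k"
    and "\<And>p q. p permutes S \<Longrightarrow> q permutes S \<Longrightarrow> \<bar>f p - f q\<bar> \<le> weighted_hamming w S p q"
  shows "fact (card S) * (\<Sum>p | p permutes S. (f p)\<^sup>2) - (\<Sum>p | p permutes S. f p)\<^sup>2
     \<le> (fact (card S))\<^sup>2 * (9 * (\<Sum>k\<in>S. (w k)\<^sup>2))"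
  using assms(1,3)
proof (induction S arbitrary: f rule: finite_ranking_induct[where f = w])
  case empty
  then show ?case by simp
next
  case (insert a S)
  show ?case
  proof (cases "a \<in> S")
    case True
    then have "insert a S = S" by auto
    then show ?thesis using insert by simp
  next
    case False
    define N where "N = (fact (card S) :: real)"
    define n where "n = real (card (insert a S))"
    define A where "A b = (\<Sum>q | q permutes S. (f (Transposition.transpose a b \<circ> q))\<^sup>2)" for b
    define s where "s b = (\<Sum>q | q permutes S. f (Transposition.transpose a b \<circ> q))" for b
    define W where "W = 9 * (\<Sum>k\<in>S. (w k)\<^sup>2)"
    have fa: "fact (card (insert a S)) = n * N"
      using False insert.hyps by (simp add: n_def N_def)
    have N: "N > 0" "real (card {q. q permutes S}) = N"
      using card_permutations[OF refl insert.hyps(1)] by (auto simp: N_def)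
    have perm: "Transposition.transpose a b \<circ> q permutes insert a S" if "b \<in> insert a S" "q permutes S" for b q
      using that by (intro permutes_compose[OF permutes_subset[of q S]] permutes_swap_id) auto
    have IH: "N * A b - (s b)\<^sup>2 \<le> N\<^sup>2 * W" if b: "b \<in> insert a S" for b
      unfolding N_def A_def s_def W_def
    proof (rule insert.IH)
      fix p q assume pq: "p permutes S" "q permutes S"
      have "\<bar>f (Transposition.transpose a b \<circ> p) - f (Transposition.transpose a b \<circ> q)\<bar>
          \<le> weighted_hamming w (insert a S) (Transposition.transpose a b \<circ> p) (Transposition.transpose a b \<circ> q)"
        using b pq by (intro insert.prems perm)
      \<comment> \<open>Left composition with the transposition is injective, and \<open>p\<close>
        and \<open>q\<close> both fix \<open>a\<close>.\<close>
      also have "\<dots> = weighted_hamming w S p q"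
        using False insert.hyps pq
        by (auto simp: weighted_hamming_def permutes_not_in[of p S a] permutes_not_in[of q S a]
            Transposition.transpose_eq_iff intro!: sum.cong)
      finally show "\<bar>f (Transposition.transpose a b \<circ> p) - f (Transposition.transpose a b \<circ> q)\<bar> \<le> weighted_hamming w S p q" .
    qed
    \<comment> \<open>The fibres over \<open>b\<close> and \<open>c\<close> are coupled by taking
      the same \<open>q\<close> in both.\<close>
    have sdiff: "(s b - s c)\<^sup>2 \<le> (N * (3 * w a))\<^sup>2" if "b \<in> insert a S" "c \<in> insert a S" for b c
    proof -
      have "\<bar>s b - s c\<bar> \<le> (\<Sum>q | q permutes S. \<bar>f (Transposition.transpose a b \<circ> q) - f (Transposition.transpose a c \<circ> q)\<bar>)"
        unfolding s_def sum_subtractf[symmetric] by (rule sum_abs)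
      also have "\<dots> \<le> (\<Sum>q | q permutes S. 3 * w a)"
      proof (rule sum_mono)
        fix q assume q: "q \<in> {q. q permutes S}"
        have "\<bar>f (Transposition.transpose a b \<circ> q) - f (Transposition.transpose a c \<circ> q)\<bar>
           \<le> weighted_hamming w (insert a S) (Transposition.transpose a b \<circ> q) (Transposition.transpose a c \<circ> q)"
          using q that by (intro insert.prems perm) auto
        also have "\<dots> \<le> 3 * w a"
          using q that False insert.hyps w by (intro weighted_hamming_transpose) auto
        finally show "\<bar>f (Transposition.transpose a b \<circ> q) - f (Transposition.transpose a c \<circ> q)\<bar> \<le> 3 * w a" .
      qed
      also have "\<dots> = N * (3 * w a)" using N by simp
      finally have "\<bar>s b - s c\<bar> \<le> \<bar>N * (3 * w a)\<bar>" by linarith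
      then show ?thesis by (simp only: abs_le_square_iff)
    qed
    have n: "n > 0" "n = real (card (insert a S))" using insert.hyps by (auto simp: n_def card_gt_0_iff)
    \<comment> \<open>The variance between fibres is a sum over pairs of fibres, so the pairwise
      bound suffices. The factor 2 gained here is given away in
      \<open>le_add_if_double_diff_le\<close>.\<close>
    have "2 * (n * (\<Sum>b\<in>insert a S. (s b)\<^sup>2) - (\<Sum>b\<in>insert a S. s b)\<^sup>2)
        \<le> (\<Sum>b\<in>insert a S. \<Sum>c\<in>insert a S. (N * (3 * w a))\<^sup>2)"
      unfolding n(2) sum_diff_square[symmetric] by (intro sum_mono sdiff)
    also have "\<dots> = n\<^sup>2 * (N * (3 * w a))\<^sup>2"
      unfolding sum_constant n(2) by (simp add: power2_eq_square)
    finally have 1: "2 * (n * (\<Sum>b\<in>insert a S. (s b)\<^sup>2) - (\<Sum>b\<in>insert a S. s b)\<^sup>2) \<le> n\<^sup>2 * (N * (3 * w a))\<^sup>2" .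
    have "N * (\<Sum>b\<in>insert a S. A b) - (\<Sum>b\<in>insert a S. (s b)\<^sup>2) = (\<Sum>b\<in>insert a S. N * A b - (s b)\<^sup>2)"
      by (simp add: sum_subtractf sum_distrib_left)
    also have "\<dots> \<le> (\<Sum>b\<in>insert a S. N\<^sup>2 * W)" by (intro sum_mono IH)
    also have "\<dots> = n * (N\<^sup>2 * W)" by (simp add: n(2))
    finally have "n * (N * (\<Sum>b\<in>insert a S. A b) - (\<Sum>b\<in>insert a S. (s b)\<^sup>2)) \<le> n * (n * (N\<^sup>2 * W))"
      using n(1) by (intro mult_left_mono) auto
    then have 2: "n * N * (\<Sum>b\<in>insert a S. A b) - n * (\<Sum>b\<in>insert a S. (s b)\<^sup>2) \<le> (n * N)\<^sup>2 * W"
      by (simp add: algebra_simps power2_eq_square)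
    have "(\<Sum>p | p permutes insert a S. (f p)\<^sup>2) = (\<Sum>b\<in>insert a S. A b)"
      unfolding A_def by (rule sum_over_permutations_insert[OF insert.hyps(1) False])
    moreover have "(\<Sum>p | p permutes insert a S. f p) = (\<Sum>b\<in>insert a S. s b)"
      unfolding s_def by (rule sum_over_permutations_insert[OF insert.hyps(1) False])
    moreover have "9 * (\<Sum>k\<in>insert a S. (w k)\<^sup>2) = 9 * (w a)\<^sup>2 + W"
      using False insert.hyps by (simp add: W_def)
    moreover have "n\<^sup>2 * (N * (3 * w a))\<^sup>2 = (n * N)\<^sup>2 * (9 * (w a)\<^sup>2)"
      by (simp add: power_mult_distrib)
    moreover have "0 \<le> (n * N)\<^sup>2 * (9 * (w a)\<^sup>2)" by simp
    moreover note le_add_if_double_diff_le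
    ultimately show ?thesis
      unfolding fa using 1 2 by (simp only: distrib_left)
  qed
qed

lemma weighted_hamming_triangle:
  assumes "\<And>k. 0 \<le> w k"
  shows "weighted_hamming w S p r \<le> weighted_hamming w S p q + weighted_hamming w S q r"
  unfolding weighted_hamming_def sum.distrib[symmetric] using assms
  by (intro sum_mono) auto

lemma weighted_hamming_commute: "weighted_hamming w S p q = weighted_hamming w S q p"
  unfolding weighted_hamming_def by (intro sum.cong) auto

text \<open>Chebyshev's inequality is used twice for the distance \<open>f\<close> to
  \<open>A\<close>, which is 1-Lipschitz and vanishes on \<open>A\<close>. Let \<open>V\<close> be
  the variance bound and \<open>m\<close> the mean. On \<open>A\<close> the deviation is
  \<open>m\<close>, so \<open>\<epsilon> * m^2 \<le> V\<close>, and
  \<open>4 * V \<le> \<epsilon> * t^2\<close> gives \<open>m \<le> t/2\<close>. Where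
  \<open>f\<close> is at least \<open>t\<close> the deviation is at least \<open>t/2\<close>, so
  this set has proportion at most \<open>4 * V / t^2 \<le> \<epsilon>\<close>. The constant 36 is 4
  times the 9 of \<open>variance_permutations\<close>.\<close>

lemma permutations_concentration:
  fixes w :: "'i \<Rightarrow> real" and \<epsilon> t :: real
  assumes S: "finite S" and w: "\<And>k. 0 \<le> w k"
    and A: "A \<subseteq> {p. p permutes S}" "\<epsilon> * fact (card S) \<le> card A"
    and "0 < \<epsilon>" "0 < t" and small: "36 * (\<Sum>k\<in>S. (w k)\<^sup>2) \<le> \<epsilon> * t\<^sup>2"
  shows "(1 - \<epsilon>) * fact (card S) \<le> card {p. p permutes S \<and> (\<exists>a\<in>A. weighted_hamming w S p a < t)}"
proof -
  let ?P = "{p. p permutes S}"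
  define N where "N = (fact (card S) :: real)"
  have fin: "finite ?P" using S by (rule finite_permutations)
  have N: "N > 0" "real (card ?P) = N"
    using card_permutations[OF refl S] by (auto simp: N_def)
  have finA: "finite A" using fin A(1) finite_subset by blast
  have "0 < \<epsilon> * fact (card S)" using \<open>0 < \<epsilon>\<close> by simp
  then have neA: "A \<noteq> {}" using A(2) by auto
  define f where "f p = Min ((\<lambda>a. weighted_hamming w S p a) ` A)" for p
  have f_le: "f p \<le> weighted_hamming w S p a" if "a \<in> A" for p a
    using that finA by (auto simp: f_def)
  have f_ex: "\<exists>a\<in>A. f p = weighted_hamming w S p a" for p
  proof -
    have "f p \<in> (\<lambda>a. weighted_hamming w S p a) ` A"
      unfolding f_def using finA neA by (intro Min_in) auto
    then show ?thesis by auto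
  qed
  have lip: "f p - f q \<le> weighted_hamming w S p q" for p q
  proof -
    obtain a where a: "a \<in> A" "f q = weighted_hamming w S q a" using f_ex by blast
    have "f p \<le> weighted_hamming w S p a" using a f_le by auto
    also have "\<dots> \<le> weighted_hamming w S p q + weighted_hamming w S q a"
      by (rule weighted_hamming_triangle[OF w])
    finally show ?thesis using a by simp
  qed
  have nonneg: "weighted_hamming w S p q \<ge> 0" for p q
    unfolding weighted_hamming_def using w by (intro sum_nonneg) auto
  have f0: "f a = 0" if "a \<in> A" for a
  proof -
    have "f a \<le> 0" using f_le[OF that, of a] by (simp add: weighted_hamming_def)
    moreover have "f a \<ge> 0" using f_ex[of a] nonneg by auto
    ultimately show ?thesis by simp
  qed
  define V where "V = 9 * (\<Sum>k\<in>S. (w k)\<^sup>2)"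
  have V: "4 * V \<le> \<epsilon> * t\<^sup>2" "V \<ge> 0" using small by (auto simp: V_def intro: sum_nonneg)
  define m where "m = (\<Sum>p\<in>?P. f p) / N"
  have var: "N * (\<Sum>p\<in>?P. (f p)\<^sup>2) - (\<Sum>p\<in>?P. f p)\<^sup>2 \<le> N\<^sup>2 * V"
    unfolding N_def V_def
  proof (rule variance_permutations[OF S w])
    show "\<bar>f p - f q\<bar> \<le> weighted_hamming w S p q" for p q
      using lip[of p q] lip[of q p] weighted_hamming_commute[of w S p q] by linarith
  qed
  have mN: "(\<Sum>p\<in>?P. f p) = m * N" using N by (simp add: m_def)
  have "(\<Sum>p\<in>?P. (f p - m)\<^sup>2) = (\<Sum>p\<in>?P. (f p)\<^sup>2) - 2 * m * (\<Sum>p\<in>?P. f p) + N * m\<^sup>2"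
    using N by (simp add: power2_diff sum.distrib sum_subtractf sum_distrib_left sum_distrib_right algebra_simps)
  also have "\<dots> = (\<Sum>p\<in>?P. (f p)\<^sup>2) - N * m\<^sup>2"
    unfolding mN by (simp add: power2_eq_square)
  finally have eq: "(\<Sum>p\<in>?P. (f p - m)\<^sup>2) = (\<Sum>p\<in>?P. (f p)\<^sup>2) - N * m\<^sup>2" .
  have "N * (\<Sum>p\<in>?P. (f p - m)\<^sup>2) \<le> N * (N * V)"
    using var unfolding eq mN by (simp add: algebra_simps power2_eq_square)
  then have var2: "(\<Sum>p\<in>?P. (f p - m)\<^sup>2) \<le> N * V" using N by simp
  have "real (card A) * m\<^sup>2 = (\<Sum>p\<in>A. (f p - m)\<^sup>2)" by (simp add: f0)
  also have "\<dots> \<le> (\<Sum>p\<in>?P. (f p - m)\<^sup>2)" using A fin by (intro sum_mono2) auto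
  finally have "real (card A) * m\<^sup>2 \<le> N * V" using var2 by simp
  moreover have "\<epsilon> * N * m\<^sup>2 \<le> real (card A) * m\<^sup>2" using A(2) by (intro mult_right_mono) (auto simp: N_def)
  ultimately have "N * (\<epsilon> * m\<^sup>2) \<le> N * V" by (simp add: ac_simps)
  then have "\<epsilon> * m\<^sup>2 \<le> V" using N(1) by (simp only: mult_le_cancel_left_pos)
  then have "\<epsilon> * (4 * m\<^sup>2) \<le> \<epsilon> * t\<^sup>2" using V by simp
  then have "(2 * m)\<^sup>2 \<le> t\<^sup>2" using \<open>0 < \<epsilon>\<close> by (simp add: power_mult_distrib)
  then have mt: "2 * m \<le> t" using power2_le_imp_le[of "2 * m" t] \<open>0 < t\<close> by linarith
  let ?G = "{p. p permutes S \<and> (\<exists>a\<in>A. weighted_hamming w S p a < t)}"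
  let ?B = "?P - ?G"
  have "real (card ?B) * (t/2)\<^sup>2 = (\<Sum>p\<in>?B. (t/2)\<^sup>2)" by simp
  also have "\<dots> \<le> (\<Sum>p\<in>?B. (f p - m)\<^sup>2)"
  proof (rule sum_mono)
    fix p assume p: "p \<in> ?B"
    obtain a where "a \<in> A" "f p = weighted_hamming w S p a" using f_ex by blast
    with p have "f p \<ge> t" by auto
    then have "f p - m \<ge> t/2" using mt by simp
    then show "(t/2)\<^sup>2 \<le> (f p - m)\<^sup>2" using \<open>0 < t\<close> by (intro power_mono) auto
  qed
  also have "\<dots> \<le> (\<Sum>p\<in>?P. (f p - m)\<^sup>2)" using fin by (intro sum_mono2) auto
  finally have "real (card ?B) * (t/2)\<^sup>2 \<le> N * V" using var2 by simp
  then have "real (card ?B) * t\<^sup>2 \<le> N * (4 * V)" by (simp add: power_divide)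
  also have "\<dots> \<le> N * (\<epsilon> * t\<^sup>2)" using V N by (intro mult_left_mono) auto
  finally have "real (card ?B) * t\<^sup>2 \<le> (\<epsilon> * N) * t\<^sup>2" by (simp add: algebra_simps)
  then have B: "real (card ?B) \<le> \<epsilon> * N" using \<open>0 < t\<close> by simp
  have "card ?B = card ?P - card ?G" using fin by (intro card_Diff_subset) (auto intro: finite_subset[OF _ fin])
  moreover have "card ?G \<le> card ?P" using fin by (intro card_mono) auto
  ultimately have "real (card ?G) = N - card ?B" using N by simp
  then show ?thesis using B by (simp add: N_def algebra_simps)
qed

text \<open>For each label, as many sources as possible are injected into the targets with the same
  label. These partial injections have disjoint domains and disjoint ranges, so they glue; the
  unmatched sources and targets are then equally numerous, and any bijection between them completes
  the permutation. One permutation thus serves all labels at once.\<close>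

lemma label_matching:
  fixes \<alpha> \<beta> :: "'i \<Rightarrow> 'l"
  assumes fin: "finite S"
  shows "\<exists>p. p permutes S \<and> (\<forall>l. min (card {i\<in>S. \<alpha> i = l}) (card {i\<in>S. \<beta> i = l})
                \<le> card {i\<in>S. \<alpha> i = l \<and> \<beta> (p i) = l})"
proof -
  define R where "R l f P \<longleftrightarrow> P \<subseteq> {i\<in>S. \<alpha> i = l} \<and> inj_on f P \<and> f ` P \<subseteq> {i\<in>S. \<beta> i = l} \<and>
       card P = min (card {i\<in>S. \<alpha> i = l}) (card {i\<in>S. \<beta> i = l})" for l and f :: "'i \<Rightarrow> 'i" and P
  have "\<forall>l. \<exists>f. \<exists>P. R l f P"
  proof
    fix l
    obtain P where P: "P \<subseteq> {i\<in>S. \<alpha> i = l}" "card P = min (card {i\<in>S. \<alpha> i = l}) (card {i\<in>S. \<beta> i = l})" "finite P"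
      by (meson min.cobounded1 obtain_subset_with_card_n)
    then have "\<exists>f. f ` P \<subseteq> {i\<in>S. \<beta> i = l} \<and> inj_on f P"
      using fin by (intro card_le_inj) auto
    then show "\<exists>f. \<exists>P. R l f P" using P unfolding R_def by blast
  qed
  from choice[OF this] obtain f where "\<forall>l. \<exists>P. R l (f l) P" ..
  from choice[OF this] obtain P where R: "\<forall>l. R l (f l) (P l)" ..
  have P: "P l \<subseteq> {i\<in>S. \<alpha> i = l}" and inj: "inj_on (f l) (P l)"
    and im: "f l ` P l \<subseteq> {i\<in>S. \<beta> i = l}"
    and card: "card (P l) = min (card {i\<in>S. \<alpha> i = l}) (card {i\<in>S. \<beta> i = l})" for l
    using R[rule_format, of l] unfolding R_def by blast+
  define D where "D = (\<Union>l. P l)"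
  define F where "F i = f (\<alpha> i) i" for i
  have D: "D \<subseteq> S" using P by (auto simp: D_def)
  have Dl: "i \<in> P (\<alpha> i)" if "i \<in> D" for i using that P by (auto simp: D_def)
  have F: "F i \<in> S" "\<beta> (F i) = \<alpha> i" if "i \<in> D" for i
    using im[of "\<alpha> i"] Dl[OF that] by (auto simp: F_def)
  have injF: "inj_on F D"
  proof (rule inj_onI)
    fix i j assume ij: "i \<in> D" "j \<in> D" "F i = F j"
    then have "\<alpha> i = \<alpha> j" using F by metis
    then show "i = j" using ij Dl inj[of "\<alpha> i"] unfolding F_def by (metis inj_onD)
  qed
  have "card (S - D) = card (S - F ` D)"
    using D F injF fin by (subst (1 2) card_Diff_subset) (auto simp: card_image intro: finite_subset)
  then obtain h where h: "bij_betw h (S - D) (S - F ` D)"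
    using fin by (meson finite_Diff finite_same_card_bij)
  define p where "p i = (if i \<in> D then F i else if i \<in> S then h i else i)" for i
  have "bij_betw p D (F ` D)" using injF by (auto simp: p_def bij_betw_def inj_on_def image_iff)
  moreover have "bij_betw p (S - D) (S - F ` D)"
    using h by (rule bij_betw_cong[THEN iffD1, rotated]) (auto simp: p_def)
  ultimately have "bij_betw p (D \<union> (S - D)) (F ` D \<union> (S - F ` D))" by (rule bij_betw_combine) auto
  moreover have "D \<union> (S - D) = S" "F ` D \<union> (S - F ` D) = S" using D F by auto
  ultimately have "bij_betw p S S" by simp
  then have "p permutes S" by (rule bij_imp_permutes) (use D in \<open>auto simp: p_def\<close>)
  moreover have "min (card {i\<in>S. \<alpha> i = l}) (card {i\<in>S. \<beta> i = l}) \<le> card {i\<in>S. \<alpha> i = l \<and> \<beta> (p i) = l}" for l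
  proof -
    have "P l \<subseteq> {i\<in>S. \<alpha> i = l \<and> \<beta> (p i) = l}"
    proof
      fix i assume i: "i \<in> P l"
      then have "i \<in> D" "\<alpha> i = l" "i \<in> S" using P by (auto simp: D_def)
      then show "i \<in> {i\<in>S. \<alpha> i = l \<and> \<beta> (p i) = l}" using F by (auto simp: p_def)
    qed
    then show ?thesis using fin unfolding card[symmetric] by (intro card_mono) auto
  qed
  ultimately show ?thesis by blast
qed

section \<open>Standard Borel probability spaces and the unit interval\<close>

text \<open>Only the digits 0 and 1 occur, so that expansions in base 4 are unique.\<close>

definition base4 :: "(nat \<Rightarrow> bool) \<Rightarrow> real" where
  "base4 b = (\<Sum>n. of_bool (b n) / 4 ^ Suc n)"

lemma base4_summable: "summable (\<lambda>n. of_bool (b n) / 4 ^ Suc n :: real)"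
proof (rule summable_comparison_test)
  show "\<exists>N. \<forall>n\<ge>N. norm (of_bool (b n) / 4 ^ Suc n :: real) \<le> (1/4) ^ n"
    by (intro exI[of _ 0] allI impI) (auto simp: field_simps power_one_over)
  show "summable (\<lambda>n. (1/4 :: real) ^ n)" by (rule summable_geometric) simp
qed

lemma base4_bounds: "0 \<le> base4 b" "base4 b \<le> 1/3"
proof -
  show "0 \<le> base4 b" unfolding base4_def by (intro suminf_nonneg base4_summable) auto
  have s: "(\<lambda>n. (1/4 :: real) * (1/4) ^ n) sums (1/4 * (1 / (1 - 1/4)))"
    by (intro sums_mult geometric_sums) simp
  have "base4 b \<le> (\<Sum>n. (1/4 :: real) * (1/4) ^ n)"
    unfolding base4_def using s
    by (intro suminf_le base4_summable) (auto simp: sums_iff power_one_over)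
  also have "\<dots> = 1/3" using s by (simp add: sums_iff)
  finally show "base4 b \<le> 1/3" .
qed

lemma base4_shift:
  "base4 b = (\<Sum>m<n. of_bool (b m) / 4 ^ Suc m) + base4 (\<lambda>m. b (m + n)) / 4 ^ n"
proof -
  have "base4 b = (\<Sum>m. of_bool (b (m + n)) / 4 ^ Suc (m + n)) + (\<Sum>m<n. of_bool (b m) / 4 ^ Suc m)"
    unfolding base4_def by (rule suminf_split_initial_segment[OF base4_summable])
  also have "(\<Sum>m. of_bool (b (m + n)) / 4 ^ Suc (m + n) :: real) = (\<Sum>m. (of_bool (b (m + n)) / 4 ^ Suc m) / 4 ^ n)"
    by (simp add: power_add mult_ac)
  also have "\<dots> = base4 (\<lambda>m. b (m + n)) / 4 ^ n"
    unfolding base4_def by (rule suminf_divide[OF base4_summable[of "\<lambda>m. b (m + n)"]])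
  finally show ?thesis by simp
qed

text \<open>A leading digit 1 contributes 1/4, while everything after it contributes at most 1/12.
  Equal sums therefore have equal leading digits, and after removing these the argument
  repeats.\<close>

lemma base4_inj:
  assumes "base4 b = base4 c" shows "b = c"
proof
  fix n show "b n = c n"
    using assms
  proof (induction n arbitrary: b c)
    case 0
    have "base4 b = of_bool (b 0) / 4 + base4 (\<lambda>m. b (m + 1)) / 4" for b
      using base4_shift[of b 1] by simp
    then have "of_bool (b 0) / 4 + base4 (\<lambda>m. b (m + 1)) / 4 = of_bool (c 0) / 4 + base4 (\<lambda>m. c (m + 1)) / 4"
      using 0 by metis
    then show ?case
      using base4_bounds[of "\<lambda>m. b (m + 1)"] base4_bounds[of "\<lambda>m. c (m + 1)"]
      by (cases "b 0"; cases "c 0") auto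
  next
    case (Suc n)
    have "base4 b = of_bool (b 0) / 4 + base4 (\<lambda>m. b (m + 1)) / 4" for b
      using base4_shift[of b 1] by simp
    then have *: "of_bool (b 0) / 4 + base4 (\<lambda>m. b (m + 1)) / 4 = of_bool (c 0) / 4 + base4 (\<lambda>m. c (m + 1)) / 4"
      using Suc.prems by metis
    then have "base4 (\<lambda>m. b (m + 1)) = base4 (\<lambda>m. c (m + 1))"
      using base4_bounds[of "\<lambda>m. b (m + 1)"] base4_bounds[of "\<lambda>m. c (m + 1)"]
      by (cases "b 0"; cases "c 0") auto
    from Suc.IH[OF this] show ?case by simp
  qed
qed

lemma base4_measurable [measurable]:
  assumes "\<And>n. Measurable.pred M (\<lambda>x. b x n)"
  shows "(\<lambda>x. base4 (b x)) \<in> borel_measurable M"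
  unfolding base4_def using assms by measurable

lemma continuous_map_indicator_clopen:
  assumes "openin X U" "closedin X U"
  shows "continuous_map X euclideanreal (\<lambda>x. of_bool (x \<in> U))"
  unfolding continuous_map_def
proof (intro conjI allI impI)
  fix V :: "real set"
  have *: "{x \<in> topspace X. of_bool (x \<in> U) \<in> V}
     = (if 1 \<in> V then (if 0 \<in> V then topspace X else U) else (if 0 \<in> V then topspace X - U else {}))"
    using openin_subset[OF assms(1)] by auto
  show "openin X {x \<in> topspace X. of_bool (x \<in> U) \<in> V}"
    unfolding * using assms by (auto simp: openin_diff)
qed auto

text \<open>Each digit is the indicator of a clopen set, and the partial sums converge uniformly
  because the tail after \<open>n\<close> digits is at most \<open>4^(-n)\<close>.\<close>

lemma continuous_map_base4:
  assumes "\<And>n. openin X {x \<in> topspace X. b x n}" "\<And>n. closedin X {x \<in> topspace X. b x n}"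
  shows "continuous_map X euclideanreal (\<lambda>x. base4 (b x))"
proof -
  have 1: "continuous_map X euclideanreal (\<lambda>x. \<Sum>m<n. of_bool (b x m) / 4 ^ Suc m)" for n
  proof (intro continuous_map_sum)
    fix m
    have "continuous_map X euclideanreal (\<lambda>x. of_bool (x \<in> {x \<in> topspace X. b x m}) * (1 / 4 ^ Suc m))"
      by (intro continuous_map_real_mult continuous_map_indicator_clopen assms) auto
    then show "continuous_map X euclideanreal (\<lambda>x. of_bool (b x m) / 4 ^ Suc m)"
      by (rule continuous_map_eq) auto
  qed auto
  have "continuous_map X Met_TC.mtopology (\<lambda>x. base4 (b x))"
  proof (rule Met_TC.continuous_map_uniform_limit_alt)
    show "\<forall>\<^sub>F n in sequentially. continuous_map X Met_TC.mtopology (\<lambda>x. \<Sum>m<n. of_bool (b x m) / 4 ^ Suc m :: real)"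
      using 1 by auto
    fix \<epsilon> :: real assume e: "0 < \<epsilon>"
    have "(\<lambda>n. (1/4 :: real) ^ n) \<longlonglongrightarrow> 0" by (intro LIMSEQ_power_zero) simp
    then have "\<forall>\<^sub>F n in sequentially. (1/4 :: real) ^ n < \<epsilon>" using e by (rule order_tendstoD)
    then show "\<forall>\<^sub>F n in sequentially. \<forall>x\<in>topspace X. dist (\<Sum>m<n. of_bool (b x m) / 4 ^ Suc m) (base4 (b x)) < \<epsilon>"
    proof (rule eventually_mono, intro ballI)
      fix n x assume n: "(1/4 :: real) ^ n < \<epsilon>"
      let ?t = "base4 (\<lambda>m. b x (m + n))"
      have "dist (\<Sum>m<n. of_bool (b x m) / 4 ^ Suc m) (base4 (b x)) = ?t / 4 ^ n"
        unfolding base4_shift[of "b x" n] dist_real_def using base4_bounds(1)[of "\<lambda>m. b x (m + n)"] by simp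
      also have "\<dots> \<le> 1 / 4 ^ n" using base4_bounds(2)[of "\<lambda>m. b x (m + n)"] by (intro divide_right_mono) auto
      finally show "dist (\<Sum>m<n. of_bool (b x m) / 4 ^ Suc m) (base4 (b x)) < \<epsilon>"
        using n by (simp add: power_one_over)
    qed
  qed auto
  then show ?thesis by simp
qed

lemma sets_borel_of: "sets (borel_of T) = sigma_sets (topspace T) {U. openin T U}"
  and space_borel_of: "space (borel_of T) = topspace T"
proof -
  have "{U. openin T U} \<subseteq> Pow (topspace T)" using openin_subset by blast
  then show "sets (borel_of T) = sigma_sets (topspace T) {U. openin T U}" "space (borel_of T) = topspace T"
    unfolding borel_of_def by (rule sets_measure_of, rule space_measure_of)
qed

lemma openin_borel_of: "openin T U \<Longrightarrow> U \<in> sets (borel_of T)"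
  by (auto simp: sets_borel_of)

lemma closedin_borel_of: "closedin T U \<Longrightarrow> U \<in> sets (borel_of T)"
  using openin_borel_of[of T "topspace T - U"] sets.compl_sets[of "topspace T - U" "borel_of T"]
  by (auto simp: closedin_def space_borel_of double_diff)

text \<open>Closed sets are the convenient generators for the inverse of the code: their preimages
  will be, up to a default value, countable unions of compact images.\<close>

lemma measurable_borel_of_closed:
  assumes f: "f \<in> space N \<rightarrow> topspace T" and "\<And>F. closedin T F \<Longrightarrow> f -` F \<inter> space N \<in> sets N"
  shows "f \<in> measurable N (borel_of T)"
  unfolding borel_of_def
proof (rule measurable_measure_of)
  fix U assume "U \<in> {U. openin T U}"
  then have U: "openin T U" by simp
  have "f -` U \<inter> space N = space N - (f -` (topspace T - U) \<inter> space N)"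
    using f openin_subset[OF U] by auto
  moreover have "f -` (topspace T - U) \<inter> space N \<in> sets N"
    using U by (intro assms(2)) auto
  ultimately show "f -` U \<inter> space N \<in> sets N" by auto
qed (use f openin_subset in auto)

lemma (in Metric_space) second_countable_dense_sequence:
  assumes "second_countable mtopology" "M \<noteq> {}"
  shows "\<exists>c. range c \<subseteq> M \<and> (\<forall>x\<in>M. \<forall>e>0. \<exists>i::nat. d (c i) x < e)"
proof -
  obtain C where C: "countable C" "C \<subseteq> M" "mtopology closure_of C = M"
    using second_countable_imp_separable_space[OF assms(1)] by (auto simp: separable_space_def)
  have "C \<noteq> {}" using C assms(2) by auto
  then have c: "range (from_nat_into C) = C" using C(1) by (intro range_from_nat_into)
  have "\<exists>i. d (from_nat_into C i) x < e" if "x \<in> M" "e > 0" for x e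
  proof -
    have "x \<in> mtopology closure_of C" using C that by simp
    then obtain y where "y \<in> C" "y \<in> mball x e" using \<open>e > 0\<close> unfolding metric_closure_of by blast
    moreover from \<open>y \<in> C\<close> obtain i where "y = from_nat_into C i" using c by blast
    ultimately show ?thesis using commute[of x y] by (intro exI[of _ i]) simp
  qed
  moreover have "range (from_nat_into C) \<subseteq> M" using C c by simp
  ultimately show ?thesis by blast
qed

text \<open>The code \<open>\<psi>\<close> records the piece containing a point in each of countably
  many partitions whose mesh tends to 0, so it is injective. Tightness supplies compact sets
  \<open>K j\<close> of measure tending to 1 on which every piece is relatively clopen; there
  \<open>\<psi>\<close> is continuous and maps closed sets to compact ones. The inverse is thus
  Borel on the image \<open>R\<close> of the conull union of the \<open>K j\<close>. This replaces
  the theorem that injective Borel maps send Borel sets to Borel sets.\<close>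

lemma standard_borel_code:
  assumes "standard_borel M" "prob_space M"
  obtains \<psi> :: "'a \<Rightarrow> real" and \<xi> R where
    "\<psi> \<in> borel_measurable M" "inj_on \<psi> (space M)" "R \<in> sets borel" "\<xi> \<in> measurable borel M"
    "\<And>r. r \<in> R \<Longrightarrow> \<psi> (\<xi> r) = r" "emeasure M (\<psi> -` R \<inter> space M) = 1"
proof -
  interpret prob_space M by fact
  obtain T where T: "completely_metrizable_space T" "second_countable T" "sets M = sets (borel_of T)"
    using assms(1) by (auto simp: standard_borel_def)
  obtain X d where X: "Metric_space X d" "Metric_space.mcomplete X d" "T = Metric_space.mtopology X d"
    using T(1) by (auto simp: completely_metrizable_space_def)
  interpret Metric_space X d by fact
  have sp: "space M = X" using sets_eq_imp_space_eq[OF T(3)] X(3) by (simp add: space_borel_of)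
  have metr: "metrizable_space T" using X by (auto simp: metrizable_space_def)
  have open_sets: "openin T U \<Longrightarrow> U \<in> sets M" for U using T(3) openin_borel_of by auto
  have closed_sets: "closedin T U \<Longrightarrow> U \<in> sets M" for U using T(3) closedin_borel_of by auto
  obtain c where c: "range c \<subseteq> X" "\<And>x e. x \<in> X \<Longrightarrow> e > 0 \<Longrightarrow> \<exists>i::nat. d (c i) x < e"
    using second_countable_dense_sequence T(2) X(3) not_empty sp by metis
  \<comment> \<open>The balls of radius \<open>1 / (k + 1)\<close> around the dense sequence, made
    disjoint.\<close>
  define P where "P k i = mball (c i) (1 / real (Suc k)) - (\<Union>j<i. mball (c j) (1 / real (Suc k)))" for k i :: nat
  have PX: "P k i \<subseteq> X" for k i by (auto simp: P_def)
  have P_cover: "\<exists>i. x \<in> P k i" if "x \<in> X" for x k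
  proof -
    have ex: "\<exists>i. x \<in> mball (c i) (1 / real (Suc k))" using c(2)[OF that, of "1 / real (Suc k)"] c(1) that by auto
    define i where "i = (LEAST i. x \<in> mball (c i) (1 / real (Suc k)))"
    have "x \<in> mball (c i) (1 / real (Suc k))" unfolding i_def using ex by (rule LeastI_ex)
    moreover have "x \<notin> mball (c j) (1 / real (Suc k))" if "j < i" for j
      using not_less_Least[of j "\<lambda>i. x \<in> mball (c i) (1 / real (Suc k))"] that unfolding i_def by blast
    ultimately show ?thesis unfolding P_def by blast
  qed
  have P_disj: "i = j" if "x \<in> P k i" "x \<in> P k j" for x k i j
    using that unfolding P_def by (cases i j rule: linorder_cases) auto
  have P_close: "d x y < 2 / real (Suc k)" if "x \<in> P k i" "y \<in> P k i" for x y k i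
  proof -
    have "d x y \<le> d x (c i) + d (c i) y" using that c(1) by (intro triangle) (auto simp: P_def)
    moreover have "d x (c i) < 1 / real (Suc k)" "d (c i) y < 1 / real (Suc k)"
      using that by (auto simp: P_def commute)
    moreover have "2 / real (Suc k) = 1 / real (Suc k) + 1 / real (Suc k)" by simp
    ultimately show ?thesis by linarith
  qed
  \<comment> \<open>Each piece is an increasing union of closed sets, so it can be approximated in
    measure from inside by closed sets.\<close>
  have P_fs: "fsigma_in T (P k i)" for k i
  proof -
    have "openin T (mball (c i) (1 / real (Suc k)))" by (simp add: X(3))
    moreover have "closedin T (topspace T - (\<Union>j<i. mball (c j) (1 / real (Suc k))))"
      by (intro closedin_diff openin_Union) (auto simp: X(3))
    ultimately have "fsigma_in T (mball (c i) (1 / real (Suc k)) \<inter> (topspace T - (\<Union>j<i. mball (c j) (1 / real (Suc k)))))"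
      by (intro fsigma_in_Int open_imp_fsigma_in metr closed_imp_fsigma_in)
    moreover have "mball (c i) (1 / real (Suc k)) \<inter> (topspace T - (\<Union>j<i. mball (c j) (1 / real (Suc k)))) = P k i"
      by (auto simp: P_def X(3))
    ultimately show ?thesis by simp
  qed
  define B where "B x n \<longleftrightarrow> x \<in> P (fst (prod_decode n)) (snd (prod_decode n))" for x n
  define \<psi> where "\<psi> x = base4 (B x)" for x
  have P_sets[measurable]: "P k i \<in> sets M" for k i
    unfolding P_def by (intro sets.Diff sets.finite_UN open_sets) (auto simp: X(3))
  have \<psi>_meas: "\<psi> \<in> borel_measurable M" unfolding \<psi>_def B_def by measurable
  have inj: "inj_on \<psi> X"
  proof (rule inj_onI)
    fix x y assume xy: "x \<in> X" "y \<in> X" "\<psi> x = \<psi> y"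
    then have B: "B x = B y" unfolding \<psi>_def by (intro base4_inj) simp
    have "d x y < 2 / real (Suc k)" for k
    proof -
      obtain i where i: "x \<in> P k i" using P_cover xy by blast
      have "B x (prod_encode (k, i))" using i by (simp add: B_def)
      then have "y \<in> P k i" unfolding B by (simp add: B_def)
      then show ?thesis using i P_close by blast
    qed
    then have lt: "d x y / 2 < inverse (real (Suc k))" for k by (simp add: field_simps)
    have "\<not> 0 < d x y / 2"
    proof
      assume "0 < d x y / 2"
      from reals_Archimedean[OF this] obtain k where "inverse (real (Suc k)) < d x y / 2" by auto
      with lt[of k] show False by simp
    qed
    then have "d x y = 0" using nonneg[of x y] by simp
    then show "x = y" using xy by simp
  qed
  have "\<exists>C. \<forall>k i. (\<forall>n. closedin T (C k i n)) \<and> (\<forall>n. C k i n \<subseteq> C k i (Suc n)) \<and> \<Union> (range (C k i)) = P k i"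
    using P_fs unfolding fsigma_in_ascending by metis
  then obtain C :: "nat \<Rightarrow> nat \<Rightarrow> nat \<Rightarrow> 'a set" where
      C': "\<forall>k i. (\<forall>n. closedin T (C k i n)) \<and> (\<forall>n. C k i n \<subseteq> C k i (Suc n)) \<and> \<Union> (range (C k i)) = P k i" ..
  have C: "closedin T (C k i n)" "C k i n \<subseteq> C k i (Suc n)" "\<Union> (range (C k i)) = P k i" for k i n
    using C' by auto
  have C_mono: "C k i n \<subseteq> C k i m" if "n \<le> m" for k i n m
    using C(2) that by (rule lift_Suc_mono_le)
  have CP: "C k i n \<subseteq> P k i" for k i n using C(3) by blast
  \<comment> \<open>A finite union of closed subsets of the pieces of level \<open>k\<close>; as
    \<open>n\<close> grows it exhausts the space.\<close>
  define Q where "Q k n = (\<Union>i<n. C k i n)" for k n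
  have Q_closed: "closedin T (Q k n)" for k n unfolding Q_def by (intro closedin_Union) (auto simp: C)
  have Q_UN: "(\<Union>n. Q k n) = X" for k
  proof
    show "X \<subseteq> (\<Union>n. Q k n)"
    proof
      fix x assume "x \<in> X"
      then obtain i where "x \<in> P k i" using P_cover by blast
      then obtain n where "x \<in> C k i n" using C(3) by blast
      then have "x \<in> C k i (max n (Suc i))" using C_mono[of n "max n (Suc i)"] by auto
      then have "x \<in> Q k (max n (Suc i))" unfolding Q_def by (intro UN_I[of i]) auto
      then show "x \<in> (\<Union>n. Q k n)" by blast
    qed
  qed (use CP PX in \<open>unfold Q_def, blast\<close>)
  have Q_inc: "incseq (Q k)" for k
    by (rule incseq_SucI) (use C(2) in \<open>force simp: Q_def\<close>)
  have "(\<lambda>n. measure M (Q k n)) \<longlonglongrightarrow> measure M (\<Union>n. Q k n)" for k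
    by (rule finite_Lim_measure_incseq) (use Q_closed closed_sets Q_inc in auto)
  then have Q_lim: "(\<lambda>n. measure M (Q k n)) \<longlonglongrightarrow> 1" for k
    unfolding Q_UN sp[symmetric] prob_space .
  have ex_n: "\<exists>n. 1 - e < measure M (Q k n)" if "e > 0" for e k
    using order_tendstoD(1)[OF Q_lim[of k], of "1 - e"] that by (auto simp: eventually_sequentially)
  have "\<exists>n. \<forall>k. 1 - (1/2)^(j + k) < measure M (Q k (n k))" for j
    by (rule choice) (auto intro!: ex_n)
  \<comment> \<open>The allowance at level \<open>k\<close> is \<open>(1/2)^(j + k)\<close>; summed
    over all levels this leaves a defect of at most \<open>2 * (1/2)^j\<close> for
    \<open>K j\<close>.\<close>
  then obtain n where n: "\<And>j k. 1 - (1/2)^(j + k) < measure M (Q k (n j k))" by metis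
  define K where "K j = (\<Inter>k. Q k (n j k))" for j
  have K_closed: "closedin T (K j)" for j unfolding K_def using Q_closed by (intro closedin_Inter) auto
  have KX: "K j \<subseteq> X" for j using closedin_subset[OF K_closed] X(3) by simp
  \<comment> \<open>On \<open>K j\<close> a piece of level \<open>k\<close> coincides with a closed
    set, and only finitely many pieces of that level meet \<open>K j\<close>. This yields both that
    the pieces are relatively clopen and that \<open>K j\<close> is totally bounded.\<close>
  have K_P: "K j \<inter> P k i = K j \<inter> (if i < n j k then C k i (n j k) else {})" for j k i
  proof -
    have "x \<in> (if i < n j k then C k i (n j k) else {})" if "x \<in> K j" "x \<in> P k i" for x
    proof -
      have "x \<in> Q k (n j k)" using that(1) by (auto simp: K_def)
      then obtain i' where "i' < n j k" "x \<in> C k i' (n j k)" by (auto simp: Q_def)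
      moreover have "i' = i" using calculation CP that(2) P_disj by blast
      ultimately show ?thesis by simp
    qed
    then show ?thesis using CP[of k i "n j k"] by (auto split: if_splits)
  qed
  have K_tb: "mtotally_bounded (K j)" for j
    unfolding mtotally_bounded_def
  proof (intro allI impI)
    fix e :: real assume "e > 0"
    then obtain k where k: "inverse (real (Suc k)) < e / 2" using reals_Archimedean[of "e/2"] by auto
    then have k2: "2 / real (Suc k) < e" by (simp add: field_simps)
    define I where "I = {i. i < n j k \<and> K j \<inter> P k i \<noteq> {}}"
    define p where "p i = (SOME x. x \<in> K j \<inter> P k i)" for i
    have p: "p i \<in> K j \<inter> P k i" if "i \<in> I" for i
      unfolding p_def by (rule someI_ex) (use that in \<open>auto simp: I_def\<close>)
    show "\<exists>F. finite F \<and> F \<subseteq> K j \<and> K j \<subseteq> (\<Union>x\<in>F. mball x e)"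
    proof (intro exI[of _ "p ` I"] conjI subsetI)
      show "finite (p ` I)" by (auto simp: I_def)
      show "x \<in> K j" if "x \<in> p ` I" for x using that p by blast
      fix x assume x: "x \<in> K j"
      then have xX: "x \<in> X" using KX by auto
      then obtain i where i: "x \<in> P k i" using P_cover by blast
      have "x \<in> K j \<inter> (if i < n j k then C k i (n j k) else {})" unfolding K_P[symmetric] using x i by blast
      then have "i < n j k" by (cases "i < n j k") auto
      then have iI: "i \<in> I" using x i unfolding I_def by blast
      have "d (p i) x < e" using P_close[OF _ i, of "p i"] p[OF iI] k2 by auto
      moreover have "p i \<in> X" using p[OF iI] KX by blast
      ultimately have "x \<in> mball (p i) e" using xX by simp
      with iI have "i \<in> I" "x \<in> mball (p i) e" by blast+
      then show "x \<in> (\<Union>x\<in>p ` I. mball x e)" by blast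
    qed
  qed
  have K_comp: "compactin T (K j)" for j
    using mtotally_bounded_eq_compact_closure_of[OF X(2), of "K j"] K_tb K_closed
    by (simp add: X(3) closure_of_closedin)
  have \<psi>_cont: "continuous_map (subtopology T (K j)) euclideanreal \<psi>" for j
    unfolding \<psi>_def
  proof (rule continuous_map_base4)
    fix m
    obtain k i where ki: "prod_decode m = (k, i)" by (cases "prod_decode m")
    have top: "topspace (subtopology T (K j)) = K j" using KX X(3) by auto
    have eq: "{x \<in> topspace (subtopology T (K j)). B x m} = K j \<inter> P k i"
      unfolding top by (auto simp: B_def ki)
    have cl: "closedin (subtopology T (K j)) (K j \<inter> P k i)" for k i
      unfolding K_P using C(1) by (auto intro!: closedin_subtopology_Int_closed)
    show "closedin (subtopology T (K j)) {x \<in> topspace (subtopology T (K j)). B x m}"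
      unfolding eq by (rule cl)
    have "K j - (K j \<inter> P k i) = (\<Union>i'\<in>{..<n j k} - {i}. K j \<inter> P k i')"
    proof (intro equalityI subsetI)
      fix x assume x: "x \<in> K j - (K j \<inter> P k i)"
      then obtain i' where "x \<in> P k i'" using P_cover KX by blast
      then show "x \<in> (\<Union>i'\<in>{..<n j k} - {i}. K j \<inter> P k i')"
        using x K_P[of j k i'] by (intro UN_I[of i']) (auto split: if_splits)
    qed (use P_disj in auto)
    moreover have "closedin (subtopology T (K j)) (\<Union>i'\<in>{..<n j k} - {i}. K j \<inter> P k i')"
      by (rule closedin_Union) (use cl in blast)+
    ultimately have "closedin (subtopology T (K j)) (K j - (K j \<inter> P k i))" by (simp only:)
    then show "openin (subtopology T (K j)) {x \<in> topspace (subtopology T (K j)). B x m}"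
      unfolding openin_closedin_eq eq unfolding top by auto
  qed
  have im_closed: "\<psi> ` (F \<inter> K j) \<in> sets borel" if "closedin T F" for F j
  proof -
    have "compactin T (F \<inter> K j)" using K_comp that by (intro closed_Int_compactin)
    then have "compactin (subtopology T (K j)) (F \<inter> K j)" by (simp add: compactin_subtopology)
    then have "compactin euclideanreal (\<psi> ` (F \<inter> K j))" using \<psi>_cont by (rule image_compactin)
    then show ?thesis by (simp add: compact_imp_closed)
  qed
  define X0 where "X0 = (\<Union>j. K j)"
  define R where "R = \<psi> ` X0"
  have X0X: "X0 \<subseteq> X" using KX by (auto simp: X0_def)
  have R_sets: "R \<in> sets borel"
  proof -
    have "R = (\<Union>j. \<psi> ` (X \<inter> K j))" using KX by (auto simp: R_def X0_def)
    also have "\<dots> \<in> sets borel" using im_closed[of X] X(3) by (intro sets.countable_UN) auto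
    finally show ?thesis .
  qed
  obtain x0 where x0: "x0 \<in> X" using not_empty sp by auto
  define \<xi> where "\<xi> r = (if r \<in> R then the_inv_into X0 \<psi> r else x0)" for r
  have inj0: "inj_on \<psi> X0" using inj X0X by (rule inj_on_subset)
  have \<xi>: "\<xi> r \<in> X0" "\<psi> (\<xi> r) = r" if "r \<in> R" for r
    using that inj0 by (auto simp: \<xi>_def R_def the_inv_into_f_f)
  have \<xi>_meas: "\<xi> \<in> measurable borel (borel_of T)"
  proof (rule measurable_borel_of_closed)
    have "\<xi> r \<in> X" for r
    proof (cases "r \<in> R")
      case True
      then show ?thesis using \<xi>(1) X0X by blast
    qed (simp add: \<xi>_def x0)
    then show "\<xi> \<in> space borel \<rightarrow> topspace T" by (simp add: X(3))
    fix F assume F: "closedin T F"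
    \<comment> \<open>Off \<open>R\<close> the map takes the default value \<open>x0\<close>, which
      puts all of the complement of \<open>R\<close> into the preimage exactly when
      \<open>x0\<close> lies in \<open>F\<close>.\<close>
    have "\<xi> -` F \<inter> space borel = (\<Union>j. \<psi> ` (F \<inter> K j)) \<union> (if x0 \<in> F then - R else {})"
    proof (intro equalityI subsetI)
      fix r assume r: "r \<in> \<xi> -` F \<inter> space borel"
      show "r \<in> (\<Union>j. \<psi> ` (F \<inter> K j)) \<union> (if x0 \<in> F then - R else {})"
      proof (cases "r \<in> R")
        case True
        then obtain j where "\<xi> r \<in> K j" using \<xi> by (auto simp: X0_def)
        then show ?thesis using r \<xi>(2)[OF True] by force
      qed (use r in \<open>auto simp: \<xi>_def\<close>)
    next
      fix r assume r: "r \<in> (\<Union>j. \<psi> ` (F \<inter> K j)) \<union> (if x0 \<in> F then - R else {})"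
      show "r \<in> \<xi> -` F \<inter> space borel"
      proof (cases "r \<in> R")
        case True
        then obtain j x where x: "x \<in> F" "x \<in> K j" "r = \<psi> x" using r by (auto split: if_splits)
        then have "x \<in> X0" unfolding X0_def by blast
        then have "\<xi> r = x" using True x(3) the_inv_into_f_f[OF inj0] by (simp add: \<xi>_def)
        then show ?thesis using x by auto
      next
        case False
        then have "r \<notin> (\<Union>j. \<psi> ` (F \<inter> K j))" by (auto simp: R_def X0_def)
        then show ?thesis using r False by (auto simp: \<xi>_def split: if_splits)
      qed
    qed
    also have "\<dots> \<in> sets borel" using im_closed[OF F] R_sets by auto
    finally show "\<xi> -` F \<inter> space borel \<in> sets borel" .
  qed
  have "measure M X0 \<ge> 1 - 2 * (1/2)^j" for j
  proof -
    have Kj: "K j \<in> sets M" using K_closed closed_sets by auto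
    have s: "(\<lambda>k. (1/2) ^ j * (1/2 :: real) ^ k) sums ((1/2) ^ j * (1 / (1 - 1/2)))"
      by (intro sums_mult geometric_sums) simp
    have m: "measure M (X - Q k (n j k)) \<le> (1/2) ^ j * (1/2) ^ k" for k
      using n[of j k] prob_compl[OF closed_sets[OF Q_closed[of k "n j k"]]] by (simp add: sp power_add)
    have sm: "summable (\<lambda>k. measure M (X - Q k (n j k)))"
      by (rule summable_comparison_test'[of "\<lambda>k. (1/2) ^ j * (1/2 :: real) ^ k" 0]) (use s m in \<open>auto simp: sums_iff\<close>)
    have "measure M (X - K j) = measure M (\<Union>k. X - Q k (n j k))" by (simp add: K_def)
    also have "\<dots> \<le> (\<Sum>k. measure M (X - Q k (n j k)))"
      by (rule finite_measure_subadditive_countably[OF _ sm]) (use closed_sets[OF Q_closed] sp in auto)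
    also have "\<dots> \<le> (\<Sum>k. (1/2) ^ j * (1/2 :: real) ^ k)"
      using s by (intro suminf_le m sm) (auto simp: sums_iff)
    also have "\<dots> = 2 * (1/2)^j" using s by (simp add: sums_iff)
    finally have "measure M (K j) \<ge> 1 - 2 * (1/2)^j" using prob_compl[OF Kj] by (simp add: sp)
    moreover have "measure M (K j) \<le> measure M X0"
      using K_closed closed_sets by (intro finite_measure_mono) (auto simp: X0_def)
    ultimately show ?thesis by simp
  qed
  moreover have "(\<lambda>j. 1 - 2 * (1/2 :: real)^j) \<longlonglongrightarrow> 1 - 2 * 0"
    by (intro tendsto_intros LIMSEQ_power_zero) simp
  ultimately have "measure M X0 \<ge> 1" by (intro LIMSEQ_le_const2[where X = "\<lambda>j. 1 - 2 * (1/2 :: real)^j"]) auto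
  then have "emeasure M X0 = 1" using prob_le_1[of X0] by (simp add: emeasure_eq_measure)
  moreover have "emeasure M X0 \<le> emeasure M (\<psi> -` R \<inter> space M)"
    using \<psi>_meas R_sets X0X sp by (intro emeasure_mono measurable_sets) (auto simp: R_def)
  moreover have "emeasure M (\<psi> -` R \<inter> space M) \<le> 1" by (simp add: emeasure_le_1)
  ultimately have "emeasure M (\<psi> -` R \<inter> space M) = 1" by (metis antisym)
  moreover have "\<xi> \<in> measurable borel M" using \<xi>_meas T(3) measurable_cong_sets by blast
  ultimately show ?thesis using that \<psi>_meas inj R_sets \<xi>(2) sp by metis
qed

text \<open>A fibre has at most one point, so its only nonempty subset is itself; a fibre of
  positive mass would contradict \<open>nonatomic\<close>.\<close>

lemma nonatomic_inj_fibre: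
  assumes "nonatomic M" "\<psi> \<in> borel_measurable M" "inj_on \<psi> (space M)"
  shows "emeasure M (\<psi> -` {t::real} \<inter> space M) = 0"
proof (rule ccontr)
  let ?S = "\<psi> -` {t} \<inter> space M"
  assume "emeasure M ?S \<noteq> 0"
  then have "0 < emeasure M ?S" by (simp add: zero_less_iff_neq_zero)
  moreover have S: "?S \<in> sets M" using assms(2) by (intro measurable_sets) auto
  ultimately obtain B where B: "B \<subseteq> ?S" "0 < emeasure M B" "emeasure M B < emeasure M ?S"
    using assms(1) unfolding nonatomic_def by meson
  have "B \<noteq> {}" using B by auto
  then obtain b where b: "b \<in> B" by blast
  have "?S \<subseteq> {b}" using b B(1) assms(3) by (auto simp: inj_on_def)
  then have "B = ?S" using b B(1) by blast
  then show False using B(3) by simp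
qed

text \<open>\<open>I\<close> is the quantile function of the distribution function \<open>C\<close>.
  If \<open>C\<close> exceeded \<open>u\<close> at the quantile, continuity would give a smaller
  point at which \<open>C\<close> is still at least \<open>u\<close>, against the minimality of the
  quantile.\<close>

lemma (in cdf_distribution) C_I:
  assumes "\<And>x. measure M {x} = 0" "0 < u" "u < 1"
  shows "C (I u) = u"
proof (rule antisym)
  show "u \<le> C (I u)" using assms pseudoinverse[of u "I u"] by auto
  show "C (I u) \<le> u"
  proof (rule ccontr)
    assume "\<not> C (I u) \<le> u"
    then have less: "u < C (I u)" by simp
    have "isCont C (I u)" using isCont_cdf assms(1) by simp
    then have "(C \<longlongrightarrow> C (I u)) (at_left (I u))" by (auto simp: isCont_def intro: filterlim_at_split[THEN iffD1, THEN conjunct1])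
    from order_tendstoD(1)[OF this less] have "\<forall>\<^sub>F x in at_left (I u). u < C x" .
    then obtain b where b: "b < I u" "\<And>y. b < y \<Longrightarrow> y < I u \<Longrightarrow> u < C y"
      unfolding eventually_at_left_field by blast
    obtain y where y: "b < y" "y < I u" using b(1) dense by blast
    then have "u \<le> C y" using b(2)[of y] by simp
    then have "I u \<le> y" using pseudoinverse[of u y] assms by simp
    then show False using y by simp
  qed
qed

text \<open>The quantile transform, applied to the law of the code under the measure conditioned on
  \<open>D\<close>: \<open>\<theta>\<close> takes the quantile and then decodes,
  \<open>\<phi>\<close> encodes and then applies the distribution function. Without atoms the
  distribution function is continuous, which makes the two inverse to each other.\<close>

lemma interval_iso:
  assumes "standard_borel M" "prob_space M" "nonatomic M" "D \<in> sets M" "emeasure M D \<noteq> 0"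
  obtains \<phi> :: "'a \<Rightarrow> real" and \<theta> E where
    "\<phi> \<in> borel_measurable M" "\<theta> \<in> measurable borel M" "E \<in> sets borel" "E \<subseteq> {0<..<1}" "emeasure lborel E = 1"
    "{x \<in> space M. \<theta> (\<phi> x) = x} \<in> sets M"
    "\<And>u. u \<in> E \<Longrightarrow> \<theta> u \<in> D \<and> \<phi> (\<theta> u) = u"
    "\<And>B. B \<in> sets M \<Longrightarrow> emeasure M (D \<inter> B) = emeasure M D * emeasure lborel (E \<inter> \<theta> -` B)"
proof -
  interpret prob_space M by fact
  obtain \<psi> :: "'a \<Rightarrow> real" and \<xi> R where
    \<psi>[measurable]: "\<psi> \<in> borel_measurable M" and inj: "inj_on \<psi> (space M)" and R[measurable]: "R \<in> sets borel"
    and \<xi>[measurable]: "\<xi> \<in> measurable borel M"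
    and \<psi>\<xi>: "\<And>r. r \<in> R \<Longrightarrow> \<psi> (\<xi> r) = r" and full: "emeasure M (\<psi> -` R \<inter> space M) = 1"
    by (rule standard_borel_code[OF assms(1,2)]) (rule that)
  note [measurable] = assms(4)
  define N where "N = uniform_measure M D"
  have N: "prob_space N" unfolding N_def using assms(5) by (intro prob_space_uniform_measure) auto
  then interpret N: prob_space N .
  have setsN[measurable_cong]: "sets N = sets M" by (simp add: N_def)
  have spaceN: "space N = space M" by (simp add: N_def)
  define \<nu> where "\<nu> = distr N borel \<psi>"
  interpret \<nu>: real_distribution \<nu> unfolding \<nu>_def by (rule N.real_distribution_distr) simp
  interpret \<nu>: cdf_distribution \<nu> ..
  have atom: "measure \<nu> {x} = 0" for x
  proof -
    have "emeasure N (\<psi> -` {x} \<inter> space M) \<le> 0"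
    proof -
      have "emeasure M (D \<inter> (\<psi> -` {x} \<inter> space M)) \<le> emeasure M (\<psi> -` {x} \<inter> space M)"
        by (rule emeasure_mono) auto
      then show ?thesis using nonatomic_inj_fibre[OF assms(3) \<psi> inj, of x]
        by (simp add: N_def)
    qed
    then show ?thesis by (simp add: \<nu>_def measure_def emeasure_distr spaceN)
  qed
  \<comment> \<open>The quantile function, extended by 0 outside the open unit interval so as to be
    Borel on the whole line.\<close>
  define G where "G u = indicator {0<..<1} u *\<^sub>R \<nu>.I u" for u :: real
  have G[measurable]: "G \<in> borel_measurable borel"
    unfolding G_def using \<nu>.measurable_CI by (subst borel_measurable_restrict_space_iff[symmetric]) auto
  have GI: "G u = \<nu>.I u" if "u \<in> {0<..<1}" for u using that by (simp add: G_def)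
  define \<theta> where "\<theta> u = \<xi> (G u)" for u
  define \<phi> where "\<phi> x = \<nu>.C (\<psi> x)" for x
  \<comment> \<open>For these \<open>u\<close> the quantile lies where decoding is exact, so
    \<open>\<phi>\<close> inverts \<open>\<theta>\<close> at every point of \<open>E\<close> and not
    just almost everywhere.\<close>
  define E where "E = {u \<in> {0<..<1}. G u \<in> R \<and> \<theta> u \<in> D}"
  have \<theta>[measurable]: "\<theta> \<in> measurable borel M" unfolding \<theta>_def by measurable
  have \<phi>: "\<phi> \<in> borel_measurable M" unfolding \<phi>_def by measurable
  have E[measurable]: "E \<in> sets borel" unfolding E_def by measurable
  have inv: "\<theta> u \<in> D \<and> \<phi> (\<theta> u) = u" if "u \<in> E" for u
  proof -
    have "\<psi> (\<theta> u) = \<nu>.I u" using that \<psi>\<xi>[of "G u"] GI[of u] by (auto simp: E_def \<theta>_def)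
    then show ?thesis using that \<nu>.C_I[OF atom, of u] by (simp add: \<phi>_def E_def)
  qed
  have \<xi>\<psi>: "\<xi> (\<psi> x) = x" if "x \<in> space M" "\<psi> x \<in> R" for x
    using \<psi>\<xi>[OF that(2)] inj that(1) measurable_space[OF \<xi>, of "\<psi> x"] by (simp add: inj_on_eq_iff)
  have main: "emeasure N (D \<inter> B) = emeasure lborel (E \<inter> \<theta> -` B)" if B[measurable]: "B \<in> sets M" for B
  proof -
    have ae: "AE x in N. \<psi> x \<in> R"
    proof -
      have "AE x in M. \<psi> x \<in> R"
        using full by (subst prob_Collect_eq_1[symmetric]) (auto simp: emeasure_eq_measure vimage_def Int_def conj_commute)
      then show ?thesis unfolding N_def by (intro AE_uniform_measureI) auto
    qed
    have "emeasure N (D \<inter> B) = emeasure N (\<psi> -` {r \<in> R. \<xi> r \<in> D \<inter> B} \<inter> space N)"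
    proof (rule emeasure_eq_AE)
      show "AE x in N. (x \<in> D \<inter> B) = (x \<in> \<psi> -` {r \<in> R. \<xi> r \<in> D \<inter> B} \<inter> space N)"
        using ae AE_space by eventually_elim (auto simp: \<xi>\<psi> spaceN)
      show "D \<inter> B \<in> sets N" "\<psi> -` {r \<in> R. \<xi> r \<in> D \<inter> B} \<inter> space N \<in> sets N" by measurable
    qed
    also have "\<dots> = emeasure \<nu> {r \<in> R. \<xi> r \<in> D \<inter> B}"
      unfolding \<nu>_def by (rule emeasure_distr[symmetric]) measurable
    also have "\<dots> = emeasure (distr (restrict_space lborel {0<..<1::real}) borel \<nu>.I) {r \<in> R. \<xi> r \<in> D \<inter> B}"
      by (simp only: \<nu>.distr_I_eq_M)
    also have "\<dots> = emeasure (restrict_space lborel {0<..<1::real}) (\<nu>.I -` {r \<in> R. \<xi> r \<in> D \<inter> B} \<inter> {0<..<1})"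
      by (subst emeasure_distr) (auto simp: space_restrict_space)
    also have "\<dots> = emeasure (restrict_space lborel {0<..<1::real}) (E \<inter> \<theta> -` B)"
      by (intro arg_cong[where f = "emeasure _"]) (auto simp: E_def \<theta>_def GI)
    also have "\<dots> = emeasure lborel (E \<inter> \<theta> -` B)"
      by (rule emeasure_restrict_space) (auto simp: E_def)
    finally show ?thesis .
  qed
  have ND: "emeasure N (D \<inter> B) * emeasure M D = emeasure M (D \<inter> B)" if [measurable]: "B \<in> sets M" for B
    using assms(5) unfolding N_def by (simp add: ennreal_divide_times emeasure_eq_measure divide_ennreal ennreal_mult[symmetric])
  have "emeasure N D = 1" unfolding N_def by (rule emeasure_uniform_measure_1) (use assms(5) in auto)
  then have "emeasure N (D \<inter> space M) = 1" by simp
  then have E1: "emeasure lborel (E \<inter> \<theta> -` space M) = 1" using main[of "space M"] by simp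
  moreover have "E \<inter> \<theta> -` space M = E" using measurable_space[OF \<theta>] by auto
  ultimately have "emeasure lborel E = 1" by (simp only:)
  show ?thesis
  proof (rule that)
    show "\<phi> \<in> borel_measurable M" "\<theta> \<in> measurable borel M" "E \<in> sets borel" by fact+
    show "emeasure lborel E = 1" by fact
    show "E \<subseteq> {0<..<1}" by (auto simp: E_def)
    \<comment> \<open>Equality of points is tested on their codes, which are real-valued measurable
      functions.\<close>
    have "{x \<in> space M. \<theta> (\<phi> x) = x} = {x \<in> space M. \<psi> (\<theta> (\<phi> x)) = \<psi> x}"
      using inj measurable_space[OF \<theta>] by (auto simp: inj_on_eq_iff)
    also have "\<dots> \<in> sets M" using \<phi> by measurable
    finally show "{x \<in> space M. \<theta> (\<phi> x) = x} \<in> sets M" .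
    show "\<theta> u \<in> D \<and> \<phi> (\<theta> u) = u" if "u \<in> E" for u by (rule inv[OF that])
    show "emeasure M (D \<inter> B) = emeasure M D * emeasure lborel (E \<inter> \<theta> -` B)" if "B \<in> sets M" for B
      using ND[OF that] main[OF that] by (simp add: mult.commute)
  qed
qed

section \<open>Nonsingular automorphisms and the Koopman representation\<close>

context prob_space
begin

text \<open>The real-valued Jacobian. \<open>enn2real\<close> turns infinite values into 0, which
  for a nonsingular \<open>T\<close> affects a null set only.\<close>

definition koopman_density :: "('a \<Rightarrow> 'a) \<Rightarrow> 'a \<Rightarrow> real" where
  "koopman_density T x = enn2real (RN_deriv M (distr M M T) x)"

definition koopman_fun :: "('a \<Rightarrow> 'a) \<Rightarrow> ('a \<Rightarrow> complex) \<Rightarrow> 'a \<Rightarrow> complex" where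
  "koopman_fun T f x = complex_of_real (sqrt (koopman_density T x)) * f (the_inv_into (space M) T x)"

lemma nsaD:
  assumes "T \<in> nonsingular_automorphisms M"
  shows "bij_betw T (space M) (space M)" "T \<in> measurable M M" "the_inv_into (space M) T \<in> measurable M M"
    "A \<in> sets M \<Longrightarrow> emeasure M (T ` A) = 0 \<longleftrightarrow> emeasure M A = 0"
    "x \<in> space M \<Longrightarrow> T x \<in> space M"
    "x \<in> space M \<Longrightarrow> the_inv_into (space M) T x \<in> space M"
    "x \<in> space M \<Longrightarrow> the_inv_into (space M) T (T x) = x"
    "x \<in> space M \<Longrightarrow> T (the_inv_into (space M) T x) = x"
proof -
  show b: "bij_betw T (space M) (space M)" and m: "T \<in> measurable M M"
    and m': "the_inv_into (space M) T \<in> measurable M M"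
    using assms by (auto simp: nonsingular_automorphisms_def)
  show "A \<in> sets M \<Longrightarrow> emeasure M (T ` A) = 0 \<longleftrightarrow> emeasure M A = 0"
    using assms by (auto simp: nonsingular_automorphisms_def)
  show "x \<in> space M \<Longrightarrow> T x \<in> space M" "x \<in> space M \<Longrightarrow> the_inv_into (space M) T x \<in> space M"
    using measurable_space[OF m] measurable_space[OF m'] by auto
  show "x \<in> space M \<Longrightarrow> the_inv_into (space M) T (T x) = x"
    using b by (auto simp: bij_betw_def the_inv_into_f_f)
  show "x \<in> space M \<Longrightarrow> T (the_inv_into (space M) T x) = x"
    using b by (rule f_the_inv_into_f_bij_betw) simp
qed

lemma nsaI:
  assumes "T \<in> measurable M M" "S \<in> measurable M M"
    and "\<And>x. x \<in> space M \<Longrightarrow> S (T x) = x" "\<And>x. x \<in> space M \<Longrightarrow> T (S x) = x"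
    and "\<And>A. A \<in> sets M \<Longrightarrow> emeasure M (T -` A \<inter> space M) = 0 \<longleftrightarrow> emeasure M A = 0"
  shows "T \<in> nonsingular_automorphisms M" "\<And>x. x \<in> space M \<Longrightarrow> the_inv_into (space M) T x = S x"
proof -
  have b: "bij_betw T (space M) (space M)"
    using measurable_space[OF assms(1)] measurable_space[OF assms(2)] assms(3,4)
    by (intro bij_betwI[where g = S]) auto
  then have inj: "inj_on T (space M)" by (simp add: bij_betw_def)
  show inv: "the_inv_into (space M) T x = S x" if "x \<in> space M" for x
    using the_inv_into_f_f[OF inj, of "S x"] assms(4)[OF that] measurable_space[OF assms(2) that] by simp
  have "the_inv_into (space M) T \<in> measurable M M"
    using assms(2) inv by (subst measurable_cong[of M _ S]) auto
  moreover have "emeasure M (T ` A) = 0 \<longleftrightarrow> emeasure M A = 0" if A: "A \<in> sets M" for A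
  proof -
    have A': "A \<subseteq> space M" using A by (rule sets.sets_into_space)
    have eq: "T ` A = S -` A \<inter> space M"
    proof (intro equalityI subsetI)
      fix y assume "y \<in> S -` A \<inter> space M"
      then show "y \<in> T ` A" using assms(4)[of y] by (intro image_eqI[of _ _ "S y"]) auto
    qed (use A' assms(3) measurable_space[OF assms(1)] in auto)
    have "T -` (T ` A) \<inter> space M = A"
      using A' inj by (auto simp: inj_on_def)
    moreover have "T ` A \<in> sets M" unfolding eq using assms(2) A by (rule measurable_sets)
    ultimately show ?thesis using assms(5)[of "T ` A"] by simp
  qed
  ultimately show "T \<in> nonsingular_automorphisms M"
    using b assms(1) by (simp add: nonsingular_automorphisms_def)
qed

lemma nsa_vimage_null:
  assumes T: "T \<in> nonsingular_automorphisms M" and A: "A \<in> sets M"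
  shows "emeasure M (T -` A \<inter> space M) = 0 \<longleftrightarrow> emeasure M A = 0"
proof -
  have "T ` (T -` A \<inter> space M) = A"
  proof (intro equalityI subsetI)
    fix y assume "y \<in> A"
    then have "y \<in> space M" using A sets.sets_into_space by auto
    then show "y \<in> T ` (T -` A \<inter> space M)"
      using nsaD[OF T] \<open>y \<in> A\<close> by (intro image_eqI[of _ _ "the_inv_into (space M) T y"]) auto
  qed auto
  moreover have "T -` A \<inter> space M \<in> sets M" using nsaD(2)[OF T] A by (rule measurable_sets)
  ultimately show ?thesis using nsaD(4)[OF T, of "T -` A \<inter> space M"] by simp
qed

lemma nsa_id: "id \<in> nonsingular_automorphisms M"
  by (rule nsaI(1)[of id id]) (auto simp: vimage_def Int_absorb2 sets.sets_into_space Int_def[symmetric])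

lemma nsa_comp:
  assumes "S \<in> nonsingular_automorphisms M" "T \<in> nonsingular_automorphisms M"
  shows "S \<circ> T \<in> nonsingular_automorphisms M"
    "x \<in> space M \<Longrightarrow> the_inv_into (space M) (S \<circ> T) x = the_inv_into (space M) T (the_inv_into (space M) S x)"
proof -
  let ?R = "the_inv_into (space M) T \<circ> the_inv_into (space M) S"
  have 1: "S \<circ> T \<in> measurable M M" "?R \<in> measurable M M"
    using nsaD(2,3)[OF assms(1)] nsaD(2,3)[OF assms(2)] by (auto intro: measurable_comp)
  have 2: "?R ((S \<circ> T) x) = x" "(S \<circ> T) (?R x) = x" if "x \<in> space M" for x
    using that nsaD(5-8)[OF assms(1)] nsaD(5-8)[OF assms(2)] by auto
  have 3: "emeasure M ((S \<circ> T) -` A \<inter> space M) = 0 \<longleftrightarrow> emeasure M A = 0" if A: "A \<in> sets M" for A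
  proof -
    have "(S \<circ> T) -` A \<inter> space M = T -` (S -` A \<inter> space M) \<inter> space M"
      using nsaD(5)[OF assms(2)] by auto
    moreover have "S -` A \<inter> space M \<in> sets M" using nsaD(2)[OF assms(1)] A by (rule measurable_sets)
    ultimately show ?thesis
      using nsa_vimage_null[OF assms(1) A] nsa_vimage_null[OF assms(2), of "S -` A \<inter> space M"] by (simp only:)
  qed
  show "S \<circ> T \<in> nonsingular_automorphisms M" by (rule nsaI(1)[OF 1 2 3])
  show "x \<in> space M \<Longrightarrow> the_inv_into (space M) (S \<circ> T) x = the_inv_into (space M) T (the_inv_into (space M) S x)"
    using nsaI(2)[OF 1 2 3] by simp
qed

lemma nsa_inv:
  assumes T: "T \<in> nonsingular_automorphisms M"
  shows "the_inv_into (space M) T \<in> nonsingular_automorphisms M"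
proof (rule nsaI(1)[OF nsaD(3)[OF T] nsaD(2)[OF T] nsaD(8)[OF T] nsaD(7)[OF T]])
  fix A assume A: "A \<in> sets M"
  have "the_inv_into (space M) T -` A \<inter> space M = T ` A"
  proof (intro equalityI subsetI)
    fix y assume "y \<in> the_inv_into (space M) T -` A \<inter> space M"
    then show "y \<in> T ` A" using nsaD(8)[OF T, of y] by (intro image_eqI[of _ _ "the_inv_into (space M) T y"]) auto
  next
    fix y assume "y \<in> T ` A"
    then show "y \<in> the_inv_into (space M) T -` A \<inter> space M"
      using nsaD(5,7)[OF T] sets.sets_into_space[OF A] by auto
  qed
  then show "emeasure M (the_inv_into (space M) T -` A \<inter> space M) = 0 \<longleftrightarrow> emeasure M A = 0"
    using nsaD(4)[OF T A] by simp
qed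

lemma nsa_AE:
  assumes T: "T \<in> nonsingular_automorphisms M" and "AE x in M. P x"
  shows "AE x in M. P (T x)"
proof -
  obtain N where N: "{x \<in> space M. \<not> P x} \<subseteq> N" "N \<in> sets M" "emeasure M N = 0"
    using assms(2) by (auto elim!: AE_E)
  show ?thesis
  proof (rule AE_I)
    show "{x \<in> space M. \<not> P (T x)} \<subseteq> T -` N \<inter> space M"
      using N(1) nsaD(5)[OF T] by auto
    show "emeasure M (T -` N \<inter> space M) = 0" using nsa_vimage_null[OF T N(2)] N(3) by simp
    show "T -` N \<inter> space M \<in> sets M" using nsaD(2)[OF T] N(2) by (rule measurable_sets)
  qed
qed

lemma koopman_density_measurable [measurable]: "koopman_density T \<in> borel_measurable M"
  unfolding koopman_density_def by measurable

lemma koopman_density_nonneg: "0 \<le> koopman_density T x"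
  by (simp add: koopman_density_def)

lemma density_koopman_density:
  assumes T: "T \<in> nonsingular_automorphisms M"
  shows "density M (\<lambda>x. ennreal (koopman_density T x)) = distr M M T"
proof -
  note [measurable] = nsaD(2)[OF T]
  interpret D: prob_space "distr M M T" by (rule prob_space_distr) simp
  have ac: "absolutely_continuous M (distr M M T)"
    unfolding absolutely_continuous_def
  proof
    fix A assume "A \<in> null_sets M"
    then have A: "A \<in> sets M" "emeasure M A = 0" by auto
    then show "A \<in> null_sets (distr M M T)"
      using nsa_vimage_null[OF T A(1)] by (auto simp: null_sets_def emeasure_distr)
  qed
  have "AE x in M. RN_deriv M (distr M M T) x \<noteq> \<infinity>"
    using ac D.sigma_finite_measure_axioms by (intro RN_deriv_finite) auto
  then have "AE x in M. ennreal (koopman_density T x) = RN_deriv M (distr M M T) x"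
    by eventually_elim (simp add: koopman_density_def ennreal_enn2real top.not_eq_extremum)
  then have "density M (\<lambda>x. ennreal (koopman_density T x)) = density M (RN_deriv M (distr M M T))"
    by (intro density_cong) auto
  also have "\<dots> = distr M M T" using ac by (intro density_RN_deriv) auto
  finally show ?thesis .
qed

lemma nn_integral_koopman_density:
  assumes T: "T \<in> nonsingular_automorphisms M" and [measurable]: "f \<in> borel_measurable M"
  shows "(\<integral>\<^sup>+x. ennreal (koopman_density T x) * f x \<partial>M) = (\<integral>\<^sup>+x. f (T x) \<partial>M)"
proof -
  note [measurable] = nsaD(2)[OF T]
  have "(\<integral>\<^sup>+x. ennreal (koopman_density T x) * f x \<partial>M) = (\<integral>\<^sup>+x. f x \<partial>density M (\<lambda>x. ennreal (koopman_density T x)))"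
    by (simp add: nn_integral_density)
  also have "\<dots> = (\<integral>\<^sup>+x. f (T x) \<partial>M)"
    unfolding density_koopman_density[OF T] by (simp add: nn_integral_distr)
  finally show ?thesis .
qed

text \<open>Uniqueness of Radon-Nikodym densities, localised by an indicator. The restriction to
  \<open>B\<close> allows a Jacobian to be identified on one cell at a time.\<close>

lemma koopman_density_unique:
  assumes T: "T \<in> nonsingular_automorphisms M" and B[measurable]: "B \<in> sets M"
    and g[measurable]: "g \<in> borel_measurable M" and g0: "\<And>x. 0 \<le> g x"
    and eq: "\<And>A. A \<in> sets M \<Longrightarrow> A \<subseteq> B \<Longrightarrow> emeasure M (T -` A \<inter> space M) = (\<integral>\<^sup>+x. ennreal (g x) * indicator A x \<partial>M)"
  shows "AE x in M. x \<in> B \<longrightarrow> koopman_density T x = g x"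
proof -
  note [measurable] = nsaD(2)[OF T]
  have "density M (\<lambda>x. ennreal (koopman_density T x) * indicator B x) = density M (\<lambda>x. ennreal (g x) * indicator B x)"
  proof (rule measure_eqI)
    fix A assume "A \<in> sets (density M (\<lambda>x. ennreal (koopman_density T x) * indicator B x))"
    then have A[measurable]: "A \<in> sets M" by simp
    have "emeasure (density M (\<lambda>x. ennreal (koopman_density T x) * indicator B x)) A
        = (\<integral>\<^sup>+x. ennreal (koopman_density T x) * indicator (A \<inter> B) x \<partial>M)"
      by (subst emeasure_density) (auto intro!: nn_integral_cong simp: indicator_def)
    also have "\<dots> = (\<integral>\<^sup>+x. indicator (A \<inter> B) (T x) \<partial>M)"
      by (rule nn_integral_koopman_density[OF T]) simp
    also have "\<dots> = (\<integral>\<^sup>+x. indicator (T -` (A \<inter> B) \<inter> space M) x \<partial>M)"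
      by (intro nn_integral_cong) (auto simp: indicator_def)
    also have "\<dots> = emeasure M (T -` (A \<inter> B) \<inter> space M)"
      by (rule nn_integral_indicator) measurable
    also have "\<dots> = (\<integral>\<^sup>+x. ennreal (g x) * indicator (A \<inter> B) x \<partial>M)" by (rule eq) auto
    also have "\<dots> = emeasure (density M (\<lambda>x. ennreal (g x) * indicator B x)) A"
      by (subst emeasure_density) (auto intro!: nn_integral_cong simp: indicator_def)
    finally show "emeasure (density M (\<lambda>x. ennreal (koopman_density T x) * indicator B x)) A
      = emeasure (density M (\<lambda>x. ennreal (g x) * indicator B x)) A" .
  qed simp
  then have "AE x in M. ennreal (koopman_density T x) * indicator B x = ennreal (g x) * indicator B x"
    by (intro density_unique) auto
  then show ?thesis
    by eventually_elim (auto simp: indicator_def ennreal_inj koopman_density_nonneg g0)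
qed

lemma koopman_density_const:
  assumes T: "T \<in> nonsingular_automorphisms M" and B[measurable]: "B \<in> sets M" and "0 \<le> c"
    and eq: "\<And>A. A \<in> sets M \<Longrightarrow> A \<subseteq> B \<Longrightarrow> emeasure M (T -` A \<inter> space M) = ennreal c * emeasure M A"
  shows "AE x in M. x \<in> B \<longrightarrow> koopman_density T x = c"
  by (rule koopman_density_unique[OF T B]) (use assms in \<open>auto simp: nn_integral_cmult\<close>)

text \<open>The preimage of the zero set of the density has mass equal to the integral of the
  density over that set, which is 0; nonsingularity then makes the zero set itself null.\<close>

lemma koopman_density_pos:
  assumes T: "T \<in> nonsingular_automorphisms M"
  shows "AE x in M. 0 < koopman_density T x"
proof -
  note [measurable] = nsaD(2)[OF T]
  let ?A = "{x \<in> space M. koopman_density T x = 0}"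
  have A[measurable]: "?A \<in> sets M" by measurable
  have "emeasure M (T -` ?A \<inter> space M) = (\<integral>\<^sup>+x. indicator (T -` ?A \<inter> space M) x \<partial>M)"
    by (rule nn_integral_indicator[symmetric]) measurable
  also have "\<dots> = (\<integral>\<^sup>+x. indicator ?A (T x) \<partial>M)" by (intro nn_integral_cong) (auto simp: indicator_def)
  also have "\<dots> = (\<integral>\<^sup>+x. ennreal (koopman_density T x) * indicator ?A x \<partial>M)"
    by (rule nn_integral_koopman_density[OF T, symmetric]) simp
  also have "\<dots> = (\<integral>\<^sup>+x. 0 \<partial>M)" by (intro nn_integral_cong) (auto simp: indicator_def)
  finally have "emeasure M ?A = 0" using nsa_vimage_null[OF T A] by simp
  then have "AE x in M. koopman_density T x \<noteq> 0" by (subst AE_iff_measurable[OF A]) auto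
  then show ?thesis by eventually_elim (use koopman_density_nonneg in \<open>auto simp: less_le\<close>)
qed

text \<open>The chain rule: two changes of variables, first along \<open>S\<close> and then along
  \<open>T\<close>, turn the integral of the product into the mass of a preimage under the
  composition, and densities are unique.\<close>

lemma koopman_density_comp:
  assumes S: "S \<in> nonsingular_automorphisms M" and T: "T \<in> nonsingular_automorphisms M"
  shows "AE x in M. koopman_density (S \<circ> T) x
      = koopman_density S x * koopman_density T (the_inv_into (space M) S x)"
proof -
  note [measurable] = nsaD(2,3)[OF S] nsaD(2,3)[OF T]
  let ?g = "\<lambda>x. koopman_density S x * koopman_density T (the_inv_into (space M) S x)"
  have "AE x in M. x \<in> space M \<longrightarrow> koopman_density (S \<circ> T) x = ?g x"
  proof (rule koopman_density_unique[OF nsa_comp(1)[OF S T]])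
    fix A assume A[measurable]: "A \<in> sets M"
    have "(\<integral>\<^sup>+x. ennreal (?g x) * indicator A x \<partial>M)
       = (\<integral>\<^sup>+x. ennreal (koopman_density S x) * (ennreal (koopman_density T (the_inv_into (space M) S x)) * indicator A x) \<partial>M)"
      by (intro nn_integral_cong) (simp add: ennreal_mult koopman_density_nonneg mult_ac)
    also have "\<dots> = (\<integral>\<^sup>+x. ennreal (koopman_density T (the_inv_into (space M) S (S x))) * indicator A (S x) \<partial>M)"
      by (rule nn_integral_koopman_density[OF S]) measurable
    also have "\<dots> = (\<integral>\<^sup>+x. ennreal (koopman_density T x) * indicator A (S x) \<partial>M)"
      by (intro nn_integral_cong) (simp add: nsaD(7)[OF S])
    also have "\<dots> = (\<integral>\<^sup>+x. indicator A (S (T x)) \<partial>M)"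
      by (rule nn_integral_koopman_density[OF T]) measurable
    also have "\<dots> = (\<integral>\<^sup>+x. indicator ((S \<circ> T) -` A \<inter> space M) x \<partial>M)"
      by (intro nn_integral_cong) (auto simp: indicator_def)
    also have "\<dots> = emeasure M ((S \<circ> T) -` A \<inter> space M)"
      by (rule nn_integral_indicator) measurable
    finally show "emeasure M ((S \<circ> T) -` A \<inter> space M) = (\<integral>\<^sup>+x. ennreal (?g x) * indicator A x \<partial>M)" by simp
  qed (auto simp: koopman_density_nonneg)
  then show ?thesis using AE_space by eventually_elim auto
qed

lemma koopman_density_id: "AE x in M. koopman_density id x = 1"
proof -
  have "AE x in M. x \<in> space M \<longrightarrow> koopman_density id x = 1"
    by (rule koopman_density_const[OF nsa_id]) (auto simp: vimage_def Int_absorb2 sets.sets_into_space Int_def[symmetric])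
  then show ?thesis using AE_space by eventually_elim auto
qed

text \<open>Both ingredients of the Koopman operator depend only on the class of the automorphism.
  For the inverses, the almost sure equality is read at the points moved back by \<open>T\<close>,
  which nonsingularity permits.\<close>

lemma koopman_density_cong:
  assumes S: "S \<in> nonsingular_automorphisms M" and T: "T \<in> nonsingular_automorphisms M"
    and ae: "AE x in M. S x = T x"
  shows "koopman_density S = koopman_density T"
    "AE x in M. the_inv_into (space M) S x = the_inv_into (space M) T x"
proof -
  have "distr M M S = distr M M T"
    using ae nsaD(2)[OF S] nsaD(2)[OF T] by (intro distr_cong_AE) auto
  then show "koopman_density S = koopman_density T" by (simp add: koopman_density_def fun_eq_iff)
  have "AE x in M. S (the_inv_into (space M) T x) = T (the_inv_into (space M) T x)"
    using nsa_AE[OF nsa_inv[OF T] ae] .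
  then show "AE x in M. the_inv_into (space M) S x = the_inv_into (space M) T x"
    using AE_space
  proof eventually_elim
    case (elim x)
    then have "S (the_inv_into (space M) T x) = x" using nsaD(8)[OF T] by simp
    then show ?case using nsaD(7)[OF S, of "the_inv_into (space M) T x"] nsaD(6)[OF T] elim by simp
  qed
qed

text \<open>Change of variables followed by cancelling \<open>T\<close> against its inverse. Vector
  values are allowed because norms need real integrands and inner products complex ones.\<close>

lemma koopman_integral:
  fixes F :: "'a \<Rightarrow> 'b::{banach, second_countable_topology}"
  assumes T: "T \<in> nonsingular_automorphisms M" and [measurable]: "F \<in> borel_measurable M"
  shows "integrable M (\<lambda>x. koopman_density T x *\<^sub>R F (the_inv_into (space M) T x)) \<longleftrightarrow> integrable M F"
    "(LINT x|M. koopman_density T x *\<^sub>R F (the_inv_into (space M) T x)) = (LINT x|M. F x)"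
proof -
  note [measurable] = nsaD(2,3)[OF T]
  have "integrable M (\<lambda>x. koopman_density T x *\<^sub>R F (the_inv_into (space M) T x))
     \<longleftrightarrow> integrable (distr M M T) (\<lambda>x. F (the_inv_into (space M) T x))"
    unfolding density_koopman_density[OF T, symmetric]
    by (subst integrable_density) (auto simp: koopman_density_nonneg)
  also have "\<dots> \<longleftrightarrow> integrable M (\<lambda>x. F (the_inv_into (space M) T (T x)))"
    by (subst integrable_distr_eq) auto
  also have "\<dots> \<longleftrightarrow> integrable M F"
    by (rule Bochner_Integration.integrable_cong) (auto simp: nsaD(7)[OF T])
  finally show "integrable M (\<lambda>x. koopman_density T x *\<^sub>R F (the_inv_into (space M) T x)) \<longleftrightarrow> integrable M F" .
  have "(LINT x|M. koopman_density T x *\<^sub>R F (the_inv_into (space M) T x))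
     = (LINT x|distr M M T. F (the_inv_into (space M) T x))"
    unfolding density_koopman_density[OF T, symmetric]
    by (subst integral_density) (auto simp: koopman_density_nonneg)
  also have "\<dots> = (LINT x|M. F (the_inv_into (space M) T (T x)))"
    by (subst integral_distr) auto
  also have "\<dots> = (LINT x|M. F x)"
    by (intro Bochner_Integration.integral_cong) (auto simp: nsaD(7)[OF T])
  finally show "(LINT x|M. koopman_density T x *\<^sub>R F (the_inv_into (space M) T x)) = (LINT x|M. F x)" .
qed

end

lemma ae_eq_on_equiv: "equiv S (ae_eq_on M S)"
proof (rule equivI)
  show "refl_on S (ae_eq_on M S)" by (auto simp: refl_on_def ae_eq_on_def)
  show "sym (ae_eq_on M S)" by (auto simp: sym_def ae_eq_on_def)
  show "trans (ae_eq_on M S)"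
  proof (rule transI)
    fix f g h assume "(f, g) \<in> ae_eq_on M S" "(g, h) \<in> ae_eq_on M S"
    then have "f \<in> S" "h \<in> S" "AE x in M. f x = g x" "AE x in M. g x = h x" by (auto simp: ae_eq_on_def)
    then show "(f, h) \<in> ae_eq_on M S" by (auto simp: ae_eq_on_def)
  qed
qed (auto simp: ae_eq_on_def)

lemma rep_ae_eq:
  assumes "f \<in> S"
  shows "rep (ae_eq_on M S `` {f}) \<in> S" "AE x in M. rep (ae_eq_on M S `` {f}) x = f x"
proof -
  have "f \<in> ae_eq_on M S `` {f}" using assms by (auto simp: ae_eq_on_def)
  then have "rep (ae_eq_on M S `` {f}) \<in> ae_eq_on M S `` {f}" unfolding rep_def
    by (rule someI[where P = "\<lambda>g. g \<in> ae_eq_on M S `` {f}"])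
  then show "rep (ae_eq_on M S `` {f}) \<in> S" "AE x in M. rep (ae_eq_on M S `` {f}) x = f x"
    by (auto simp: ae_eq_on_def)
qed

lemma rep_quotient:
  assumes "C \<in> S // ae_eq_on M S"
  shows "rep C \<in> S" "ae_eq_on M S `` {rep C} = C"
proof -
  obtain f where f: "f \<in> S" "C = ae_eq_on M S `` {f}" using assms by (auto elim: quotientE)
  show "rep C \<in> S" unfolding f(2) by (rule rep_ae_eq(1)[OF f(1)])
  have "(rep C, f) \<in> ae_eq_on M S" using rep_ae_eq[OF f(1), of M] f by (auto simp: ae_eq_on_def)
  then show "ae_eq_on M S `` {rep C} = C" unfolding f(2) by (rule equiv_class_eq[OF ae_eq_on_equiv])
qed

lemma ae_class_eq_iff:
  assumes "f \<in> S" "g \<in> S"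
  shows "ae_eq_on M S `` {f} = ae_eq_on M S `` {g} \<longleftrightarrow> (AE x in M. f x = g x)"
  using eq_equiv_class_iff[OF ae_eq_on_equiv assms] assms by (auto simp: ae_eq_on_def)

section \<open>Square integrable functions and the Koopman action on them\<close>

context prob_space
begin

definition l2dist :: "('a \<Rightarrow> complex) \<Rightarrow> ('a \<Rightarrow> complex) \<Rightarrow> real" where
  "l2dist f g = sqrt (LINT x|M. (cmod (f x - g x))\<^sup>2)"

lemma sqD: "f \<in> square_integrable M \<Longrightarrow> f \<in> borel_measurable M"
  "f \<in> square_integrable M \<Longrightarrow> integrable M (\<lambda>x. (cmod (f x))\<^sup>2)"
  by (auto simp: square_integrable_def)

lemma sq_bound:
  assumes "f \<in> borel_measurable M" "integrable M g" "\<And>x. x \<in> space M \<Longrightarrow> (cmod (f x))\<^sup>2 \<le> g x"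
  shows "f \<in> square_integrable M"
  unfolding square_integrable_def
proof (intro CollectI conjI assms(1))
  show "integrable M (\<lambda>x. (cmod (f x))\<^sup>2)"
  proof (rule Bochner_Integration.integrable_bound[OF assms(2)])
    show "AE x in M. norm ((cmod (f x))\<^sup>2) \<le> norm (g x)"
    proof (rule AE_I2)
      show "norm ((cmod (f x))\<^sup>2) \<le> norm (g x)" if "x \<in> space M" for x
        using assms(3)[OF that] by simp
    qed
  qed (use assms(1) in measurable)
qed

text \<open>Young's inequality with free weights. Taking for \<open>a\<close> and \<open>b\<close>
  the two norms themselves makes the integrated form equal to Minkowski's inequality.\<close>

lemma cmod_add_square_le:
  assumes "0 < a" "0 < b"
  shows "(cmod (x + y))\<^sup>2 \<le> (1 + b / a) * (cmod x)\<^sup>2 + (1 + a / b) * (cmod y)\<^sup>2"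
proof -
  have "0 \<le> (b * cmod x - a * cmod y)\<^sup>2 / (a * b)" using assms by simp
  also have "\<dots> = b / a * (cmod x)\<^sup>2 + a / b * (cmod y)\<^sup>2 - 2 * cmod x * cmod y"
    using assms by (simp add: power2_diff field_simps power2_eq_square)
  finally have "2 * cmod x * cmod y \<le> b / a * (cmod x)\<^sup>2 + a / b * (cmod y)\<^sup>2" by simp
  moreover have "(cmod (x + y))\<^sup>2 \<le> (cmod x + cmod y)\<^sup>2"
    by (intro power_mono norm_triangle_ineq) simp
  ultimately show ?thesis by (simp add: power2_sum algebra_simps)
qed

lemma sq_scale: "f \<in> square_integrable M \<Longrightarrow> (\<lambda>x. c * f x) \<in> square_integrable M"
  by (rule sq_bound[where g = "\<lambda>x. (cmod c)\<^sup>2 * (cmod (f x))\<^sup>2"])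
    (auto simp: sqD norm_mult power_mult_distrib intro!: borel_measurable_times)

lemma sq_add:
  assumes "f \<in> square_integrable M" "g \<in> square_integrable M"
  shows "(\<lambda>x. f x + g x) \<in> square_integrable M"
proof (rule sq_bound)
  show "(cmod (f x + g x))\<^sup>2 \<le> (1 + 1 / 1) * (cmod (f x))\<^sup>2 + (1 + 1 / 1) * (cmod (g x))\<^sup>2" for x
    by (rule cmod_add_square_le) auto
  show "integrable M (\<lambda>x. (1 + 1 / 1) * (cmod (f x))\<^sup>2 + (1 + 1 / 1) * (cmod (g x))\<^sup>2)"
    using assms sqD by auto
  show "(\<lambda>x. f x + g x) \<in> borel_measurable M" using assms sqD by auto
qed

lemma sq_diff:
  assumes "f \<in> square_integrable M" "g \<in> square_integrable M"
  shows "(\<lambda>x. f x - g x) \<in> square_integrable M"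
  using sq_add[OF assms(1) sq_scale[OF assms(2), of "-1"]] by simp

lemma sq_indicator: "A \<in> sets M \<Longrightarrow> indicator A \<in> square_integrable M"
  by (rule sq_bound[where g = "\<lambda>_. 1"]) (auto simp: indicator_def)

lemma sq_sum:
  assumes "\<And>i. i \<in> I \<Longrightarrow> f i \<in> square_integrable M"
  shows "(\<lambda>x. \<Sum>i\<in>I. f i x) \<in> square_integrable M"
  using assms
proof (induction I rule: infinite_finite_induct)
  case (insert i I)
  then show ?case using sq_add[of "f i" "\<lambda>x. \<Sum>i\<in>I. f i x"] by simp
qed (auto simp: square_integrable_def)

lemma l2dist_nonneg: "0 \<le> l2dist f g"
  by (simp add: l2dist_def)

lemma l2dist_commute: "l2dist f g = l2dist g f"
  by (simp add: l2dist_def norm_minus_commute)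

lemma l2dist_refl [simp]: "l2dist f f = 0"
  by (simp add: l2dist_def)

lemma l2dist_sq: "(l2dist f g)\<^sup>2 = (LINT x|M. (cmod (f x - g x))\<^sup>2)"
  by (simp add: l2dist_def)

lemma l2dist_triangle:
  assumes f: "f \<in> square_integrable M" and g: "g \<in> square_integrable M" and h: "h \<in> square_integrable M"
  shows "l2dist f h \<le> l2dist f g + l2dist g h"
proof (rule field_le_epsilon)
  fix e :: real assume e: "0 < e"
  \<comment> \<open>The summand \<open>e/2\<close> keeps the weights positive even when a distance
    vanishes.\<close>
  define a where "a = l2dist f g + e/2"
  define b where "b = l2dist g h + e/2"
  have a: "0 < a" and b: "0 < b" using e l2dist_nonneg[of f g] l2dist_nonneg[of g h] by (auto simp: a_def b_def)
  have i: "integrable M (\<lambda>x. (cmod (f x - g x))\<^sup>2)" "integrable M (\<lambda>x. (cmod (g x - h x))\<^sup>2)"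
      "integrable M (\<lambda>x. (cmod (f x - h x))\<^sup>2)"
    using sqD(2)[OF sq_diff[OF f g]] sqD(2)[OF sq_diff[OF g h]] sqD(2)[OF sq_diff[OF f h]] by auto
  have "(l2dist f h)\<^sup>2 \<le> (LINT x|M. (1 + b / a) * (cmod (f x - g x))\<^sup>2 + (1 + a / b) * (cmod (g x - h x))\<^sup>2)"
    unfolding l2dist_sq
  proof (rule integral_mono)
    show "(cmod (f x - h x))\<^sup>2 \<le> (1 + b / a) * (cmod (f x - g x))\<^sup>2 + (1 + a / b) * (cmod (g x - h x))\<^sup>2" for x
      using cmod_add_square_le[OF a b, of "f x - g x" "g x - h x"] by simp
  qed (use i in auto)
  also have "\<dots> = (1 + b / a) * (l2dist f g)\<^sup>2 + (1 + a / b) * (l2dist g h)\<^sup>2"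
    using i by (simp add: l2dist_sq)
  also have "\<dots> \<le> (1 + b / a) * a\<^sup>2 + (1 + a / b) * b\<^sup>2"
    using a b e l2dist_nonneg[of f g] l2dist_nonneg[of g h]
    by (intro add_mono mult_left_mono power_mono) (auto simp: a_def b_def)
  also have "(1 + b / a) * a\<^sup>2 = a\<^sup>2 + a * b" using a by (simp add: power2_eq_square field_simps)
  also have "(1 + a / b) * b\<^sup>2 = b\<^sup>2 + a * b" using b by (simp add: power2_eq_square field_simps)
  also have "a\<^sup>2 + a * b + (b\<^sup>2 + a * b) = (a + b)\<^sup>2" by (simp add: power2_sum)
  finally have "l2dist f h \<le> a + b" by (rule power2_le_imp_le) (use a b in auto)
  then show "l2dist f h \<le> l2dist f g + l2dist g h + e" by (simp add: a_def b_def)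
qed

lemma l2dist_eq_0_iff:
  assumes f: "f \<in> square_integrable M" and g: "g \<in> square_integrable M"
  shows "l2dist f g = 0 \<longleftrightarrow> (AE x in M. f x = g x)"
proof -
  have "l2dist f g = 0 \<longleftrightarrow> (LINT x|M. (cmod (f x - g x))\<^sup>2) = 0" by (simp add: l2dist_def)
  also have "\<dots> \<longleftrightarrow> (AE x in M. (cmod (f x - g x))\<^sup>2 = 0)"
    by (rule integral_nonneg_eq_0_iff_AE) (use sqD(2)[OF sq_diff[OF f g]] in auto)
  finally show ?thesis by simp
qed

lemma l2dist_cong:
  assumes "f \<in> square_integrable M" "g \<in> square_integrable M" "f' \<in> square_integrable M" "g' \<in> square_integrable M"
    and "AE x in M. f x = f' x" "AE x in M. g x = g' x"
  shows "l2dist f g = l2dist f' g'"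
proof -
  have "AE x in M. (cmod (f x - g x))\<^sup>2 = (cmod (f' x - g' x))\<^sup>2" using assms(5,6) by eventually_elim simp
  then have "(LINT x|M. (cmod (f x - g x))\<^sup>2) = (LINT x|M. (cmod (f' x - g' x))\<^sup>2)"
    using assms(1-4)[THEN sqD(1)] by (intro integral_cong_AE) auto
  then show ?thesis by (simp add: l2dist_def)
qed

lemma koopman_fun_measurable:
  assumes T: "T \<in> nonsingular_automorphisms M" and f: "f \<in> borel_measurable M"
  shows "koopman_fun T f \<in> borel_measurable M"
  using nsaD(3)[OF T] f unfolding koopman_fun_def by measurable

lemma cmod_koopman_fun: "(cmod (koopman_fun T f x))\<^sup>2 = koopman_density T x * (cmod (f (the_inv_into (space M) T x)))\<^sup>2"
  using koopman_density_nonneg[of T x] by (simp add: koopman_fun_def norm_mult power_mult_distrib)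

lemma koopman_fun_sq:
  assumes T: "T \<in> nonsingular_automorphisms M" and f: "f \<in> square_integrable M"
  shows "koopman_fun T f \<in> square_integrable M"
  using koopman_fun_measurable[OF T sqD(1)[OF f]] koopman_integral(1)[OF T, of "\<lambda>x. (cmod (f x))\<^sup>2"] sqD[OF f]
  by (simp add: square_integrable_def cmod_koopman_fun)

lemma koopman_fun_add: "koopman_fun T (\<lambda>x. f x + g x) x = koopman_fun T f x + koopman_fun T g x"
  by (simp add: koopman_fun_def algebra_simps)

lemma koopman_fun_diff: "koopman_fun T (\<lambda>x. f x - g x) x = koopman_fun T f x - koopman_fun T g x"
  by (simp add: koopman_fun_def algebra_simps)

lemma koopman_fun_scale: "koopman_fun T (\<lambda>x. c * f x) x = c * koopman_fun T f x"
  by (simp add: koopman_fun_def algebra_simps)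

lemma koopman_fun_isometry:
  assumes T: "T \<in> nonsingular_automorphisms M" and f: "f \<in> square_integrable M" and g: "g \<in> square_integrable M"
  shows "l2dist (koopman_fun T f) (koopman_fun T g) = l2dist f g"
proof -
  have "(LINT x|M. (cmod (koopman_fun T f x - koopman_fun T g x))\<^sup>2) = (LINT x|M. (cmod (f x - g x))\<^sup>2)"
    using koopman_integral(2)[OF T, of "\<lambda>x. (cmod (f x - g x))\<^sup>2"] sqD(1)[OF sq_diff[OF f g]]
    unfolding koopman_fun_diff[symmetric] cmod_koopman_fun by simp
  then show ?thesis by (simp add: l2dist_def)
qed

lemma koopman_fun_inner:
  assumes T: "T \<in> nonsingular_automorphisms M" and f: "f \<in> square_integrable M" and g: "g \<in> square_integrable M"
  shows "(LINT x|M. koopman_fun T f x * cnj (koopman_fun T g x)) = (LINT x|M. f x * cnj (g x))"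
proof -
  note [measurable] = sqD(1)[OF f] sqD(1)[OF g]
  have "koopman_fun T f x * cnj (koopman_fun T g x)
     = koopman_density T x *\<^sub>R (\<lambda>x. f x * cnj (g x)) (the_inv_into (space M) T x)" for x
  proof -
    have "complex_of_real (sqrt (koopman_density T x)) * complex_of_real (sqrt (koopman_density T x)) = complex_of_real (koopman_density T x)"
      using koopman_density_nonneg[of T x] by (simp flip: of_real_mult)
    then show ?thesis by (simp add: koopman_fun_def scaleR_conv_of_real mult_ac)
  qed
  moreover have "(\<lambda>x. f x * cnj (g x)) \<in> borel_measurable M"
    by (intro borel_measurable_times borel_measurable_continuous_on[of cnj] sqD(1)[OF f] sqD(1)[OF g] continuous_intros)
  ultimately show ?thesis using koopman_integral(2)[OF T, of "\<lambda>x. f x * cnj (g x)"] by simp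
qed

lemma koopman_fun_comp:
  assumes S: "S \<in> nonsingular_automorphisms M" and T: "T \<in> nonsingular_automorphisms M"
  shows "AE x in M. koopman_fun (S \<circ> T) f x = koopman_fun S (koopman_fun T f) x"
  using koopman_density_comp[OF S T] AE_space
  by eventually_elim (simp add: koopman_fun_def nsa_comp(2)[OF S T] real_sqrt_mult)

lemma koopman_fun_id: "AE x in M. koopman_fun id f x = f x"
  using koopman_density_id AE_space
proof eventually_elim
  case (elim x)
  moreover have "the_inv_into (space M) id x = x" using nsaD(7)[OF nsa_id, of x] elim by simp
  ultimately show ?case by (simp add: koopman_fun_def)
qed

lemma koopman_fun_cong:
  assumes S: "S \<in> nonsingular_automorphisms M" and T: "T \<in> nonsingular_automorphisms M"
    and "AE x in M. S x = T x" "AE x in M. f x = g x"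
  shows "AE x in M. koopman_fun S f x = koopman_fun T g x"
  using koopman_density_cong(2)[OF S T assms(3)] nsa_AE[OF nsa_inv[OF T] assms(4)]
  by eventually_elim (simp add: koopman_fun_def koopman_density_cong(1)[OF S T assms(3)])

text \<open>Both images of the indicator have squared norm \<open>measure M A\<close>, so the
  distance is governed by their inner product, the overlap integral of \<open>ov\<close>. A lower
  bound for \<open>ov\<close> is therefore an approximation result; both \<open>cells_l2dist\<close>
  and \<open>l2dist_fixing\<close> are obtained in this way.\<close>

lemma l2dist_indicators:
  assumes S: "S \<in> nonsingular_automorphisms M" and T: "T \<in> nonsingular_automorphisms M" and A[measurable]: "A \<in> sets M"
  defines "ov \<equiv> \<lambda>x. sqrt (koopman_density S x * koopman_density T x) *
        (indicator A (the_inv_into (space M) S x) * indicator A (the_inv_into (space M) T x))"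
  shows "integrable M ov" "(l2dist (koopman_fun S (indicator A)) (koopman_fun T (indicator A)))\<^sup>2 = 2 * (measure M A - (LINT x|M. ov x))"
proof -
  note [measurable] = nsaD(2,3)[OF S] nsaD(2,3)[OF T]
  define u where "u S x = sqrt (koopman_density S x) * (indicator A (the_inv_into (space M) S x) :: real)" for S x
  have u: "koopman_fun S (indicator A) x = complex_of_real (u S x)" for S x
    by (simp add: koopman_fun_def u_def indicator_def)
  have [measurable]: "u S \<in> borel_measurable M" "u T \<in> borel_measurable M" unfolding u_def by measurable
  have usq: "(u S x)\<^sup>2 = koopman_density S x *\<^sub>R indicator A (the_inv_into (space M) S x)" for S x
    by (simp add: u_def power_mult_distrib koopman_density_nonneg indicator_def)
  have uu: "u S x * u T x = ov x" for x
    by (simp add: u_def ov_def real_sqrt_mult)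
  have i: "integrable M (\<lambda>x. (u R x)\<^sup>2)" "(LINT x|M. (u R x)\<^sup>2) = measure M A" if R: "R \<in> nonsingular_automorphisms M" for R
  proof -
    have "integrable M (indicator A :: 'a \<Rightarrow> real)"
      by (intro integrable_real_indicator) (auto simp: less_top[symmetric])
    then show "integrable M (\<lambda>x. (u R x)\<^sup>2)" "(LINT x|M. (u R x)\<^sup>2) = measure M A"
      unfolding usq using koopman_integral[OF R, of "indicator A :: 'a \<Rightarrow> real"] by simp_all
  qed
  have ov[measurable]: "ov \<in> borel_measurable M" unfolding uu[symmetric] by measurable
  show iov: "integrable M ov"
  proof (rule Bochner_Integration.integrable_bound)
    show "integrable M (\<lambda>x. (u S x)\<^sup>2 + (u T x)\<^sup>2)" using i[OF S] i[OF T] by auto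
    have "\<bar>u S x * u T x\<bar> \<le> (u S x)\<^sup>2 + (u T x)\<^sup>2" for x
    proof -
      have "0 \<le> (\<bar>u S x\<bar> - \<bar>u T x\<bar>)\<^sup>2" by simp
      then have "2 * \<bar>u S x * u T x\<bar> \<le> (u S x)\<^sup>2 + (u T x)\<^sup>2" by (simp add: power2_diff abs_mult)
      then show ?thesis by linarith
    qed
    then show "AE x in M. norm (ov x) \<le> norm ((u S x)\<^sup>2 + (u T x)\<^sup>2)" by (simp add: uu)
  qed (rule ov)
  have "(cmod (koopman_fun S (indicator A) x - koopman_fun T (indicator A) x))\<^sup>2 = (u S x)\<^sup>2 + (u T x)\<^sup>2 - 2 * ov x" for x
    unfolding u uu[symmetric] by (simp flip: of_real_diff add: power2_diff)
  then show "(l2dist (koopman_fun S (indicator A)) (koopman_fun T (indicator A)))\<^sup>2 = 2 * (measure M A - (LINT x|M. ov x))"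
    unfolding l2dist_sq using i[OF S] i[OF T] iov by simp
qed

end

section \<open>The topological group of automorphism classes\<close>

context prob_space
begin

lemma carrier_Aut_star: "carrier (Aut_star M) = nonsingular_automorphisms M // ae_eq_on M (nonsingular_automorphisms M)"
  by (simp add: Aut_star_def)

lemma aut_class_carrier: "T \<in> nonsingular_automorphisms M \<Longrightarrow> aut_class M T \<in> carrier (Aut_star M)"
  by (auto simp: carrier_Aut_star aut_class_def intro: quotientI)

lemma rep_Aut_star:
  assumes "X \<in> carrier (Aut_star M)"
  shows "rep X \<in> nonsingular_automorphisms M" "aut_class M (rep X) = X"
  using rep_quotient[of X "nonsingular_automorphisms M" M] assms by (auto simp: carrier_Aut_star aut_class_def)

lemma rep_aut_class:
  assumes "T \<in> nonsingular_automorphisms M"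
  shows "rep (aut_class M T) \<in> nonsingular_automorphisms M" "AE x in M. rep (aut_class M T) x = T x"
  unfolding aut_class_def using rep_ae_eq[OF assms] by auto

lemma aut_class_eq_iff:
  "S \<in> nonsingular_automorphisms M \<Longrightarrow> T \<in> nonsingular_automorphisms M \<Longrightarrow>
     aut_class M S = aut_class M T \<longleftrightarrow> (AE x in M. S x = T x)"
  unfolding aut_class_def by (rule ae_class_eq_iff)

text \<open>Changing the representative of the outer factor alters the composition on the preimage
  of a null set under \<open>T\<close>, and this is null because \<open>T\<close> is
  nonsingular.\<close>

lemma aut_class_mult:
  assumes S: "S \<in> nonsingular_automorphisms M" and T: "T \<in> nonsingular_automorphisms M"
  shows "aut_class M S \<otimes>\<^bsub>Aut_star M\<^esub> aut_class M T = aut_class M (S \<circ> T)"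
proof -
  have "AE x in M. (rep (aut_class M S) \<circ> rep (aut_class M T)) x = (S \<circ> T) x"
    using rep_aut_class(2)[OF T] nsa_AE[OF T rep_aut_class(2)[OF S]] by eventually_elim simp
  then show ?thesis
    by (simp add: Aut_star_def aut_class_eq_iff nsa_comp S T rep_aut_class(1))
qed

lemma aut_class_one: "\<one>\<^bsub>Aut_star M\<^esub> = aut_class M id"
  by (simp add: Aut_star_def)

lemma aut_class_inv_mult:
  assumes "T \<in> nonsingular_automorphisms M"
  shows "aut_class M (the_inv_into (space M) T) \<otimes>\<^bsub>Aut_star M\<^esub> aut_class M T = \<one>\<^bsub>Aut_star M\<^esub>"
  unfolding aut_class_mult[OF nsa_inv[OF assms] assms] aut_class_one
  using nsaD(7)[OF assms] by (subst aut_class_eq_iff) (auto intro: nsa_comp nsa_inv nsa_id assms)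

lemma group_Aut_star: "group (Aut_star M)"
proof (rule groupI)
  let ?G = "Aut_star M"
  fix X Y Z assume XYZ: "X \<in> carrier ?G" "Y \<in> carrier ?G" "Z \<in> carrier ?G"
  obtain S T R where STR: "S \<in> nonsingular_automorphisms M" "T \<in> nonsingular_automorphisms M" "R \<in> nonsingular_automorphisms M"
    "X = aut_class M S" "Y = aut_class M T" "Z = aut_class M R"
    using rep_Aut_star[OF XYZ(1)] rep_Aut_star[OF XYZ(2)] rep_Aut_star[OF XYZ(3)] by metis
  show "X \<otimes>\<^bsub>?G\<^esub> Y \<otimes>\<^bsub>?G\<^esub> Z = X \<otimes>\<^bsub>?G\<^esub> (Y \<otimes>\<^bsub>?G\<^esub> Z)"
    unfolding STR(4-6) by (simp add: aut_class_mult nsa_comp STR o_assoc)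
next
  let ?G = "Aut_star M"
  fix X Y assume XY: "X \<in> carrier ?G" "Y \<in> carrier ?G"
  obtain S T where ST: "S \<in> nonsingular_automorphisms M" "T \<in> nonsingular_automorphisms M"
    "X = aut_class M S" "Y = aut_class M T"
    using rep_Aut_star[OF XY(1)] rep_Aut_star[OF XY(2)] by metis
  show "X \<otimes>\<^bsub>?G\<^esub> Y \<in> carrier ?G"
    unfolding ST(3,4) by (simp add: aut_class_mult nsa_comp ST aut_class_carrier)
next
  let ?G = "Aut_star M"
  show "\<one>\<^bsub>?G\<^esub> \<in> carrier ?G" by (simp add: aut_class_one aut_class_carrier nsa_id)
  fix X assume X: "X \<in> carrier ?G"
  note r = rep_Aut_star[OF X]
  show "\<one>\<^bsub>?G\<^esub> \<otimes>\<^bsub>?G\<^esub> X = X"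
    using aut_class_mult[OF nsa_id r(1)] r(2) by (simp add: aut_class_one)
  show "\<exists>Y\<in>carrier ?G. Y \<otimes>\<^bsub>?G\<^esub> X = \<one>\<^bsub>?G\<^esub>"
    using aut_class_inv_mult[OF r(1)] aut_class_carrier[OF nsa_inv[OF r(1)]] r(2) by metis
qed

definition act :: "('a \<Rightarrow> 'a) set \<Rightarrow> ('a \<Rightarrow> complex) \<Rightarrow> 'a \<Rightarrow> complex" where
  "act X = koopman_fun (rep X)"

lemma act_sq: "X \<in> carrier (Aut_star M) \<Longrightarrow> f \<in> square_integrable M \<Longrightarrow> act X f \<in> square_integrable M"
  unfolding act_def by (intro koopman_fun_sq rep_Aut_star)

lemma act_isometry:
  "X \<in> carrier (Aut_star M) \<Longrightarrow> f \<in> square_integrable M \<Longrightarrow> g \<in> square_integrable M \<Longrightarrow>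
    l2dist (act X f) (act X g) = l2dist f g"
  unfolding act_def by (intro koopman_fun_isometry rep_Aut_star)

lemma act_aut_class:
  assumes "T \<in> nonsingular_automorphisms M"
  shows "AE x in M. act (aut_class M T) f x = koopman_fun T f x"
  unfolding act_def by (rule koopman_fun_cong[OF rep_aut_class(1)[OF assms] assms rep_aut_class(2)[OF assms]]) simp

lemma act_mult:
  assumes X: "X \<in> carrier (Aut_star M)" and Y: "Y \<in> carrier (Aut_star M)"
  shows "AE x in M. act (X \<otimes>\<^bsub>Aut_star M\<^esub> Y) f x = act X (act Y f) x"
proof -
  note rX = rep_Aut_star[OF X] and rY = rep_Aut_star[OF Y]
  have "X \<otimes>\<^bsub>Aut_star M\<^esub> Y = aut_class M (rep X \<circ> rep Y)"
    using aut_class_mult[OF rX(1) rY(1)] rX(2) rY(2) by simp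
  moreover have "AE x in M. act (aut_class M (rep X \<circ> rep Y)) f x = act X (act Y f) x"
    using act_aut_class[OF nsa_comp(1)[OF rX(1) rY(1)], of f] koopman_fun_comp[OF rX(1) rY(1), of f]
    by eventually_elim (simp add: act_def)
  ultimately show ?thesis by simp
qed

lemma act_one: "AE x in M. act \<one>\<^bsub>Aut_star M\<^esub> f x = f x"
  using act_aut_class[OF nsa_id, of f] koopman_fun_id[of f] unfolding aut_class_one by eventually_elim simp

lemma act_cong:
  assumes "X \<in> carrier (Aut_star M)" "AE x in M. f x = g x"
  shows "AE x in M. act X f x = act X g x"
  unfolding act_def using koopman_fun_cong[OF rep_Aut_star(1)[OF assms(1)] rep_Aut_star(1)[OF assms(1)] _ assms(2)] by simp

text \<open>The product class chooses its own representative, so the action is multiplicative only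
  almost everywhere; L2 distances do not see the difference.\<close>

lemma l2dist_act_mult:
  assumes X: "X \<in> carrier (Aut_star M)" and Y: "Y \<in> carrier (Aut_star M)" and f: "f \<in> square_integrable M"
    and g: "g \<in> square_integrable M"
  shows "l2dist (act (X \<otimes>\<^bsub>Aut_star M\<^esub> Y) f) g = l2dist (act X (act Y f)) g"
  using assms group.is_monoid[OF group_Aut_star]
  by (intro l2dist_cong act_sq act_mult) (auto intro: monoid.m_closed)

lemma rep_L2:
  assumes "F \<in> L2 M"
  shows "rep F \<in> square_integrable M" "L2_class M (rep F) = F"
  using rep_quotient[of F "square_integrable M" M] assms by (auto simp: L2_def L2_class_def)

lemma L2_class_in: "f \<in> square_integrable M \<Longrightarrow> L2_class M f \<in> L2 M"
  by (auto simp: L2_def L2_class_def intro: quotientI)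

lemma rep_L2_class:
  assumes "f \<in> square_integrable M"
  shows "rep (L2_class M f) \<in> square_integrable M" "AE x in M. rep (L2_class M f) x = f x"
  unfolding L2_class_def using rep_ae_eq[OF assms] by auto

lemma L2_class_eq_iff:
  "f \<in> square_integrable M \<Longrightarrow> g \<in> square_integrable M \<Longrightarrow> L2_class M f = L2_class M g \<longleftrightarrow> (AE x in M. f x = g x)"
  unfolding L2_class_def by (rule ae_class_eq_iff)

lemma L2_dist_rep: "L2_dist M F G = l2dist (rep F) (rep G)"
  by (simp add: L2_dist_def l2dist_def)

lemma L2_dist_class:
  assumes "f \<in> square_integrable M" "g \<in> square_integrable M"
  shows "L2_dist M (L2_class M f) (L2_class M g) = l2dist f g"
  unfolding L2_dist_rep using assms by (intro l2dist_cong rep_L2_class)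

lemma Metric_space_L2: "Metric_space (L2 M) (L2_dist M)"
proof
  fix F G H
  show "0 \<le> L2_dist M F G" by (simp add: L2_dist_rep l2dist_nonneg)
  show "L2_dist M F G = L2_dist M G F" by (simp add: L2_dist_rep l2dist_commute)
  show "L2_dist M F G = 0 \<longleftrightarrow> F = G" if "F \<in> L2 M" "G \<in> L2 M"
    using l2dist_eq_0_iff[OF rep_L2(1)[OF that(1)] rep_L2(1)[OF that(2)]]
      L2_class_eq_iff[OF rep_L2(1)[OF that(1)] rep_L2(1)[OF that(2)]] rep_L2(2)[OF that(1)] rep_L2(2)[OF that(2)]
    by (simp add: L2_dist_rep)
  show "L2_dist M F H \<le> L2_dist M F G + L2_dist M G H" if "F \<in> L2 M" "G \<in> L2 M" "H \<in> L2 M"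
    unfolding L2_dist_rep using that by (intro l2dist_triangle rep_L2)
qed

lemma koopman_rep:
  assumes "F \<in> L2 M"
  shows "koopman M X F = L2_class M (act X (rep F))"
proof -
  have "act X (rep F) = (\<lambda>x. complex_of_real (sqrt (enn2real (RN_deriv M (distr M M (rep X)) x)))
              * rep F (the_inv_into (space M) (rep X) x))"
    by (simp add: fun_eq_iff act_def koopman_fun_def koopman_density_def)
  then show ?thesis using assms by (simp add: koopman_def)
qed

lemma koopman_class:
  assumes "X \<in> carrier (Aut_star M)" "f \<in> square_integrable M"
  shows "koopman M X (L2_class M f) = L2_class M (act X f)"
  unfolding koopman_rep[OF L2_class_in[OF assms(2)]]
  by (subst L2_class_eq_iff) (auto intro!: act_cong act_sq rep_L2_class assms)

text \<open>Change of variables preserves inner products, and surjectivity comes from the inverse in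
  the group. Membership in \<open>unitary_operators\<close> is what makes the pulled back topology
  live on the whole carrier.\<close>

lemma koopman_unitary:
  assumes X: "X \<in> carrier (Aut_star M)"
  shows "koopman M X \<in> unitary_operators M"
proof -
  let ?G = "Aut_star M"
  interpret G: group ?G by (rule group_Aut_star)
  let ?U = "koopman M X"
  have ex: "\<exists>f. f \<in> square_integrable M \<and> F = L2_class M f" if "F \<in> L2 M" for F using rep_L2[OF that] by metis
  have in_L2: "?U F \<in> L2 M" if "F \<in> L2 M" for F
    unfolding koopman_rep[OF that] using that by (intro L2_class_in act_sq X rep_L2)
  have inj: "inj_on ?U (L2 M)"
  proof (rule inj_onI)
    fix F H assume FH: "F \<in> L2 M" "H \<in> L2 M" "?U F = ?U H"
    obtain f h where f: "f \<in> square_integrable M" "F = L2_class M f" and h: "h \<in> square_integrable M" "H = L2_class M h"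
      using ex[OF FH(1)] ex[OF FH(2)] by blast
    have "AE x in M. act X f x = act X h x"
      using FH(3) f h X by (simp add: koopman_class L2_class_eq_iff act_sq)
    then have "l2dist (act X f) (act X h) = 0"
      using f h X by (subst l2dist_eq_0_iff) (auto intro: act_sq)
    then have "l2dist f h = 0" using act_isometry X f h by simp
    then show "F = H" using f h by (simp add: l2dist_eq_0_iff L2_class_eq_iff)
  qed
  have surj: "H \<in> ?U ` L2 M" if "H \<in> L2 M" for H
  proof -
    obtain h where h: "h \<in> square_integrable M" "H = L2_class M h" using ex[OF \<open>H \<in> L2 M\<close>] by blast
    let ?Y = "inv\<^bsub>?G\<^esub> X"
    have Y: "?Y \<in> carrier ?G" using X by simp
    have "AE x in M. act \<one>\<^bsub>?G\<^esub> h x = act X (act ?Y h) x"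
      using act_mult[OF X Y, of h] unfolding G.r_inv[OF X] .
    then have "AE x in M. act X (act ?Y h) x = h x"
      using act_one[of h] by eventually_elim simp
    then have "?U (L2_class M (act ?Y h)) = H"
      using h X Y by (simp add: koopman_class act_sq L2_class_eq_iff)
    then show ?thesis using L2_class_in[OF act_sq[OF Y h(1)]] by blast
  qed
  show ?thesis
    unfolding unitary_operators_def
  proof (intro CollectI conjI ballI allI)
    show "?U \<in> L2 M \<rightarrow>\<^sub>E L2 M" using in_L2 by (auto simp: koopman_def)
    show "bij_betw ?U (L2 M) (L2 M)" using inj surj in_L2 by (auto simp: bij_betw_def)
    fix F assume F: "F \<in> L2 M"
    note rF = rep_L2[OF F]
    have rU: "rep (?U F) \<in> square_integrable M" "AE x in M. rep (?U F) x = act X (rep F) x"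
      using rep_L2_class[OF act_sq[OF X rF(1)]] by (auto simp: koopman_rep[OF F])
    {
      fix c
      have "?U (L2_scale M c F) = L2_class M (act X (\<lambda>x. c * rep F x))"
        unfolding L2_scale_def by (intro koopman_class X sq_scale rF)
      also have "\<dots> = L2_class M (\<lambda>x. c * rep (?U F) x)"
      proof (subst L2_class_eq_iff)
        show "AE x in M. act X (\<lambda>x. c * rep F x) x = c * rep (?U F) x"
          using rU(2) by eventually_elim (simp add: act_def koopman_fun_scale)
      qed (intro act_sq sq_scale X rF rU refl TrueI)+
      finally show "?U (L2_scale M c F) = L2_scale M c (?U F)" by (simp add: L2_scale_def)
    }
    fix H assume H: "H \<in> L2 M"
    note rH = rep_L2[OF H]
    have rU': "rep (?U H) \<in> square_integrable M" "AE x in M. rep (?U H) x = act X (rep H) x"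
      using rep_L2_class[OF act_sq[OF X rH(1)]] by (auto simp: koopman_rep[OF H])
    have "?U (L2_add M F H) = L2_class M (act X (\<lambda>x. rep F x + rep H x))"
      unfolding L2_add_def by (intro koopman_class X sq_add rF rH)
    also have "\<dots> = L2_class M (\<lambda>x. rep (?U F) x + rep (?U H) x)"
    proof (subst L2_class_eq_iff)
      show "AE x in M. act X (\<lambda>x. rep F x + rep H x) x = rep (?U F) x + rep (?U H) x"
        using rU(2) rU'(2) by eventually_elim (simp add: act_def koopman_fun_add)
    qed (intro act_sq sq_add X rF rH rU rU' refl TrueI)+
    finally show "?U (L2_add M F H) = L2_add M (?U F) (?U H)" by (simp add: L2_add_def)
    have "L2_inner M (?U F) (?U H) = (LINT x|M. act X (rep F) x * cnj (act X (rep H) x))"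
      unfolding L2_inner_def
    proof (rule integral_cong_AE)
      show "AE x in M. rep (?U F) x * cnj (rep (?U H) x) = act X (rep F) x * cnj (act X (rep H) x)"
        using rU(2) rU'(2) by eventually_elim simp
    qed (intro borel_measurable_times borel_measurable_continuous_on[of cnj] continuous_intros
        sqD(1)[OF rU(1)] sqD(1)[OF rU'(1)] sqD(1)[OF act_sq[OF X rF(1)]] sqD(1)[OF act_sq[OF X rH(1)]])+
    also have "\<dots> = L2_inner M F H"
      unfolding act_def L2_inner_def by (rule koopman_fun_inner[OF rep_Aut_star(1)[OF X] rF(1) rH(1)])
    finally show "L2_inner M (?U F) (?U H) = L2_inner M F H" .
  qed
qed

lemma topspace_strong_topology: "topspace (strong_topology M) = carrier (Aut_star M)"
proof -
  have "topspace (unitary_SOT M) = unitary_operators M"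
    unfolding unitary_SOT_def L2_topology_def using Metric_space.topspace_mtopology[OF Metric_space_L2]
    by (auto simp: unitary_operators_def)
  then show ?thesis
    unfolding strong_topology_def topspace_pullback_topology using koopman_unitary by auto
qed

text \<open>The basic neighbourhoods of the strong operator topology, written with functions in
  place of classes.\<close>

definition strong_nbhd :: "('a \<Rightarrow> 'a) set \<Rightarrow> ('a \<Rightarrow> complex) set \<Rightarrow> real \<Rightarrow> ('a \<Rightarrow> 'a) set set" where
  "strong_nbhd X F \<epsilon> = {Y \<in> carrier (Aut_star M). \<forall>f\<in>F. l2dist (act Y f) (act X f) < \<epsilon>}"

lemma openin_strong_nbhd:
  assumes X: "X \<in> carrier (Aut_star M)" and F: "finite F" "F \<subseteq> square_integrable M"
  shows "openin (strong_topology M) (strong_nbhd X F \<epsilon>)"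
proof -
  interpret L: Metric_space "L2 M" "L2_dist M" by (rule Metric_space_L2)
  let ?P = "product_topology (\<lambda>_. L2_topology M) (L2 M)"
  let ?B = "\<lambda>f. {u \<in> topspace ?P. u (L2_class M f) \<in> L.mball (L2_class M (act X f)) \<epsilon>}"
  \<comment> \<open>The extra member keeps the intersection inside the product space when
    \<open>F\<close> is empty.\<close>
  let ?V = "\<Inter> (insert (topspace ?P) (?B ` F))"
  have oB: "openin ?P (?B f)" if "f \<in> F" for f
  proof -
    have "L2_class M f \<in> L2 M" using F that by (intro L2_class_in) auto
    then have "continuous_map ?P (L2_topology M) (\<lambda>u. u (L2_class M f))"
      by (rule continuous_map_product_projection)
    moreover have "openin (L2_topology M) (L.mball (L2_class M (act X f)) \<epsilon>)"
      by (simp add: L2_topology_def)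
    ultimately show ?thesis by (rule openin_continuous_map_preimage)
  qed
  have V: "openin ?P ?V"
  proof (rule openin_Inter)
    show "openin ?P S" if "S \<in> insert (topspace ?P) (?B ` F)" for S
      using that oB by (elim insertE imageE) (simp_all only: openin_topspace)
  qed (use F in auto)
  have top: "u \<in> topspace ?P" if "u \<in> unitary_operators M" for u
    using that by (auto simp: unitary_operators_def L2_topology_def)
  have dist: "L2_dist M (L2_class M (act X f)) (koopman M Y (L2_class M f)) = l2dist (act Y f) (act X f)"
    if "Y \<in> carrier (Aut_star M)" "f \<in> F" for Y f
    using that X F by (subst koopman_class) (auto simp: L2_dist_class act_sq l2dist_commute)
  have "strong_nbhd X F \<epsilon> = koopman M -` (?V \<inter> unitary_operators M) \<inter> carrier (Aut_star M)"
  proof (intro equalityI subsetI)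
    fix Y assume Y: "Y \<in> strong_nbhd X F \<epsilon>"
    then have Yc: "Y \<in> carrier (Aut_star M)" by (simp add: strong_nbhd_def)
    have U: "koopman M Y \<in> unitary_operators M" by (rule koopman_unitary[OF Yc])
    have "koopman M Y \<in> ?B f" if f: "f \<in> F" for f
    proof -
      have "L2_class M (act X f) \<in> L2 M" "koopman M Y (L2_class M f) \<in> L2 M"
        using f F X Yc by (auto simp: koopman_class intro!: L2_class_in act_sq)
      then show ?thesis using top[OF U] dist[OF Yc f] Y f by (simp add: strong_nbhd_def)
    qed
    then show "Y \<in> koopman M -` (?V \<inter> unitary_operators M) \<inter> carrier (Aut_star M)"
      using U top[OF U] Yc by blast
  next
    fix Y assume Y: "Y \<in> koopman M -` (?V \<inter> unitary_operators M) \<inter> carrier (Aut_star M)"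
    then show "Y \<in> strong_nbhd X F \<epsilon>"
      using dist[of Y] by (auto simp: strong_nbhd_def)
  qed
  moreover have "openin (unitary_SOT M) (?V \<inter> unitary_operators M)"
    unfolding unitary_SOT_def using V by (rule openin_subtopology_Int)
  ultimately show ?thesis
    unfolding strong_topology_def openin_pullback_topology by blast
qed

lemma strong_nbhd_self: "X \<in> carrier (Aut_star M) \<Longrightarrow> 0 < \<epsilon> \<Longrightarrow> X \<in> strong_nbhd X F \<epsilon>"
  by (simp add: strong_nbhd_def)

lemma strong_nbhd_base:
  assumes W: "openin (strong_topology M) W" and X: "X \<in> W"
  obtains F \<epsilon> where "finite F" "F \<subseteq> square_integrable M" "0 < \<epsilon>" "strong_nbhd X F \<epsilon> \<subseteq> W"
proof -
  interpret L: Metric_space "L2 M" "L2_dist M" by (rule Metric_space_L2)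
  let ?P = "product_topology (\<lambda>_. L2_topology M) (L2 M)"
  obtain U where U: "openin (unitary_SOT M) U" "W = koopman M -` U \<inter> carrier (Aut_star M)"
    using W by (auto simp: strong_topology_def openin_pullback_topology)
  have "\<exists>V. openin ?P V \<and> U = V \<inter> unitary_operators M"
    using U(1) unfolding unitary_SOT_def openin_subtopology .
  then obtain V where V: "openin ?P V" "U = V \<inter> unitary_operators M" by (elim exE conjE)
  have Xc: "X \<in> carrier (Aut_star M)" and XV: "koopman M X \<in> V" using X U V by auto
  have "\<exists>Z. finite {i \<in> L2 M. Z i \<noteq> topspace (L2_topology M)} \<and> (\<forall>i\<in>L2 M. openin (L2_topology M) (Z i)) \<and>
      koopman M X \<in> Pi\<^sub>E (L2 M) Z \<and> Pi\<^sub>E (L2 M) Z \<subseteq> V"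
    using V(1) XV unfolding openin_product_topology_alt by (rule bspec)
  then obtain Z where Z: "finite {i \<in> L2 M. Z i \<noteq> topspace (L2_topology M)}" "\<forall>i\<in>L2 M. openin (L2_topology M) (Z i)"
      "koopman M X \<in> Pi\<^sub>E (L2 M) Z" "Pi\<^sub>E (L2 M) Z \<subseteq> V"
    by (elim exE conjE)
  define I where "I = {i \<in> L2 M. Z i \<noteq> topspace (L2_topology M)}"
  have "\<forall>i\<in>I. \<exists>e>0. L.mball (koopman M X i) e \<subseteq> Z i"
  proof
    fix i assume "i \<in> I"
    then have "openin L.mtopology (Z i)" "koopman M X i \<in> Z i"
      using Z(2,3) by (auto simp: I_def L2_topology_def PiE_iff)
    then show "\<exists>e>0. L.mball (koopman M X i) e \<subseteq> Z i" by (simp add: L.openin_mtopology)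
  qed
  from bchoice[OF this] obtain e where "\<forall>i\<in>I. 0 < e i \<and> L.mball (koopman M X i) (e i) \<subseteq> Z i" ..
  then have e: "0 < e i" "L.mball (koopman M X i) (e i) \<subseteq> Z i" if "i \<in> I" for i using that by auto
  \<comment> \<open>The number 1 covers the case of an empty index set; the same device recurs
    below.\<close>
  define \<epsilon> where "\<epsilon> = Min (insert 1 (e ` I))"
  have I: "finite I" "I \<subseteq> L2 M" using Z(1) by (auto simp: I_def)
  have \<epsilon>: "0 < \<epsilon>" "\<And>i. i \<in> I \<Longrightarrow> \<epsilon> \<le> e i" using I e by (auto simp: \<epsilon>_def)
  show ?thesis
  proof (rule that)
    show "finite (rep ` I)" using I by simp
    show "rep ` I \<subseteq> square_integrable M" using I rep_L2(1) by auto
    show "0 < \<epsilon>" by (rule \<epsilon>)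
    show "strong_nbhd X (rep ` I) \<epsilon> \<subseteq> W"
    proof
      fix Y assume Y: "Y \<in> strong_nbhd X (rep ` I) \<epsilon>"
      then have Yc: "Y \<in> carrier (Aut_star M)" by (simp add: strong_nbhd_def)
      have U': "koopman M Y \<in> unitary_operators M" by (rule koopman_unitary[OF Yc])
      then have YE: "koopman M Y \<in> L2 M \<rightarrow>\<^sub>E L2 M" by (simp add: unitary_operators_def)
      have XE: "koopman M X \<in> L2 M \<rightarrow>\<^sub>E L2 M" using koopman_unitary[OF Xc] by (simp add: unitary_operators_def)
      have "koopman M Y i \<in> Z i" if i: "i \<in> L2 M" for i
      proof (cases "i \<in> I")
        case True
        have "L2_dist M (koopman M X i) (koopman M Y i) = l2dist (act Y (rep i)) (act X (rep i))"
          using i Xc Yc by (simp add: koopman_rep L2_dist_class act_sq rep_L2 l2dist_commute)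
        also have "\<dots> < e i" using Y True \<epsilon>(2)[OF True] by (auto simp: strong_nbhd_def)
        finally have "koopman M Y i \<in> L.mball (koopman M X i) (e i)" using XE YE i by auto
        then show ?thesis using e(2)[OF True] by blast
      next
        case False
        then show ?thesis using i YE by (auto simp: I_def L2_topology_def)
      qed
      then have "koopman M Y \<in> Pi\<^sub>E (L2 M) Z" using YE by (auto simp: PiE_iff)
      then show "Y \<in> W" using Z(4) U(2) V(2) U' Yc by blast
    qed
  qed
qed

text \<open>Isometry gives joint continuity: moving from X'Y'f to XYf through X'Yf, the first step
  costs the distance of Y'f and Yf, and the second only tests X' on the fixed vectors Yf. For
  inversion, applying Y turns the distance of the inverses at f into the distance of X and Y at the
  image of f under the inverse of X.\<close>

lemma topological_group_strong_topology: "topological_group (Aut_star M) (strong_topology M)"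
proof -
  let ?G = "Aut_star M" and ?T = "strong_topology M"
  interpret G: group ?G by (rule group_Aut_star)
  have mult: "continuous_map (prod_topology ?T ?T) ?T (\<lambda>(x, y). x \<otimes>\<^bsub>?G\<^esub> y)"
    unfolding continuous_map_def
  proof (intro conjI allI impI)
    show "(\<lambda>(x, y). x \<otimes>\<^bsub>?G\<^esub> y) \<in> topspace (prod_topology ?T ?T) \<rightarrow> topspace ?T"
      by (auto simp: topspace_strong_topology)
    fix W assume W: "openin ?T W"
    show "openin (prod_topology ?T ?T) {z \<in> topspace (prod_topology ?T ?T). (\<lambda>(x, y). x \<otimes>\<^bsub>?G\<^esub> y) z \<in> W}"
      unfolding openin_prod_topology_alt
    proof (intro allI impI)
      fix X Y assume "(X, Y) \<in> {z \<in> topspace (prod_topology ?T ?T). (\<lambda>(x, y). x \<otimes>\<^bsub>?G\<^esub> y) z \<in> W}"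
      then have X: "X \<in> carrier ?G" and Y: "Y \<in> carrier ?G" and XY: "X \<otimes>\<^bsub>?G\<^esub> Y \<in> W"
        by (auto simp: topspace_strong_topology)
      obtain F \<epsilon> where F: "finite F" "F \<subseteq> square_integrable M" "0 < \<epsilon>" "strong_nbhd (X \<otimes>\<^bsub>?G\<^esub> Y) F \<epsilon> \<subseteq> W"
        by (rule strong_nbhd_base[OF W XY]) (rule that)
      let ?U = "strong_nbhd X (act Y ` F) (\<epsilon>/2)" and ?V = "strong_nbhd Y F (\<epsilon>/2)"
      have YF: "act Y ` F \<subseteq> square_integrable M" using F Y by (auto intro: act_sq)
      have key: "X' \<otimes>\<^bsub>?G\<^esub> Y' \<in> strong_nbhd (X \<otimes>\<^bsub>?G\<^esub> Y) F \<epsilon>" if X': "X' \<in> ?U" and Y': "Y' \<in> ?V" for X' Y'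
      proof -
        have X'c: "X' \<in> carrier ?G" and Y'c: "Y' \<in> carrier ?G" using X' Y' by (auto simp: strong_nbhd_def)
        have "l2dist (act (X' \<otimes>\<^bsub>?G\<^esub> Y') f) (act (X \<otimes>\<^bsub>?G\<^esub> Y) f) < \<epsilon>" if f: "f \<in> F" for f
        proof -
          have fs: "f \<in> square_integrable M" using F f by auto
          note s = act_sq[OF X'c act_sq[OF Y'c fs]] act_sq[OF X'c act_sq[OF Y fs]] act_sq[OF X act_sq[OF Y fs]]
          have XYc: "X \<otimes>\<^bsub>?G\<^esub> Y \<in> carrier ?G" using X Y by simp
          have "l2dist (act (X' \<otimes>\<^bsub>?G\<^esub> Y') f) (act (X \<otimes>\<^bsub>?G\<^esub> Y) f) = l2dist (act X' (act Y' f)) (act (X \<otimes>\<^bsub>?G\<^esub> Y) f)"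
            by (rule l2dist_act_mult[OF X'c Y'c fs act_sq[OF XYc fs]])
          also have "\<dots> = l2dist (act X' (act Y' f)) (act X (act Y f))"
            using l2dist_act_mult[OF X Y fs s(1)] by (simp add: l2dist_commute)
          also have "\<dots> \<le> l2dist (act X' (act Y' f)) (act X' (act Y f)) + l2dist (act X' (act Y f)) (act X (act Y f))"
            by (rule l2dist_triangle[OF s])
          also have "l2dist (act X' (act Y' f)) (act X' (act Y f)) = l2dist (act Y' f) (act Y f)"
            by (intro act_isometry X'c act_sq Y'c Y fs)
          also have "l2dist (act Y' f) (act Y f) + l2dist (act X' (act Y f)) (act X (act Y f)) < \<epsilon>/2 + \<epsilon>/2"
            using X' Y' f by (intro add_strict_mono) (auto simp: strong_nbhd_def)
          finally show ?thesis by simp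
        qed
        then show ?thesis using X'c Y'c by (simp add: strong_nbhd_def)
      qed
      have "?U \<times> ?V \<subseteq> {z \<in> topspace (prod_topology ?T ?T). (\<lambda>(x, y). x \<otimes>\<^bsub>?G\<^esub> y) z \<in> W}"
      proof
        fix z assume "z \<in> ?U \<times> ?V"
        then obtain X' Y' where z: "z = (X', Y')" "X' \<in> ?U" "Y' \<in> ?V" by (elim SigmaE) simp
        then have "X' \<otimes>\<^bsub>?G\<^esub> Y' \<in> W" using key[of X' Y'] F(4) by (intro subsetD[OF F(4)])
        moreover have "X' \<in> carrier ?G" "Y' \<in> carrier ?G" using z by (simp_all add: strong_nbhd_def)
        ultimately show "z \<in> {z \<in> topspace (prod_topology ?T ?T). (\<lambda>(x, y). x \<otimes>\<^bsub>?G\<^esub> y) z \<in> W}"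
          using z(1) by (simp add: topspace_strong_topology)
      qed
      moreover have "openin ?T ?U" by (rule openin_strong_nbhd[OF X _ YF]) (use F in auto)
      moreover have "openin ?T ?V" by (rule openin_strong_nbhd[OF Y F(1,2)])
      moreover have "X \<in> ?U" by (rule strong_nbhd_self[OF X]) (use F in auto)
      moreover have "Y \<in> ?V" by (rule strong_nbhd_self[OF Y]) (use F in auto)
      ultimately show "\<exists>U V. openin ?T U \<and> openin ?T V \<and> X \<in> U \<and> Y \<in> V \<and>
          U \<times> V \<subseteq> {z \<in> topspace (prod_topology ?T ?T). (\<lambda>(x, y). x \<otimes>\<^bsub>?G\<^esub> y) z \<in> W}"
        by (intro exI[of _ ?U] exI[of _ ?V] conjI)
    qed
  qed
  have inv: "continuous_map ?T ?T (\<lambda>x. inv\<^bsub>?G\<^esub> x)"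
    unfolding continuous_map_def
  proof (intro conjI allI impI)
    show "(\<lambda>x. inv\<^bsub>?G\<^esub> x) \<in> topspace ?T \<rightarrow> topspace ?T" by (auto simp: topspace_strong_topology)
    fix W assume W: "openin ?T W"
    show "openin ?T {X \<in> topspace ?T. inv\<^bsub>?G\<^esub> X \<in> W}"
    proof (subst openin_subopen, intro ballI)
      fix X assume "X \<in> {X \<in> topspace ?T. inv\<^bsub>?G\<^esub> X \<in> W}"
      then have X: "X \<in> carrier ?G" and XW: "inv\<^bsub>?G\<^esub> X \<in> W" by (auto simp: topspace_strong_topology)
      let ?X = "inv\<^bsub>?G\<^esub> X"
      have Xi: "?X \<in> carrier ?G" using X by simp
      obtain F \<epsilon> where F: "finite F" "F \<subseteq> square_integrable M" "0 < \<epsilon>" "strong_nbhd ?X F \<epsilon> \<subseteq> W"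
        by (rule strong_nbhd_base[OF W XW]) (rule that)
      let ?U = "strong_nbhd X (act ?X ` F) \<epsilon>"
      have XF: "act ?X ` F \<subseteq> square_integrable M" using F Xi by (auto intro: act_sq)
      have key: "inv\<^bsub>?G\<^esub> Y \<in> strong_nbhd ?X F \<epsilon>" if Y: "Y \<in> ?U" for Y
      proof -
        have Yc: "Y \<in> carrier ?G" using Y by (auto simp: strong_nbhd_def)
        then have Yi: "inv\<^bsub>?G\<^esub> Y \<in> carrier ?G" by simp
        have "l2dist (act (inv\<^bsub>?G\<^esub> Y) f) (act ?X f) < \<epsilon>" if f: "f \<in> F" for f
        proof -
          have fs: "f \<in> square_integrable M" using F f by auto
          note s = act_sq[OF Yi fs] act_sq[OF Xi fs]
          have "l2dist (act (inv\<^bsub>?G\<^esub> Y) f) (act ?X f) = l2dist (act Y (act (inv\<^bsub>?G\<^esub> Y) f)) (act Y (act ?X f))"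
            by (rule act_isometry[OF Yc s, symmetric])
          also have "\<dots> = l2dist (act (Y \<otimes>\<^bsub>?G\<^esub> inv\<^bsub>?G\<^esub> Y) f) (act Y (act ?X f))"
            by (rule l2dist_act_mult[OF Yc Yi fs act_sq[OF Yc s(2)], symmetric])
          also have "\<dots> = l2dist (act (X \<otimes>\<^bsub>?G\<^esub> ?X) f) (act Y (act ?X f))" using X Yc by simp
          also have "\<dots> = l2dist (act X (act ?X f)) (act Y (act ?X f))"
            by (rule l2dist_act_mult[OF X Xi fs act_sq[OF Yc s(2)]])
          also have "\<dots> < \<epsilon>" using Y f by (auto simp: strong_nbhd_def l2dist_commute)
          finally show ?thesis .
        qed
        then show ?thesis using Yi by (simp add: strong_nbhd_def)
      qed
      have "?U \<subseteq> {X \<in> topspace ?T. inv\<^bsub>?G\<^esub> X \<in> W}"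
      proof
        fix Y assume Y: "Y \<in> ?U"
        then have "inv\<^bsub>?G\<^esub> Y \<in> W" using key[of Y] by (intro subsetD[OF F(4)])
        moreover have "Y \<in> carrier ?G" using Y by (simp add: strong_nbhd_def)
        ultimately show "Y \<in> {X \<in> topspace ?T. inv\<^bsub>?G\<^esub> X \<in> W}" by (simp add: topspace_strong_topology)
      qed
      moreover have "openin ?T ?U" by (rule openin_strong_nbhd[OF X _ XF]) (use F in auto)
      moreover have "X \<in> ?U" using X F(3) by (rule strong_nbhd_self)
      ultimately show "\<exists>U. openin ?T U \<and> X \<in> U \<and> U \<subseteq> {X \<in> topspace ?T. inv\<^bsub>?G\<^esub> X \<in> W}"
        by (intro exI[of _ ?U] conjI)
    qed
  qed
  show ?thesis
    unfolding topological_group_def using mult inv group_Aut_star topspace_strong_topology by blast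
qed


section \<open>Testing the strong topology on a generating family of sets\<close>

text \<open>Uniform continuity of the orbit map of \<open>f\<close>, with respect to the uniformity
  on the group that is generated by the orbit maps of the indicators of sets in
  \<open>\<A>\<close>.\<close>

definition determined_by :: "'a set set \<Rightarrow> ('a \<Rightarrow> complex) \<Rightarrow> bool" where
  "determined_by \<A> f \<longleftrightarrow> (\<forall>\<epsilon>>0. \<exists>F \<eta>. finite F \<and> F \<subseteq> \<A> \<and> 0 < \<eta> \<and>
     (\<forall>X\<in>carrier (Aut_star M). \<forall>Y\<in>carrier (Aut_star M).
        (\<forall>A\<in>F. l2dist (act X (indicator A)) (act Y (indicator A)) < \<eta>) \<longrightarrow> l2dist (act X f) (act Y f) < \<epsilon>))"

lemma determined_by_indicator: "A \<in> \<A> \<Longrightarrow> determined_by \<A> (indicator A)"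
  unfolding determined_by_def
proof (intro allI impI)
  fix \<epsilon> :: real assume "A \<in> \<A>" "0 < \<epsilon>"
  then show "\<exists>F \<eta>. finite F \<and> F \<subseteq> \<A> \<and> 0 < \<eta> \<and>
     (\<forall>X\<in>carrier (Aut_star M). \<forall>Y\<in>carrier (Aut_star M).
        (\<forall>A\<in>F. l2dist (act X (indicator A)) (act Y (indicator A)) < \<eta>) \<longrightarrow>
         l2dist (act X (indicator A)) (act Y (indicator A)) < \<epsilon>)"
    by (intro exI[of _ "{A}"] exI[of _ \<epsilon>]) auto
qed

lemma determined_by_combine:
  assumes f: "determined_by \<A> f" and g: "determined_by \<A> g"
    and le: "\<And>X Y. X \<in> carrier (Aut_star M) \<Longrightarrow> Y \<in> carrier (Aut_star M) \<Longrightarrow>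
       l2dist (act X h) (act Y h) \<le> C * (l2dist (act X f) (act Y f) + l2dist (act X g) (act Y g))"
  shows "determined_by \<A> h"
  unfolding determined_by_def
proof (intro allI impI)
  fix \<epsilon> :: real assume e: "0 < \<epsilon>"
  define D where "D = \<bar>C\<bar> + 1"
  have D: "0 < D" "C \<le> D" by (auto simp: D_def)
  have e': "0 < \<epsilon> / (2 * D)" using e D by simp
  obtain F \<eta> where F: "finite F" "F \<subseteq> \<A>" "0 < \<eta>"
    "\<And>X Y. X \<in> carrier (Aut_star M) \<Longrightarrow> Y \<in> carrier (Aut_star M) \<Longrightarrow>
        \<forall>A\<in>F. l2dist (act X (indicator A)) (act Y (indicator A)) < \<eta> \<Longrightarrow> l2dist (act X f) (act Y f) < \<epsilon> / (2 * D)"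
    using f[unfolded determined_by_def, rule_format, OF e'] by auto
  obtain F' \<eta>' where F': "finite F'" "F' \<subseteq> \<A>" "0 < \<eta>'"
    "\<And>X Y. X \<in> carrier (Aut_star M) \<Longrightarrow> Y \<in> carrier (Aut_star M) \<Longrightarrow>
        \<forall>A\<in>F'. l2dist (act X (indicator A)) (act Y (indicator A)) < \<eta>' \<Longrightarrow> l2dist (act X g) (act Y g) < \<epsilon> / (2 * D)"
    using g[unfolded determined_by_def, rule_format, OF e'] by auto
  show "\<exists>F \<eta>. finite F \<and> F \<subseteq> \<A> \<and> 0 < \<eta> \<and>
     (\<forall>X\<in>carrier (Aut_star M). \<forall>Y\<in>carrier (Aut_star M).
        (\<forall>A\<in>F. l2dist (act X (indicator A)) (act Y (indicator A)) < \<eta>) \<longrightarrow> l2dist (act X h) (act Y h) < \<epsilon>)"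
  proof (intro exI[of _ "F \<union> F'"] exI[of _ "min \<eta> \<eta>'"] conjI ballI impI)
    fix X Y assume X: "X \<in> carrier (Aut_star M)" and Y: "Y \<in> carrier (Aut_star M)"
      and A: "\<forall>A\<in>F \<union> F'. l2dist (act X (indicator A)) (act Y (indicator A)) < min \<eta> \<eta>'"
    have "l2dist (act X f) (act Y f) < \<epsilon> / (2 * D)" "l2dist (act X g) (act Y g) < \<epsilon> / (2 * D)"
      using F(4)[OF X Y] F'(4)[OF X Y] A by auto
    then have s: "l2dist (act X f) (act Y f) + l2dist (act X g) (act Y g) < \<epsilon> / D"
      using D by (simp add: field_simps)
    have "l2dist (act X h) (act Y h) \<le> C * (l2dist (act X f) (act Y f) + l2dist (act X g) (act Y g))"
      by (rule le[OF X Y])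
    also have "\<dots> \<le> D * (l2dist (act X f) (act Y f) + l2dist (act X g) (act Y g))"
      using D by (intro mult_right_mono) (auto simp: l2dist_nonneg)
    also have "\<dots> < D * (\<epsilon> / D)" using s D by (intro mult_strict_left_mono)
    finally show "l2dist (act X h) (act Y h) < \<epsilon>" using D by simp
  qed (use F F' in auto)
qed

text \<open>A three-epsilon argument: every group element acts isometrically, so replacing
  \<open>h\<close> by \<open>g\<close> costs the same amount at all group elements.\<close>

lemma determined_by_limit:
  assumes h: "h \<in> square_integrable M"
    and ap: "\<And>\<epsilon>. 0 < \<epsilon> \<Longrightarrow> \<exists>g\<in>square_integrable M. determined_by \<A> g \<and> l2dist h g < \<epsilon>"
  shows "determined_by \<A> h"
  unfolding determined_by_def
proof (intro allI impI)
  fix \<epsilon> :: real assume e: "0 < \<epsilon>"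
  then have e3: "0 < \<epsilon> / 3" by simp
  obtain g where g: "g \<in> square_integrable M" "determined_by \<A> g" "l2dist h g < \<epsilon> / 3"
    using ap[OF e3] by auto
  obtain F \<eta> where F: "finite F" "F \<subseteq> \<A>" "0 < \<eta>"
    "\<And>X Y. X \<in> carrier (Aut_star M) \<Longrightarrow> Y \<in> carrier (Aut_star M) \<Longrightarrow>
        \<forall>A\<in>F. l2dist (act X (indicator A)) (act Y (indicator A)) < \<eta> \<Longrightarrow> l2dist (act X g) (act Y g) < \<epsilon> / 3"
    using g(2)[unfolded determined_by_def, rule_format, OF e3] by auto
  show "\<exists>F \<eta>. finite F \<and> F \<subseteq> \<A> \<and> 0 < \<eta> \<and>
     (\<forall>X\<in>carrier (Aut_star M). \<forall>Y\<in>carrier (Aut_star M).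
        (\<forall>A\<in>F. l2dist (act X (indicator A)) (act Y (indicator A)) < \<eta>) \<longrightarrow> l2dist (act X h) (act Y h) < \<epsilon>)"
  proof (intro exI[of _ F] exI[of _ \<eta>] conjI ballI impI)
    fix X Y assume X: "X \<in> carrier (Aut_star M)" and Y: "Y \<in> carrier (Aut_star M)"
      and A: "\<forall>A\<in>F. l2dist (act X (indicator A)) (act Y (indicator A)) < \<eta>"
    note s = act_sq[OF X h] act_sq[OF X g(1)] act_sq[OF Y g(1)] act_sq[OF Y h]
    have "l2dist (act X h) (act Y h) \<le> l2dist (act X h) (act X g) + l2dist (act X g) (act Y h)"
      by (rule l2dist_triangle[OF s(1,2,4)])
    also have "l2dist (act X g) (act Y h) \<le> l2dist (act X g) (act Y g) + l2dist (act Y g) (act Y h)"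
      by (rule l2dist_triangle[OF s(2,3,4)])
    also have "l2dist (act X h) (act X g) = l2dist h g" by (rule act_isometry[OF X h g(1)])
    also have "l2dist (act Y g) (act Y h) = l2dist h g" using act_isometry[OF Y g(1) h] by (simp add: l2dist_commute)
    finally show "l2dist (act X h) (act Y h) < \<epsilon>"
      using F(4)[OF X Y A] g(3) by linarith
  qed (use F in auto)
qed

lemma l2dist_add_le:
  assumes "f \<in> square_integrable M" "g \<in> square_integrable M" "f' \<in> square_integrable M" "g' \<in> square_integrable M"
  shows "l2dist (\<lambda>x. f x + g x) (\<lambda>x. f' x + g' x) \<le> l2dist f f' + l2dist g g'"
proof -
  have "l2dist (\<lambda>x. f x + g x) (\<lambda>x. f' x + g' x)
      \<le> l2dist (\<lambda>x. f x + g x) (\<lambda>x. f' x + g x) + l2dist (\<lambda>x. f' x + g x) (\<lambda>x. f' x + g' x)"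
    by (intro l2dist_triangle sq_add assms)
  then show ?thesis by (simp add: l2dist_def)
qed

lemma l2dist_scale: "l2dist (\<lambda>x. c * f x) (\<lambda>x. c * g x) = cmod c * l2dist f g"
proof -
  have "(cmod (c * f x - c * g x))\<^sup>2 = (cmod c)\<^sup>2 * (cmod (f x - g x))\<^sup>2" for x
    by (simp flip: right_diff_distrib add: norm_mult power_mult_distrib)
  then show ?thesis by (simp add: l2dist_def real_sqrt_mult)
qed

lemma act_add: "act X (\<lambda>x. f x + g x) = (\<lambda>x. act X f x + act X g x)"
  by (simp add: fun_eq_iff act_def koopman_fun_add)

lemma act_scale: "act X (\<lambda>x. c * f x) = (\<lambda>x. c * act X f x)"
  by (simp add: fun_eq_iff act_def koopman_fun_scale)

lemma determined_by_add:
  assumes "f \<in> square_integrable M" "g \<in> square_integrable M" "determined_by \<A> f" "determined_by \<A> g"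
  shows "determined_by \<A> (\<lambda>x. f x + g x)"
proof (rule determined_by_combine[OF assms(3,4), where C = 1])
  fix X Y assume X: "X \<in> carrier (Aut_star M)" and Y: "Y \<in> carrier (Aut_star M)"
  have "l2dist (\<lambda>x. act X f x + act X g x) (\<lambda>x. act Y f x + act Y g x) \<le> l2dist (act X f) (act Y f) + l2dist (act X g) (act Y g)"
    by (intro l2dist_add_le act_sq X Y assms)
  then show "l2dist (act X (\<lambda>x. f x + g x)) (act Y (\<lambda>x. f x + g x)) \<le> 1 * (l2dist (act X f) (act Y f) + l2dist (act X g) (act Y g))"
    by (simp add: act_add)
qed

lemma determined_by_scale:
  assumes "determined_by \<A> f"
  shows "determined_by \<A> (\<lambda>x. c * f x)"
proof (rule determined_by_combine[OF assms assms, where C = "cmod c"])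
  fix X Y assume X: "X \<in> carrier (Aut_star M)" and Y: "Y \<in> carrier (Aut_star M)"
  have "cmod c * l2dist (act X f) (act Y f) \<le> cmod c * (l2dist (act X f) (act Y f) + l2dist (act X f) (act Y f))"
    by (intro mult_left_mono) (auto simp: l2dist_nonneg)
  then show "l2dist (act X (\<lambda>x. c * f x)) (act Y (\<lambda>x. c * f x)) \<le> cmod c * (l2dist (act X f) (act Y f) + l2dist (act X f) (act Y f))"
    unfolding act_scale l2dist_scale .
qed

lemma determined_by_zero: "determined_by \<A> (\<lambda>_. 0)"
  unfolding determined_by_def
proof (intro allI impI)
  fix \<epsilon> :: real assume e: "0 < \<epsilon>"
  have "act X (\<lambda>_. 0) = (\<lambda>_. 0)" for X by (simp add: act_def koopman_fun_def fun_eq_iff)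
  then show "\<exists>F \<eta>. finite F \<and> F \<subseteq> \<A> \<and> 0 < \<eta> \<and>
     (\<forall>X\<in>carrier (Aut_star M). \<forall>Y\<in>carrier (Aut_star M).
        (\<forall>A\<in>F. l2dist (act X (indicator A)) (act Y (indicator A)) < \<eta>) \<longrightarrow> l2dist (act X (\<lambda>_. 0)) (act Y (\<lambda>_. 0)) < \<epsilon>)"
    using e by (intro exI[of _ "{}"] exI[of _ 1]) auto
qed

lemma determined_by_sum:
  assumes "finite I" "\<And>i. i \<in> I \<Longrightarrow> f i \<in> square_integrable M" "\<And>i. i \<in> I \<Longrightarrow> determined_by \<A> (f i)"
  shows "determined_by \<A> (\<lambda>x. \<Sum>i\<in>I. f i x)"
  using assms
proof (induction I)
  case empty
  then show ?case by (simp add: determined_by_zero)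
next
  case (insert i I)
  then have "determined_by \<A> (\<lambda>x. f i x + (\<Sum>i\<in>I. f i x))"
    by (intro determined_by_add sq_sum) auto
  then show ?case using insert by simp
qed

text \<open>Dynkin's induction over the generated sigma-algebra. Complements and finite disjoint
  unions are linear combinations of indicators; a countable disjoint union is the L2 limit of its
  finite partial unions, by continuity of the measure.\<close>

lemma determined_by_set:
  assumes \<A>: "\<A> \<subseteq> sets M" "Int_stable \<A>" "space M \<in> \<A>" "sets M = sigma_sets (space M) \<A>"
    and B: "B \<in> sets M"
  shows "determined_by \<A> (indicator B)"
proof -
  have "\<A> \<subseteq> Pow (space M)" using \<A>(1) sets.space_closed by blast
  have "B \<in> sigma_sets (space M) \<A>" using B \<A>(4) by simp
  with \<A>(2) \<open>\<A> \<subseteq> Pow (space M)\<close> show ?thesis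
  proof (induction rule: sigma_sets_induct_disjoint)
    case (basic A)
    then show ?case by (rule determined_by_indicator)
  next
    case empty
    have "indicator {} = (\<lambda>_ :: 'a. 0 :: complex)" by (auto simp: fun_eq_iff)
    then show ?case by (simp add: determined_by_zero)
  next
    case (compl A)
    then have A: "A \<in> sets M" using \<A>(4) by simp
    have "determined_by \<A> (\<lambda>x. indicator (space M) x + (- 1) * indicator A x)"
      using A compl(2) determined_by_indicator[OF \<A>(3)] by (intro determined_by_add determined_by_scale sq_indicator sq_scale) auto
    moreover have "(\<lambda>x. indicator (space M) x + (- 1) * indicator A x) = (indicator (space M - A) :: 'a \<Rightarrow> complex)"
      using sets.sets_into_space[OF A] by (auto simp: fun_eq_iff indicator_def)
    ultimately show ?case by simp
  next
    case (union A)
    have A: "A i \<in> sets M" for i using union(2) \<A>(4) by auto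
    define C where "C n = (\<Union>i<n. A i)" for n
    have C: "C n \<in> sets M" for n using A by (auto simp: C_def)
    have ind: "(\<lambda>x. \<Sum>i<n. indicator (A i) x) = (indicator (C n) :: 'a \<Rightarrow> complex)" for n
    proof
      fix x show "(\<Sum>i<n. indicator (A i) x) = (indicator (C n) x :: complex)"
      proof (cases "x \<in> C n")
        case True
        then obtain i where i: "i < n" "x \<in> A i" by (auto simp: C_def)
        have "indicator (A j) x = (if j = i then 1 else 0 :: complex)" for j
          using i(2) union(1) by (auto simp: disjoint_family_on_def indicator_def)
        then show ?thesis using i True by simp
      qed (auto simp: C_def indicator_def)
    qed
    show ?case
    proof (rule determined_by_limit)
      show "indicator (\<Union> (range A)) \<in> square_integrable M" using A by (intro sq_indicator) auto
      fix \<epsilon> :: real assume e: "0 < \<epsilon>"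
      have "incseq C" by (rule incseq_SucI) (auto simp: C_def less_Suc_eq)
      then have "(\<lambda>n. measure M (C n)) \<longlonglongrightarrow> measure M (\<Union>n. C n)"
        using C by (intro finite_Lim_measure_incseq) auto
      moreover have "(\<Union>n. C n) = \<Union> (range A)" by (auto simp: C_def)
      moreover have "measure M (\<Union> (range A)) - \<epsilon>\<^sup>2 < measure M (\<Union> (range A))" using e by simp
      ultimately have "\<forall>\<^sub>F n in sequentially. measure M (\<Union> (range A)) - \<epsilon>\<^sup>2 < measure M (C n)"
        by (intro order_tendstoD(1)[of _ "measure M (\<Union> (range A))"]) auto
      then obtain n where n: "measure M (\<Union> (range A)) - \<epsilon>\<^sup>2 < measure M (C n)"
        by (auto simp: eventually_sequentially)
      have sub: "C n \<subseteq> \<Union> (range A)" by (auto simp: C_def)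
      have "(cmod (indicator (\<Union> (range A)) x - indicator (C n) x))\<^sup>2 = indicator (\<Union> (range A) - C n) x" for x
        using sub by (auto simp: indicator_def)
      then have "(l2dist (indicator (\<Union> (range A))) (indicator (C n)))\<^sup>2 = measure M (\<Union> (range A) - C n)"
        unfolding l2dist_sq using A C by simp
      also have "\<dots> = measure M (\<Union> (range A)) - measure M (C n)"
        using A C sub by (intro finite_measure_Diff) auto
      also have "\<dots> < \<epsilon>\<^sup>2" using n by simp
      finally have "l2dist (indicator (\<Union> (range A))) (indicator (C n)) < \<epsilon>"
        by (rule power2_less_imp_less) (use e in simp)
      moreover have "determined_by \<A> (indicator (C n))"
        unfolding ind[symmetric] using A union(3) by (intro determined_by_sum sq_indicator) auto
      ultimately show "\<exists>g\<in>square_integrable M. determined_by \<A> g \<and> l2dist (indicator (\<Union> (range A))) g < \<epsilon>"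
        using sq_indicator[OF C, of n] by blast
    qed
  qed
qed

text \<open>Simple functions are dense in L2 and are, up to null sets, finite linear combinations of
  indicators.\<close>

lemma determined_by_all:
  assumes \<A>: "\<A> \<subseteq> sets M" "Int_stable \<A>" "space M \<in> \<A>" "sets M = sigma_sets (space M) \<A>"
    and f: "f \<in> square_integrable M"
  shows "determined_by \<A> f"
proof (rule determined_by_limit[OF f])
  fix \<epsilon> :: real assume e: "0 < \<epsilon>"
  from borel_measurable_implies_sequence_metric[OF sqD(1)[OF f], of 0] obtain s where
    s': "\<forall>i. simple_function M (s i)" "\<forall>x\<in>space M. (\<lambda>i. s i x) \<longlonglongrightarrow> f x"
      "\<forall>i. \<forall>x\<in>space M. dist (s i x) 0 \<le> 2 * dist (f x) 0"
    by (elim exE conjE)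
  have s: "simple_function M (s i)" "x \<in> space M \<Longrightarrow> (\<lambda>i. s i x) \<longlonglongrightarrow> f x"
      "x \<in> space M \<Longrightarrow> dist (s i x) 0 \<le> 2 * dist (f x) 0" for i x using s' by auto
  have fm[measurable]: "f \<in> borel_measurable M" by (rule sqD(1)[OF f])
  have sm[measurable]: "s i \<in> borel_measurable M" for i using s(1) by (rule borel_measurable_simple_function)
  have sb: "(cmod (s i x))\<^sup>2 \<le> 4 * (cmod (f x))\<^sup>2" if "x \<in> space M" for i x
  proof -
    have "(cmod (s i x))\<^sup>2 \<le> (2 * cmod (f x))\<^sup>2" using s(3)[OF that, of i] by (intro power_mono) auto
    then show ?thesis by (simp add: power_mult_distrib)
  qed
  have ssq: "s i \<in> square_integrable M" for i
    by (rule sq_bound[where g = "\<lambda>x. 4 * (cmod (f x))\<^sup>2"]) (use sqD(2)[OF f] sb in auto)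
  have "(\<lambda>i. LINT x|M. (cmod (f x - s i x))\<^sup>2) \<longlonglongrightarrow> (LINT x|M. (0::real))"
  proof (rule integral_dominated_convergence)
    \<comment> \<open>The approximants satisfy \<open>cmod (s i x) \<le> 2 * cmod (f x)\<close>, so
      the difference is at most \<open>3 * cmod (f x)\<close> before squaring.\<close>
    show "integrable M (\<lambda>x. 9 * (cmod (f x))\<^sup>2)" using sqD(2)[OF f] by auto
    show "AE x in M. (\<lambda>i. (cmod (f x - s i x))\<^sup>2) \<longlonglongrightarrow> 0"
    proof (rule AE_I2)
      fix x assume "x \<in> space M"
      then have "(\<lambda>i. (cmod (f x - s i x))\<^sup>2) \<longlonglongrightarrow> (cmod (f x - f x))\<^sup>2"
        by (intro tendsto_intros s(2))
      then show "(\<lambda>i. (cmod (f x - s i x))\<^sup>2) \<longlonglongrightarrow> 0" by simp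
    qed
    show "AE x in M. norm ((cmod (f x - s i x))\<^sup>2) \<le> 9 * (cmod (f x))\<^sup>2" for i
    proof (rule AE_I2)
      fix x assume x: "x \<in> space M"
      have "cmod (f x - s i x) \<le> cmod (f x) + cmod (s i x)" by (rule norm_triangle_ineq4)
      also have "\<dots> \<le> 3 * cmod (f x)" using s(3)[OF x, of i] by simp
      finally have "(cmod (f x - s i x))\<^sup>2 \<le> (3 * cmod (f x))\<^sup>2" by (intro power_mono) auto
      then show "norm ((cmod (f x - s i x))\<^sup>2) \<le> 9 * (cmod (f x))\<^sup>2" by (simp add: power_mult_distrib)
    qed
  qed measurable
  then have "\<forall>\<^sub>F i in sequentially. (LINT x|M. (cmod (f x - s i x))\<^sup>2) < \<epsilon>\<^sup>2"
    using e by (intro order_tendstoD(2)[of _ 0]) auto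
  then obtain i where i: "(l2dist f (s i))\<^sup>2 < \<epsilon>\<^sup>2"
    unfolding l2dist_sq by (auto simp: eventually_sequentially)
  have "l2dist f (s i) < \<epsilon>" by (rule power2_less_imp_less[OF i]) (use e in simp)
  moreover have "determined_by \<A> (s i)"
  proof -
    let ?g = "\<lambda>x. \<Sum>y\<in>s i ` space M. y * indicator (s i -` {y} \<inter> space M) x"
    have fin: "finite (s i ` space M)" using s(1) by (simp add: simple_function_def)
    have meas: "s i -` {y} \<inter> space M \<in> sets M" for y by measurable
    have gsq: "?g \<in> square_integrable M" by (intro sq_sum sq_scale sq_indicator meas)
    have g: "determined_by \<A> ?g"
      using fin by (intro determined_by_sum determined_by_scale determined_by_set[OF \<A>] sq_scale sq_indicator meas)
    have "?g x = s i x" if "x \<in> space M" for x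
    proof -
      have "?g x = (\<Sum>y\<in>s i ` space M. if y = s i x then y else 0)"
        using that by (intro sum.cong) (auto simp: indicator_def)
      then show ?thesis using fin that by simp
    qed
    then have "l2dist (s i) ?g = 0" using ssq gsq by (subst l2dist_eq_0_iff) (auto intro!: AE_I2)
    then show ?thesis using g gsq by (intro determined_by_limit[OF ssq]) auto
  qed
  ultimately show "\<exists>g\<in>square_integrable M. determined_by \<A> g \<and> l2dist f g < \<epsilon>" using ssq by blast
qed

text \<open>With a countable generator this gives a countable base at each point, hence
  metrizability; with all measurable sets it lets the approximation be carried out on finitely many
  indicators.\<close>

lemma strong_nbhd_base_generator:
  assumes \<A>: "\<A> \<subseteq> sets M" "Int_stable \<A>" "space M \<in> \<A>" "sets M = sigma_sets (space M) \<A>"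
    and W: "openin (strong_topology M) W" and X: "X \<in> W"
  obtains F \<epsilon> where "finite F" "F \<subseteq> \<A>" "0 < \<epsilon>" "strong_nbhd X (indicator ` F) \<epsilon> \<subseteq> W"
proof -
  have Xc: "X \<in> carrier (Aut_star M)" using openin_subset[OF W] X topspace_strong_topology by auto
  obtain F \<epsilon> where F: "finite F" "F \<subseteq> square_integrable M" "0 < \<epsilon>" "strong_nbhd X F \<epsilon> \<subseteq> W"
    by (rule strong_nbhd_base[OF W X]) (rule that)
  have "\<forall>f\<in>F. \<exists>E. finite (fst E) \<and> fst E \<subseteq> \<A> \<and> 0 < snd E \<and> (\<forall>X\<in>carrier (Aut_star M). \<forall>Y\<in>carrier (Aut_star M).
        (\<forall>A\<in>fst E. l2dist (act X (indicator A)) (act Y (indicator A)) < snd E) \<longrightarrow> l2dist (act X f) (act Y f) < \<epsilon>)"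
  proof
    fix f assume "f \<in> F"
    then have "determined_by \<A> f"
      using F(2) by (intro determined_by_all[OF \<A>]) auto
    from this[unfolded determined_by_def, rule_format, OF F(3)]
    show "\<exists>E. finite (fst E) \<and> fst E \<subseteq> \<A> \<and> 0 < snd E \<and> (\<forall>X\<in>carrier (Aut_star M). \<forall>Y\<in>carrier (Aut_star M).
        (\<forall>A\<in>fst E. l2dist (act X (indicator A)) (act Y (indicator A)) < snd E) \<longrightarrow> l2dist (act X f) (act Y f) < \<epsilon>)"
      by simp
  qed
  from bchoice[OF this] obtain E where E: "\<forall>f\<in>F. finite (fst (E f)) \<and> fst (E f) \<subseteq> \<A> \<and> 0 < snd (E f) \<and>
      (\<forall>X\<in>carrier (Aut_star M). \<forall>Y\<in>carrier (Aut_star M).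
        (\<forall>A\<in>fst (E f). l2dist (act X (indicator A)) (act Y (indicator A)) < snd (E f)) \<longrightarrow> l2dist (act X f) (act Y f) < \<epsilon>)" ..
  define \<eta> where "\<eta> = Min (insert 1 ((\<lambda>f. snd (E f)) ` F))"
  have \<eta>: "0 < \<eta>" "\<And>f. f \<in> F \<Longrightarrow> \<eta> \<le> snd (E f)" using F(1) E by (auto simp: \<eta>_def)
  show ?thesis
  proof (rule that)
    show "finite (\<Union>f\<in>F. fst (E f))" using F(1) E by auto
    show "(\<Union>f\<in>F. fst (E f)) \<subseteq> \<A>" using E by auto
    show "0 < \<eta>" by (rule \<eta>)
    have "strong_nbhd X (indicator ` (\<Union>f\<in>F. fst (E f))) \<eta> \<subseteq> strong_nbhd X F \<epsilon>"
    proof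
      fix Y assume Y: "Y \<in> strong_nbhd X (indicator ` (\<Union>f\<in>F. fst (E f))) \<eta>"
      then have Yc: "Y \<in> carrier (Aut_star M)" by (simp add: strong_nbhd_def)
      have "l2dist (act Y f) (act X f) < \<epsilon>" if f: "f \<in> F" for f
      proof -
        have "l2dist (act Y (indicator A)) (act X (indicator A)) < snd (E f)" if A: "A \<in> fst (E f)" for A
        proof -
          have "l2dist (act Y (indicator A)) (act X (indicator A)) < \<eta>"
            using Y f A by (auto simp: strong_nbhd_def)
          then show ?thesis using \<eta>(2)[OF f] by simp
        qed
        then show ?thesis using E f Xc Yc by blast
      qed
      then show "Y \<in> strong_nbhd X F \<epsilon>" using Yc by (simp add: strong_nbhd_def)
    qed
    then show "strong_nbhd X (indicator ` (\<Union>f\<in>F. fst (E f))) \<eta> \<subseteq> W" using F(4) by blast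
  qed
qed

lemma strong_nbhd_base_sets:
  assumes W: "openin (strong_topology M) W" and X: "X \<in> W"
  obtains F \<epsilon> where "finite F" "F \<subseteq> sets M" "0 < \<epsilon>" "strong_nbhd X (indicator ` F) \<epsilon> \<subseteq> W"
proof (rule strong_nbhd_base_generator[OF _ _ _ _ W X])
  show "sets M = sigma_sets (space M) (sets M)" by (rule sets.sigma_sets_eq[symmetric])
qed (use that in \<open>auto simp: sets.Int_stable\<close>)

end

section \<open>Metrizability of the strong topology\<close>

text \<open>Finite intersections of members of a countable base. Every open set is a countable union
  of base sets, and the Hausdorff property separates points.\<close>

lemma (in prob_space) standard_borel_generator:
  assumes "standard_borel M"
  obtains \<A> where "countable \<A>" "\<A> \<subseteq> sets M" "Int_stable \<A>" "space M \<in> \<A>" "sets M = sigma_sets (space M) \<A>"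
    "\<And>x y. x \<in> space M \<Longrightarrow> y \<in> space M \<Longrightarrow> x \<noteq> y \<Longrightarrow> \<exists>A\<in>\<A>. x \<in> A \<and> y \<notin> A"
proof -
  obtain T where T: "completely_metrizable_space T" "second_countable T" "sets M = sets (borel_of T)"
    using assms by (auto simp: standard_borel_def)
  have sp: "space M = topspace T" using sets_eq_imp_space_eq[OF T(3)] by (simp add: space_borel_of)
  from T(2) obtain \<B> where \<B>': "countable \<B>" "\<forall>V\<in>\<B>. openin T V"
    "\<forall>U x. openin T U \<and> x \<in> U \<longrightarrow> (\<exists>V\<in>\<B>. x \<in> V \<and> V \<subseteq> U)"
    unfolding second_countable_def by (elim exE conjE)
  have \<B>: "countable \<B>" "V \<in> \<B> \<Longrightarrow> openin T V"
    "openin T U \<Longrightarrow> x \<in> U \<Longrightarrow> \<exists>V\<in>\<B>. x \<in> V \<and> V \<subseteq> U" for V U x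
    using \<B>' by blast+
  define \<A> where "\<A> = (\<lambda>F. space M \<inter> \<Inter>F) ` {F. finite F \<and> F \<subseteq> \<B>}"
  have \<A>_open: "openin T A" if A: "A \<in> \<A>" for A
  proof -
    obtain F where F: "finite F" "F \<subseteq> \<B>" "A = space M \<inter> \<Inter>F" using A by (auto simp: \<A>_def)
    have "openin T (\<Inter>(insert (topspace T) F))" using F \<B>(2) by (intro openin_Inter) auto
    then show ?thesis using F sp by simp
  qed
  have BA: "V \<in> \<A>" if "V \<in> \<B>" for V
    using openin_subset[OF \<B>(2)[OF that]] that sp unfolding \<A>_def by (intro image_eqI[of _ _ "{V}"]) auto
  show ?thesis
  proof (rule that)
    show "countable \<A>" unfolding \<A>_def using \<B>(1) by (intro countable_image countable_Collect_finite_subset)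
    show sub: "\<A> \<subseteq> sets M" using \<A>_open T(3) openin_borel_of by blast
    show "Int_stable \<A>"
    proof (rule Int_stableI)
      fix A B assume "A \<in> \<A>" "B \<in> \<A>"
      then obtain F G where "finite F" "F \<subseteq> \<B>" "A = space M \<inter> \<Inter>F" "finite G" "G \<subseteq> \<B>" "B = space M \<inter> \<Inter>G"
        by (auto simp: \<A>_def)
      then show "A \<inter> B \<in> \<A>" unfolding \<A>_def by (intro image_eqI[of _ _ "F \<union> G"]) auto
    qed
    show "space M \<in> \<A>" unfolding \<A>_def by (intro image_eqI[of _ _ "{}"]) auto
    have "sigma_sets (topspace T) {U. openin T U} \<subseteq> sigma_sets (space M) \<A>"
      unfolding sp
    proof (rule sigma_sets_mono, rule subsetI)
      fix U assume "U \<in> {U. openin T U}"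
      then have U: "openin T U" by simp
      have "U = \<Union>{V \<in> \<B>. V \<subseteq> U}" using \<B>(3)[OF U] by blast
      moreover have "\<Union>{V \<in> \<B>. V \<subseteq> U} \<in> sigma_sets (topspace T) \<A>"
        using \<B>(1) BA by (intro sigma_sets_UNION) (auto intro: sigma_sets.Basic)
      ultimately show "U \<in> sigma_sets (topspace T) \<A>" by simp
    qed
    moreover have "sigma_sets (space M) \<A> \<subseteq> sets M" using sub by (rule sets.sigma_sets_subset)
    ultimately show "sets M = sigma_sets (space M) \<A>"
      unfolding T(3) sets_borel_of by (intro subset_antisym)
    fix x y assume xy: "x \<in> space M" "y \<in> space M" "x \<noteq> y"
    have "Hausdorff_space T"
      using T(1) by (intro metrizable_imp_Hausdorff_space completely_metrizable_imp_metrizable_space)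
    then obtain U V where "openin T U" "openin T V" "x \<in> U" "y \<in> V" "disjnt U V"
      using xy sp unfolding Hausdorff_space_def by metis
    then have "openin T U" "x \<in> U" "y \<notin> U" by (auto simp: disjnt_iff)
    then show "\<exists>A\<in>\<A>. x \<in> A \<and> y \<notin> A" using \<B>(3)[of U x] BA by blast
  qed
qed

context prob_space
begin

text \<open>At almost every point, if the preimages under two representatives differed, some member
  of \<open>\<A>\<close> would contain one and not the other. Then one of the two images of its
  indicator would vanish there while the other is the root of a positive Jacobian. Equality of the
  inverses passes to the automorphisms by evaluating along \<open>S\<close>.\<close>

lemma koopman_faithful:
  assumes \<A>: "countable \<A>" "\<A> \<subseteq> sets M" "space M \<in> \<A>"
    "\<And>x y. x \<in> space M \<Longrightarrow> y \<in> space M \<Longrightarrow> x \<noteq> y \<Longrightarrow> \<exists>A\<in>\<A>. x \<in> A \<and> y \<notin> A"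
    and X: "X \<in> carrier (Aut_star M)" and Y: "Y \<in> carrier (Aut_star M)"
    and eq: "\<And>A. A \<in> \<A> \<Longrightarrow> l2dist (act X (indicator A)) (act Y (indicator A)) = 0"
  shows "X = Y"
proof -
  define S where "S = rep X"
  define T where "T = rep Y"
  have S: "S \<in> nonsingular_automorphisms M" "aut_class M S = X" and T: "T \<in> nonsingular_automorphisms M" "aut_class M T = Y"
    using rep_Aut_star[OF X] rep_Aut_star[OF Y] by (auto simp: S_def T_def)
  have "AE x in M. \<forall>A\<in>\<A>. koopman_fun S (indicator A) x = koopman_fun T (indicator A) x"
    unfolding AE_ball_countable[OF \<A>(1)]
  proof
    fix A assume A: "A \<in> \<A>"
    have s: "act X (indicator A) \<in> square_integrable M" "act Y (indicator A) \<in> square_integrable M"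
      using A \<A>(2) by (auto intro!: act_sq X Y sq_indicator)
    show "AE x in M. koopman_fun S (indicator A) x = koopman_fun T (indicator A) x"
      using eq[OF A] unfolding l2dist_eq_0_iff[OF s] by (simp add: act_def S_def T_def)
  qed
  then have "AE x in M. the_inv_into (space M) S x = the_inv_into (space M) T x"
    using koopman_density_pos[OF S(1)] AE_space
  proof eventually_elim
    case (elim x)
    have S': "the_inv_into (space M) S x \<in> space M" and T': "the_inv_into (space M) T x \<in> space M"
      using nsaD(6)[OF S(1) elim(3)] nsaD(6)[OF T(1) elim(3)] by auto
    have "koopman_fun S (indicator (space M)) x = koopman_fun T (indicator (space M)) x" using elim(1) \<A>(3) by blast
    then have d: "koopman_density S x = koopman_density T x" using S' T' by (simp add: koopman_fun_def)
    show ?case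
    proof (rule ccontr)
      assume "the_inv_into (space M) S x \<noteq> the_inv_into (space M) T x"
      then obtain A where A: "A \<in> \<A>" "the_inv_into (space M) S x \<in> A" "the_inv_into (space M) T x \<notin> A"
        using \<A>(4)[OF S' T'] by blast
      then have "koopman_fun S (indicator A) x = koopman_fun T (indicator A) x" using elim(1) by blast
      then show False using A elim(2) by (simp add: koopman_fun_def)
    qed
  qed
  from nsa_AE[OF S(1) this] have "AE x in M. S x = T x" using AE_space
  proof eventually_elim
    case (elim x)
    then have "x = the_inv_into (space M) T (S x)" using nsaD(7)[OF S(1)] by simp
    then have "T x = T (the_inv_into (space M) T (S x))" by simp
    then show ?case using nsaD(8)[OF T(1) nsaD(5)[OF S(1) elim(2)]] by simp
  qed
  then show ?thesis using aut_class_eq_iff[OF S(1) T(1)] S(2) T(2) by simp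
qed

text \<open>The action is isometric and an indicator has norm at most 1. The bound does not depend
  on the group elements, which makes the series defining a metric converge.\<close>

lemma l2dist_act_indicator_le:
  assumes "A \<in> sets M" "X \<in> carrier (Aut_star M)" "Y \<in> carrier (Aut_star M)"
  shows "l2dist (act X (indicator A)) (act Y (indicator A)) \<le> 2"
proof -
  have z: "(\<lambda>_. 0) \<in> square_integrable M" by (simp add: square_integrable_def)
  have le1: "l2dist (act Z (indicator A)) (\<lambda>_. 0) \<le> 1" if Z: "Z \<in> carrier (Aut_star M)" for Z
  proof -
    have "act Z (\<lambda>_. 0) = (\<lambda>_. 0)" by (simp add: act_def koopman_fun_def fun_eq_iff)
    then have "l2dist (act Z (indicator A)) (\<lambda>_. 0) = l2dist (indicator A) (\<lambda>_. 0)"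
      using act_isometry[OF Z sq_indicator[OF assms(1)] z] by simp
    also have "\<dots> = sqrt (LINT x|M. (indicator A x :: real))"
      unfolding l2dist_def by (intro arg_cong[where f = sqrt] Bochner_Integration.integral_cong) (auto simp: indicator_def)
    also have "\<dots> \<le> 1" using assms(1) by simp
    finally show ?thesis .
  qed
  have "l2dist (act X (indicator A)) (act Y (indicator A))
      \<le> l2dist (act X (indicator A)) (\<lambda>_. 0) + l2dist (\<lambda>_. 0) (act Y (indicator A))"
    using assms z by (intro l2dist_triangle act_sq sq_indicator)
  then show ?thesis
    using le1[OF assms(2)] le1[OF assms(3)] l2dist_commute[of "\<lambda>_. 0" "act Y (indicator A)"] by linarith
qed

lemma metrizable_strong_topology:
  assumes "standard_borel M"
  shows "metrizable_space (strong_topology M)"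
proof -
  let ?C = "carrier (Aut_star M)"
  obtain \<A> where \<A>: "countable \<A>" "\<A> \<subseteq> sets M" "Int_stable \<A>" "space M \<in> \<A>" "sets M = sigma_sets (space M) \<A>"
    "\<And>x y. x \<in> space M \<Longrightarrow> y \<in> space M \<Longrightarrow> x \<noteq> y \<Longrightarrow> \<exists>A\<in>\<A>. x \<in> A \<and> y \<notin> A"
    by (rule standard_borel_generator[OF assms]) (rule that)
  define A where "A = from_nat_into \<A>"
  have rA: "range A = \<A>" unfolding A_def using \<A>(1,4) by (intro range_from_nat_into) auto
  then have As: "A n \<in> sets M" for n using \<A>(2) by blast
  define \<delta> where "\<delta> n X Y = l2dist (act X (indicator (A n))) (act Y (indicator (A n)))" for n X Y
  have \<delta>0: "0 \<le> \<delta> n X Y" for n X Y by (simp add: \<delta>_def l2dist_nonneg)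
  have \<delta>2: "\<delta> n X Y \<le> 2" if "X \<in> ?C" "Y \<in> ?C" for n X Y
    unfolding \<delta>_def using l2dist_act_indicator_le[OF As that] .
  have \<delta>tri: "\<delta> n X Z \<le> \<delta> n X Y + \<delta> n Y Z" if "X \<in> ?C" "Y \<in> ?C" "Z \<in> ?C" for n X Y Z
    unfolding \<delta>_def using that by (intro l2dist_triangle act_sq sq_indicator As)
  \<comment> \<open>The absolute value makes \<open>D\<close> nonnegative for arguments outside the
    carrier as well, as the axioms of \<open>Metric_space\<close> demand.\<close>
  define D where "D X Y = \<bar>\<Sum>n. (1/2)^n * \<delta> n X Y\<bar>" for X Y
  have geo: "summable (\<lambda>n. 2 * (1/2 :: real)^n)" by (intro summable_mult summable_geometric) simp
  have sum: "summable (\<lambda>n. (1/2)^n * \<delta> n X Y)" if "X \<in> ?C" "Y \<in> ?C" for X Y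
  proof (rule summable_comparison_test'[OF geo, of 0])
    show "norm ((1/2)^n * \<delta> n X Y) \<le> 2 * (1/2)^n" for n
      using \<delta>0[of n X Y] \<delta>2[OF that, of n] by (simp add: abs_mult)
  qed
  have D_eq: "D X Y = (\<Sum>n. (1/2)^n * \<delta> n X Y)" if "X \<in> ?C" "Y \<in> ?C" for X Y
    unfolding D_def using suminf_nonneg[OF sum[OF that]] by (simp add: \<delta>0)
  have D_ge: "(1/2)^n * \<delta> n X Y \<le> D X Y" if "X \<in> ?C" "Y \<in> ?C" for n X Y
  proof -
    have "sum (\<lambda>n. (1/2)^n * \<delta> n X Y) {n} \<le> D X Y"
      unfolding D_eq[OF that] by (rule sum_le_suminf[OF sum[OF that]]) (auto simp: \<delta>0)
    then show ?thesis by simp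
  qed
  interpret Dm: Metric_space ?C D
  proof
    fix X Y Z
    show "0 \<le> D X Y" by (simp add: D_def)
    show "D X Y = D Y X" unfolding D_def \<delta>_def by (subst l2dist_commute) simp
    show "D X Y = 0 \<longleftrightarrow> X = Y" if XY: "X \<in> ?C" "Y \<in> ?C"
    proof
      assume D0: "D X Y = 0"
      have "\<delta> n X Y = 0" for n
      proof -
        have "(1/2)^n * \<delta> n X Y \<le> (1/2)^n * 0" using D_ge[OF XY, of n] D0 by simp
        then have "\<delta> n X Y \<le> 0" by (subst (asm) mult_le_cancel_left_pos) simp_all
        then show ?thesis using \<delta>0[of n X Y] by simp
      qed
      then have "l2dist (act X (indicator B)) (act Y (indicator B)) = 0" if "B \<in> \<A>" for B
        using that rA unfolding \<delta>_def by blast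
      then show "X = Y" by (intro koopman_faithful[OF \<A>(1,2,4,6) XY])
    qed (simp add: D_def \<delta>_def)
    show "D X Z \<le> D X Y + D Y Z" if "X \<in> ?C" "Y \<in> ?C" "Z \<in> ?C"
    proof -
      have "D X Z \<le> (\<Sum>n. (1/2)^n * \<delta> n X Y + (1/2)^n * \<delta> n Y Z)"
        unfolding D_eq[OF that(1,3)] using that
        by (intro suminf_le summable_add sum) (auto simp flip: distrib_left intro!: mult_left_mono \<delta>tri)
      also have "\<dots> = D X Y + D Y Z" unfolding D_eq[OF that(1,2)] D_eq[OF that(2,3)] using that by (intro suminf_add[symmetric] sum)
      finally show ?thesis .
    qed
  qed
  have "openin Dm.mtopology W \<longleftrightarrow> openin (strong_topology M) W" for W
  proof
    assume W: "openin (strong_topology M) W"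
    show "openin Dm.mtopology W"
      unfolding Dm.openin_mtopology
    proof (intro conjI allI impI)
      show "W \<subseteq> ?C" using openin_subset[OF W] topspace_strong_topology by simp
      fix X assume X: "X \<in> W"
      then have Xc: "X \<in> ?C" using \<open>W \<subseteq> ?C\<close> by blast
      obtain F \<epsilon> where F: "finite F" "F \<subseteq> \<A>" "0 < \<epsilon>" "strong_nbhd X (indicator ` F) \<epsilon> \<subseteq> W"
        by (rule strong_nbhd_base_generator[OF \<A>(2-5) W X]) (rule that)
      obtain K where K: "finite K" "F = A ` K" using F(1,2) rA by (metis finite_subset_image)
      define N where "N = Max (insert 0 K)"
      have N: "n \<le> N" if "n \<in> K" for n using that K(1) by (simp add: N_def)
      show "\<exists>r>0. Dm.mball X r \<subseteq> W"
      \<comment> \<open>A single term of the series is at most \<open>D\<close>, and the weights of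
        the indices in \<open>K\<close> are at least \<open>(1/2)^N\<close>.\<close>
      proof (intro exI[of _ "(1/2)^N * \<epsilon>"] conjI)
        show "0 < (1/2)^N * \<epsilon>" using F(3) by simp
        have "Dm.mball X ((1/2)^N * \<epsilon>) \<subseteq> strong_nbhd X (indicator ` F) \<epsilon>"
        proof
          fix Y assume "Y \<in> Dm.mball X ((1/2)^N * \<epsilon>)"
          then have Y: "Y \<in> ?C" "D X Y < (1/2)^N * \<epsilon>" by auto
          have "\<delta> n Y X < \<epsilon>" if n: "n \<in> K" for n
          proof -
            have "(1/2)^n * \<delta> n Y X < (1/2)^N * \<epsilon>"
              using D_ge[OF Xc Y(1), of n] Y(2) by (simp add: \<delta>_def l2dist_commute)
            also have "\<dots> \<le> (1/2)^n * \<epsilon>"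
              using N[OF n] F(3) by (intro mult_right_mono power_decreasing) auto
            finally show ?thesis by simp
          qed
          then show "Y \<in> strong_nbhd X (indicator ` F) \<epsilon>"
            using Y(1) K(2) by (auto simp: strong_nbhd_def \<delta>_def)
        qed
        then show "Dm.mball X ((1/2)^N * \<epsilon>) \<subseteq> W" using F(4) by (rule subset_trans)
      qed
    qed
  next
    assume W: "openin Dm.mtopology W"
    show "openin (strong_topology M) W"
    proof (subst openin_subopen, intro ballI)
      fix X assume X: "X \<in> W"
      obtain r where r: "0 < r" "Dm.mball X r \<subseteq> W" using W X by (auto simp: Dm.openin_mtopology)
      have Xc: "X \<in> ?C" using W X by (auto simp: Dm.openin_mtopology)
      have "(\<lambda>N. (1/2 :: real)^N) \<longlonglongrightarrow> 0" by (intro LIMSEQ_power_zero) simp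
      then have "\<forall>\<^sub>F N in sequentially. (1/2 :: real)^N < r / 8" using r by (intro order_tendstoD(2)) auto
      then obtain N where N: "(1/2 :: real)^N < r / 8" by (auto simp: eventually_sequentially)
      \<comment> \<open>The first \<open>N\<close> terms contribute at most \<open>r/4\<close> and
        the tail at most \<open>4 * (1/2)^N\<close>, which is below \<open>r/2\<close>.\<close>
      let ?U = "strong_nbhd X ((\<lambda>n. indicator (A n)) ` {..<N}) (r / 8)"
      have UB: "?U \<subseteq> Dm.mball X r"
      proof
        fix Y assume Y: "Y \<in> ?U"
        then have Yc: "Y \<in> ?C" by (simp add: strong_nbhd_def)
        have small: "\<delta> n X Y \<le> r / 8" if "n < N" for n
          using Y that by (auto simp: strong_nbhd_def \<delta>_def l2dist_commute[of "act X _"] less_imp_le)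
        have s: "(\<lambda>n. (1/2 :: real)^n) sums 2" using geometric_sums[of "1/2 :: real"] by simp
        have tail: "(\<Sum>n. (1/2)^(n+N) * \<delta> (n+N) X Y) \<le> (\<Sum>n. (2 * (1/2)^N) * (1/2)^n)"
        proof (rule suminf_le)
          show "(1/2)^(n+N) * \<delta> (n+N) X Y \<le> (2 * (1/2)^N) * (1/2)^n" for n
            using mult_left_mono[OF \<delta>2[OF Xc Yc, of "n+N"], of "(1/2)^(n+N)"] by (simp add: power_add mult_ac)
          show "summable (\<lambda>n. (1/2)^(n+N) * \<delta> (n+N) X Y)"
            using sum[OF Xc Yc] by (rule summable_ignore_initial_segment)
          show "summable (\<lambda>n. (2 * (1/2)^N) * (1/2 :: real)^n)" using s by (intro summable_mult) (auto simp: sums_iff)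
        qed
        have "D X Y = (\<Sum>n. (1/2)^(n+N) * \<delta> (n+N) X Y) + (\<Sum>n<N. (1/2)^n * \<delta> n X Y)"
          unfolding D_eq[OF Xc Yc] by (rule suminf_split_initial_segment[OF sum[OF Xc Yc]])
        also have "(\<Sum>n<N. (1/2)^n * \<delta> n X Y) \<le> (\<Sum>n<N. (1/2)^n * (r/8))"
          by (intro sum_mono mult_left_mono small) auto
        also have "\<dots> = (\<Sum>n<N. (1/2)^n) * (r/8)" by (simp add: sum_distrib_right)
        also have "(\<Sum>n<N. (1/2 :: real)^n) \<le> (\<Sum>n. (1/2)^n)"
          using s by (intro sum_le_suminf) (auto simp: sums_iff)
        also have "(\<Sum>n. (1/2 :: real)^n) = 2" using s by (simp add: sums_iff)
        also have "(\<Sum>n. (1/2)^(n+N) * \<delta> (n+N) X Y) \<le> (2 * (1/2)^N) * 2"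
          using tail s by (simp add: suminf_mult sums_iff)
        finally have "D X Y < r" using N r(1) by (simp add: mult_right_mono)
        then show "Y \<in> Dm.mball X r" using Xc Yc by simp
      qed
      have "openin (strong_topology M) ?U"
        by (rule openin_strong_nbhd[OF Xc]) (use As in \<open>auto intro: sq_indicator\<close>)
      moreover have "X \<in> ?U" by (rule strong_nbhd_self[OF Xc]) (use r(1) in simp)
      moreover have "?U \<subseteq> W" using UB r(2) by (rule subset_trans)
      ultimately show "\<exists>U. openin (strong_topology M) U \<and> X \<in> U \<and> U \<subseteq> W"
        by (intro exI[of _ ?U] conjI)
    qed
  qed
  then have "Dm.mtopology = strong_topology M" unfolding topology_eq by blast
  then show ?thesis using Dm.metrizable_space_mtopology by metis
qed

end

section \<open>Approximation by permutations of cells\<close>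

context prob_space
begin

text \<open>Permutations of disjoint cells, realised by isomorphisms of the cells with a common
  Lebesgue-conull subset of the unit interval.\<close>

lemma cell_permutations:
  fixes D :: "'i \<Rightarrow> 'a set"
  assumes M: "standard_borel M" "nonatomic M"
    and I: "finite I" and D: "\<And>i. i \<in> I \<Longrightarrow> D i \<in> sets M" "\<And>i. i \<in> I \<Longrightarrow> 0 < measure M (D i)"
    and disj: "disjoint_family_on D I"
  obtains T :: "('i \<Rightarrow> 'i) \<Rightarrow> 'a \<Rightarrow> 'a" where
    "\<And>p. p permutes I \<Longrightarrow> T p \<in> nonsingular_automorphisms M"
    "\<And>p q x. p permutes I \<Longrightarrow> q permutes I \<Longrightarrow> x \<in> space M \<Longrightarrow> T (q \<circ> p) x = T q (T p x)"
    "\<And>p x. p permutes I \<Longrightarrow> x \<in> space M \<Longrightarrow> \<forall>i\<in>I. x \<in> D i \<longrightarrow> p i = i \<Longrightarrow> T p x = x"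
    "\<And>p. p permutes I \<Longrightarrow> AE x in M. \<forall>i\<in>I. x \<in> D (p i) \<longrightarrow> the_inv_into (space M) (T p) x \<in> D i"
    "\<And>p i. p permutes I \<Longrightarrow> i \<in> I \<Longrightarrow>
        AE x in M. x \<in> D (p i) \<longrightarrow> koopman_density (T p) x = measure M (D i) / measure M (D (p i))"
proof -
  have "\<forall>i\<in>I. \<exists>\<phi> \<theta> E. \<phi> \<in> borel_measurable M \<and> \<theta> \<in> measurable borel M \<and> E \<in> sets borel \<and> E \<subseteq> {0<..<1::real} \<and> emeasure lborel E = 1 \<and>
    {x \<in> space M. \<theta> (\<phi> x) = x} \<in> sets M \<and> (\<forall>u\<in>E. \<theta> u \<in> D i \<and> \<phi> (\<theta> u) = u) \<and>
    (\<forall>B\<in>sets M. emeasure M (D i \<inter> B) = emeasure M (D i) * emeasure lborel (E \<inter> \<theta> -` B))" (is "\<forall>i\<in>I. \<exists>\<phi> \<theta> E. ?iso i \<phi> \<theta> E")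
  proof
    fix i assume i: "i \<in> I"
    have "emeasure M (D i) \<noteq> 0" using D(2)[OF i] by (simp add: emeasure_eq_measure)
    from M(1) prob_space_axioms M(2) D(1)[OF i] this
    show "\<exists>\<phi> \<theta> E. ?iso i \<phi> \<theta> E"
      by (rule interval_iso) (intro exI conjI ballI, assumption+, simp_all)
  qed
  from bchoice[OF this] obtain \<phi> where "\<forall>i\<in>I. \<exists>\<theta> E. ?iso i (\<phi> i) \<theta> E" ..
  from bchoice[OF this] obtain \<theta> where "\<forall>i\<in>I. \<exists>E. ?iso i (\<phi> i) (\<theta> i) E" ..
  from bchoice[OF this] obtain E' where iso: "\<forall>i\<in>I. ?iso i (\<phi> i) (\<theta> i) (E' i)" ..
  have \<phi>: "\<phi> i \<in> borel_measurable M" and \<theta>: "\<theta> i \<in> measurable borel M" and E': "E' i \<in> sets borel" "E' i \<subseteq> {0<..<1}" "emeasure lborel (E' i) = 1"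
    and Z: "{x \<in> space M. \<theta> i (\<phi> i x) = x} \<in> sets M" and \<phi>\<theta>': "u \<in> E' i \<Longrightarrow> \<theta> i u \<in> D i" "u \<in> E' i \<Longrightarrow> \<phi> i (\<theta> i u) = u"
    and meas': "B \<in> sets M \<Longrightarrow> emeasure M (D i \<inter> B) = emeasure M (D i) * emeasure lborel (E' i \<inter> \<theta> i -` B)"
    if "i \<in> I" for i u B
    using iso that by blast+
  \<comment> \<open>One conull set of coordinates common to all cells. With it the moves between
    cells compose exactly, so \<open>T\<close> is a homomorphism at every point and not just almost
    everywhere.\<close>
  define E where "E = {0<..<1} - (\<Union>i\<in>I. {0<..<1} - E' i)"
  have nullE: "{0<..<1} - E' i \<in> null_sets lborel" if i: "i \<in> I" for i
  proof -
    have "emeasure lborel ({0<..<1} - E' i) = emeasure lborel {0<..<1::real} - emeasure lborel (E' i)"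
      using E'[OF i] by (intro emeasure_Diff) auto
    then show ?thesis using E'[OF i] by (intro null_setsI) auto
  qed
  have nullU: "(\<Union>i\<in>I. {0<..<1} - E' i) \<in> null_sets lborel" using I nullE by (intro null_sets.finite_UN) auto
  have E_sets: "E \<in> sets borel" unfolding E_def using I E' by (intro sets.Diff sets.finite_UN) auto
  have E_sub: "E \<subseteq> E' i" if "i \<in> I" for i using that E' by (auto simp: E_def)
  have \<phi>\<theta>: "\<theta> i u \<in> D i" "\<phi> i (\<theta> i u) = u" if "i \<in> I" "u \<in> E" for i u
    using \<phi>\<theta>' that E_sub by blast+
  have meas: "emeasure M (D i \<inter> B) = emeasure M (D i) * emeasure lborel (E \<inter> \<theta> i -` B)"
    if i: "i \<in> I" and B: "B \<in> sets M" for i B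
  proof -
    have [measurable]: "\<theta> i -` B \<in> sets borel" using measurable_sets[OF \<theta>[OF i] B] by simp
    have "E' i \<inter> \<theta> i -` B - (\<Union>i\<in>I. {0<..<1} - E' i) = E \<inter> \<theta> i -` B"
      using E'(2)[OF i] E_sub[OF i] by (auto simp: E_def)
    moreover have "emeasure lborel (E' i \<inter> \<theta> i -` B - (\<Union>i\<in>I. {0<..<1} - E' i)) = emeasure lborel (E' i \<inter> \<theta> i -` B)"
      using E'(1)[OF i] by (intro emeasure_Diff_null_set[OF nullU]) auto
    ultimately show ?thesis using meas'[OF i B] by simp
  qed
  \<comment> \<open>The core of a cell: between it and \<open>E\<close> the maps
    \<open>\<phi> i\<close> and \<open>\<theta> i\<close> are mutually inverse. What is left of the
    cell has no coordinate in \<open>E\<close> and is therefore null.\<close>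
  define D0 where "D0 i = D i \<inter> {x \<in> space M. \<phi> i x \<in> E \<and> \<theta> i (\<phi> i x) = x}" for i
  have D0_sets: "D0 i \<in> sets M" if i: "i \<in> I" for i
  proof -
    have "D0 i = D i \<inter> (\<phi> i -` E \<inter> space M) \<inter> {x \<in> space M. \<theta> i (\<phi> i x) = x}" by (auto simp: D0_def)
    then show ?thesis using D(1)[OF i] measurable_sets[OF \<phi>[OF i] E_sets] Z[OF i] by auto
  qed
  have D0_null: "emeasure M (D i - D0 i) = 0" if i: "i \<in> I" for i
  proof -
    have "emeasure M (D i \<inter> (space M - D0 i)) = emeasure M (D i) * emeasure lborel (E \<inter> \<theta> i -` (space M - D0 i))"
      using D0_sets[OF i] by (intro meas[OF i]) auto
    also have "E \<inter> \<theta> i -` (space M - D0 i) = {}"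
      using \<phi>\<theta>[OF i] by (auto simp: D0_def)
    finally have "emeasure M (D i \<inter> (space M - D0 i)) = 0" by simp
    moreover have "D i \<inter> (space M - D0 i) = D i - D0 i" using sets.sets_into_space[OF D(1)[OF i]] by blast
    ultimately show ?thesis by simp
  qed
  have D0_D: "D0 i \<subseteq> D i" for i by (auto simp: D0_def)
  have uniq: "i = j" if "i \<in> I" "j \<in> I" "x \<in> D i" "x \<in> D j" for i j x
    using disj that by (auto simp: disjoint_family_on_def)
  define \<iota> where "\<iota> x = (THE i. i \<in> I \<and> x \<in> D0 i)" for x
  have \<iota>: "\<iota> x = i" if "i \<in> I" "x \<in> D0 i" for i x
    unfolding \<iota>_def using that uniq D0_D by (intro the_equality) blast+
  define T where "T p x = (if x \<in> (\<Union>i\<in>I. D0 i) then \<theta> (p (\<iota> x)) (\<phi> (\<iota> x) x) else x)" for p x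
  have T_in: "T p x = \<theta> (p i) (\<phi> i x)" if "i \<in> I" "x \<in> D0 i" for p i x
    using that \<iota>[OF that] by (auto simp: T_def)
  have T_out: "T p x = x" if "x \<notin> (\<Union>i\<in>I. D0 i)" for p x
    using that unfolding T_def by (rule if_not_P)
  have perm_in: "p i \<in> I" if "p permutes I" "i \<in> I" for p i using permutes_in_image[OF that(1)] that(2) by simp
  have T_D0: "T p x \<in> D0 (p i)" "\<phi> (p i) (T p x) = \<phi> i x" if p: "p permutes I" and i: "i \<in> I" "x \<in> D0 i" for p i x
  proof -
    have u: "\<phi> i x \<in> E" using i by (auto simp: D0_def)
    note pi = perm_in[OF p i(1)]
    show "\<phi> (p i) (T p x) = \<phi> i x" unfolding T_in[OF i] by (rule \<phi>\<theta>(2)[OF pi u])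
    have "\<theta> (p i) (\<phi> i x) \<in> space M" using \<phi>\<theta>(1)[OF pi u] sets.sets_into_space[OF D(1)[OF pi]] by auto
    then show "T p x \<in> D0 (p i)"
      using \<phi>\<theta>[OF pi u] u by (simp add: D0_def T_in[OF i])
  qed
  have T_comp: "T (q \<circ> p) x = T q (T p x)" if p: "p permutes I" and q: "q permutes I" for p q x
  proof (cases "x \<in> (\<Union>i\<in>I. D0 i)")
    case True
    then obtain i where i: "i \<in> I" "x \<in> D0 i" by blast
    show ?thesis using T_in[OF i, of "q \<circ> p"] T_in[OF perm_in[OF p i(1)] T_D0(1)[OF p i], of q] T_D0(2)[OF p i] by simp
  next
    case False
    then show ?thesis using T_out[OF False] by simp
  qed
  have T_id: "T id x = x" for x
  proof (cases "x \<in> (\<Union>i\<in>I. D0 i)")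
    case True
    then obtain i where i: "i \<in> I" "x \<in> D0 i" by blast
    then show ?thesis using T_in[OF i, of id] by (simp add: D0_def)
  qed (rule T_out)
  have T_space: "T p x \<in> space M" if "p permutes I" "x \<in> space M" for p x
  proof (cases "x \<in> (\<Union>i\<in>I. D0 i)")
    case True
    then obtain i where i: "i \<in> I" "x \<in> D0 i" by blast
    then show ?thesis using T_D0(1)[OF that(1) i] by (simp add: D0_def)
  next
    case False
    show ?thesis using that(2) T_out[OF False] by simp
  qed
  define P where "P p i B = D0 i \<inter> (\<phi> i -` (\<theta> (p i) -` B) \<inter> space M)" for p i and B :: "'a set"
  have P_sets: "P p i B \<in> sets M" if "p permutes I" "i \<in> I" "B \<in> sets M" for p i B
  proof -
    have "\<theta> (p i) -` B \<inter> space borel \<in> sets borel" using \<theta>[OF perm_in[OF that(1,2)]] that(3) by (rule measurable_sets)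
    then have "\<phi> i -` (\<theta> (p i) -` B) \<inter> space M \<in> sets M" using \<phi>[OF that(2)] by (intro measurable_sets) auto
    then show ?thesis unfolding P_def by (rule sets.Int[OF D0_sets[OF that(2)]])
  qed
  have vim: "T p -` B \<inter> space M = (\<Union>i\<in>I. P p i B) \<union> (B - (\<Union>i\<in>I. D0 i))" if B: "B \<in> sets M" for p B
  proof (intro equalityI subsetI)
    fix x assume x: "x \<in> T p -` B \<inter> space M"
    show "x \<in> (\<Union>i\<in>I. P p i B) \<union> (B - (\<Union>i\<in>I. D0 i))"
    proof (cases "x \<in> (\<Union>i\<in>I. D0 i)")
      case True
      then obtain i where i: "i \<in> I" "x \<in> D0 i" by blast
      then show ?thesis using x T_in[OF i, of p] by (auto simp: P_def)
    next
      case False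
      then show ?thesis using x T_out[OF False, of p] by simp
    qed
  next
    fix x assume x: "x \<in> (\<Union>i\<in>I. P p i B) \<union> (B - (\<Union>i\<in>I. D0 i))"
    show "x \<in> T p -` B \<inter> space M"
    proof (cases "x \<in> (\<Union>i\<in>I. D0 i)")
      case True
      then obtain i where "i \<in> I" "x \<in> P p i B" using x by blast
      then show ?thesis using T_in[of i x p] by (auto simp: P_def D0_def)
    next
      case False
      moreover have "x \<in> B"
      proof (rule ccontr)
        assume "x \<notin> B"
        then obtain i where "i \<in> I" "x \<in> P p i B" using x by blast
        then show False using False by (auto simp: P_def)
      qed
      ultimately show ?thesis using T_out[OF False, of p] sets.sets_into_space[OF B] by auto
    qed
  qed
  have vim_sets: "T p -` B \<inter> space M \<in> sets M" if "p permutes I" "B \<in> sets M" for p B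
    unfolding vim[OF that(2)] using I P_sets[OF that(1) _ that(2)] D0_sets that(2) by (intro sets.Un sets.Diff sets.finite_UN) auto
  have T_meas: "T p \<in> measurable M M" if "p permutes I" for p
    using T_space[OF that] vim_sets[OF that] by (intro measurableI) auto
  \<comment> \<open>The coordinates of this piece are those of \<open>B\<close> as seen from the
    cell \<open>p i\<close>; only the prefactor remembers \<open>i\<close>, whence the Jacobian is a
    constant quotient of masses.\<close>
  have P_meas: "emeasure M (P p i B) = emeasure M (D i) * emeasure lborel (E \<inter> \<theta> (p i) -` B)"
    if p: "p permutes I" and i: "i \<in> I" and B: "B \<in> sets M" for p i B
  proof -
    have "P p i B = D i \<inter> P p i B" using D0_D by (auto simp: P_def)
    then have "emeasure M (P p i B) = emeasure M (D i \<inter> P p i B)" by simp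
    also have "\<dots> = emeasure M (D i) * emeasure lborel (E \<inter> \<theta> i -` P p i B)"
      by (rule meas[OF i P_sets[OF p i B]])
    also have "E \<inter> \<theta> i -` P p i B = E \<inter> \<theta> (p i) -` B"
      using \<phi>\<theta>[OF i] sets.sets_into_space[OF D(1)[OF i]] by (auto simp: P_def D0_def)
    finally show ?thesis .
  qed
  have P_null: "emeasure M (P p i B) = 0" if p: "p permutes I" and i: "i \<in> I" and B: "B \<in> sets M" "emeasure M B = 0" for p i B
  proof -
    note pi = perm_in[OF p i]
    have "emeasure M (D (p i) \<inter> B) \<le> emeasure M B" using B by (intro emeasure_mono) auto
    then have "emeasure M (D (p i)) * emeasure lborel (E \<inter> \<theta> (p i) -` B) = 0" using meas[OF pi B(1)] B(2) by simp
    moreover have "emeasure M (D (p i)) \<noteq> 0" using D(2)[OF pi] by (simp add: emeasure_eq_measure)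
    ultimately have "emeasure lborel (E \<inter> \<theta> (p i) -` B) = 0" by simp
    then show ?thesis unfolding P_meas[OF p i B(1)] by simp
  qed
  have null1: "emeasure M (T p -` B \<inter> space M) = 0" if p: "p permutes I" and B: "B \<in> sets M" "emeasure M B = 0" for p B
  proof -
    have "(\<Union>i\<in>I. P p i B) \<in> null_sets M" using I P_null[OF p _ B] P_sets[OF p _ B(1)] by (intro null_sets.finite_UN) auto
    moreover have "B - (\<Union>i\<in>I. D0 i) \<in> null_sets M"
      using B I D0_sets by (intro null_set_Diff) auto
    ultimately have "(\<Union>i\<in>I. P p i B) \<union> (B - (\<Union>i\<in>I. D0 i)) \<in> null_sets M" by (rule null_sets.Un)
    then show ?thesis unfolding vim[OF B(1)] by auto
  qed
  have T_inv: "T (Hilbert_Choice.inv p) (T p x) = x" "T p (T (Hilbert_Choice.inv p) x) = x" if p: "p permutes I" for p x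
  proof -
    have "T (Hilbert_Choice.inv p) (T p x) = T (Hilbert_Choice.inv p \<circ> p) x" by (rule T_comp[OF p permutes_inv[OF p], symmetric])
    also have "Hilbert_Choice.inv p \<circ> p = id" by (rule permutes_inv_o(2)[OF p])
    finally show "T (Hilbert_Choice.inv p) (T p x) = x" by (simp only: T_id)
    have "T p (T (Hilbert_Choice.inv p) x) = T (p \<circ> Hilbert_Choice.inv p) x" by (rule T_comp[OF permutes_inv[OF p] p, symmetric])
    also have "p \<circ> Hilbert_Choice.inv p = id" by (rule permutes_inv_o(1)[OF p])
    finally show "T p (T (Hilbert_Choice.inv p) x) = x" by (simp only: T_id)
  qed
  have null2: "emeasure M (T p -` B \<inter> space M) = 0 \<longleftrightarrow> emeasure M B = 0"
    if p: "p permutes I" and B: "B \<in> sets M" for p B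
  proof
    assume "emeasure M (T p -` B \<inter> space M) = 0"
    from null1[OF permutes_inv[OF p] vim_sets[OF p B] this]
    have "emeasure M (T (Hilbert_Choice.inv p) -` (T p -` B \<inter> space M) \<inter> space M) = 0" .
    moreover have "T (Hilbert_Choice.inv p) -` (T p -` B \<inter> space M) \<inter> space M = B"
      using T_inv[OF p] T_space[OF permutes_inv[OF p]] sets.sets_into_space[OF B] by auto
    ultimately show "emeasure M B = 0" by simp
  qed (rule null1[OF p B])
  have T_nsa: "T p \<in> nonsingular_automorphisms M"
    and T_the_inv: "x \<in> space M \<Longrightarrow> the_inv_into (space M) (T p) x = T (Hilbert_Choice.inv p) x"
    if p: "p permutes I" for p x
    using nsaI[OF T_meas[OF p] T_meas[OF permutes_inv[OF p]] T_inv[OF p] null2[OF p]] by blast+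
  show ?thesis
  proof (rule that)
    show "T p \<in> nonsingular_automorphisms M" if "p permutes I" for p by (rule T_nsa[OF that])
    show "T (q \<circ> p) x = T q (T p x)" if "p permutes I" "q permutes I" "x \<in> space M" for p q x
      by (rule T_comp[OF that(1,2)])
    show "T p x = x" if p: "p permutes I" and x: "x \<in> space M" and fix_i: "\<forall>i\<in>I. x \<in> D i \<longrightarrow> p i = i" for p x
    proof (cases "x \<in> (\<Union>i\<in>I. D0 i)")
      case True
      then obtain i where i: "i \<in> I" "x \<in> D0 i" by blast
      have "p i = i" using fix_i i D0_D by blast
      then show ?thesis using T_in[OF i, of p] i(2) by (simp add: D0_def)
    qed (rule T_out)
    show "AE x in M. \<forall>i\<in>I. x \<in> D (p i) \<longrightarrow> the_inv_into (space M) (T p) x \<in> D i" if p: "p permutes I" for p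
    proof -
      have "AE x in M. x \<in> D i \<longrightarrow> x \<in> D0 i" if i: "i \<in> I" for i
        using D0_null[OF i] D(1)[OF i] D0_sets[OF i] by (intro AE_I'[of "D i - D0 i"]) auto
      then have "AE x in M. \<forall>i\<in>I. x \<in> D i \<longrightarrow> x \<in> D0 i" using I by (simp add: AE_finite_all)
      then show ?thesis using AE_space
      proof eventually_elim
        case (elim x)
        show ?case
        proof (intro ballI impI)
          fix i assume i: "i \<in> I" "x \<in> D (p i)"
          then have "x \<in> D0 (p i)" using elim perm_in[OF p] by blast
          from T_D0(1)[OF permutes_inv[OF p] perm_in[OF p i(1)] this]
          have "T (Hilbert_Choice.inv p) x \<in> D0 i" by (simp add: permutes_inverses(2)[OF p])
          then show "the_inv_into (space M) (T p) x \<in> D i" using T_the_inv[OF p elim(2)] D0_D by auto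
        qed
      qed
    qed
    show "AE x in M. x \<in> D (p i) \<longrightarrow> koopman_density (T p) x = measure M (D i) / measure M (D (p i))"
      if p: "p permutes I" and i: "i \<in> I" for p i
    proof (rule koopman_density_const[OF T_nsa[OF p]])
      note pi = perm_in[OF p i]
      show "D (p i) \<in> sets M" by (rule D(1)[OF pi])
      show "0 \<le> measure M (D i) / measure M (D (p i))" by simp
      fix B assume B: "B \<in> sets M" "B \<subseteq> D (p i)"
      have "emeasure M (T p -` B \<inter> space M) = emeasure M (P p i B)"
      proof (rule emeasure_eq_AE)
        \<comment> \<open>Outside the cores \<open>T p\<close> is the identity, so points of the
          target cell off its core are their own preimages; they form a null set.\<close>
        have "AE x in M. x \<notin> D (p i) - D0 (p i)"
          using D0_null[OF pi] D(1)[OF pi] D0_sets[OF pi] by (intro AE_not_in) auto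
        then show "AE x in M. (x \<in> T p -` B \<inter> space M) = (x \<in> P p i B)"
        proof eventually_elim
          case (elim x)
          have "x \<notin> P p j B" if j: "j \<in> I" "j \<noteq> i" for j
          proof
            assume x: "x \<in> P p j B"
            then have "x \<in> D0 j" "\<theta> (p j) (\<phi> j x) \<in> B" by (auto simp: P_def)
            then have "T p x \<in> D (p j)" "T p x \<in> D (p i)"
              using T_D0(1)[OF p j(1), of x] D0_D[of "p j"] B(2) T_in[OF j(1), of x p] by (blast, auto)
            then have "p j = p i" using uniq perm_in[OF p j(1)] pi by blast
            then show False using permutes_inj[OF p] j(2) by (auto simp: inj_eq)
          qed
          moreover have "x \<notin> B - (\<Union>i\<in>I. D0 i)" using elim B(2) pi by blast
          ultimately show ?case unfolding vim[OF B(1)] using i by blast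
        qed
      qed (use vim_sets[OF p B(1)] P_sets[OF p i B(1)] in auto)
      also have "\<dots> = emeasure M (D i) * emeasure lborel (E \<inter> \<theta> (p i) -` B)" by (rule P_meas[OF p i B(1)])
      also have "\<dots> = ennreal (measure M (D i) / measure M (D (p i))) * (emeasure M (D (p i)) * emeasure lborel (E \<inter> \<theta> (p i) -` B))"
      proof -
        have "emeasure M (D i) = ennreal (measure M (D i) / measure M (D (p i))) * emeasure M (D (p i))"
          using D(2)[OF pi] by (simp add: emeasure_eq_measure ennreal_mult[symmetric])
        then show ?thesis by (simp add: mult.assoc)
      qed
      also have "emeasure M (D (p i)) * emeasure lborel (E \<inter> \<theta> (p i) -` B) = emeasure M (D (p i) \<inter> B)"
        by (rule meas[OF pi B(1), symmetric])
      also have "D (p i) \<inter> B = B" using B(2) by blast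
      finally show "emeasure M (T p -` B \<inter> space M) = ennreal (measure M (D i) / measure M (D (p i))) * emeasure M B" .
    qed
  qed
qed


text \<open>The coordinate of \<open>interval_iso\<close> cuts \<open>D\<close> into slices of
  prescribed proportion. On a null set any coordinate will do.\<close>

lemma interval_slices:
  assumes M: "standard_borel M" "nonatomic M" and D: "D \<in> sets M"
  shows "\<exists>\<phi>\<in>borel_measurable M. \<forall>a b. 0 \<le> a \<and> a \<le> b \<and> b \<le> 1 \<longrightarrow>
       measure M (D \<inter> (\<phi> -` {a<..b::real} \<inter> space M)) = measure M D * (b - a)"
proof (cases "emeasure M D = 0")
  case True
  have "measure M (D \<inter> (\<phi> -` {a<..b::real} \<inter> space M)) \<le> measure M D" for \<phi> a b
    using D by (intro finite_measure_mono) auto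
  then show ?thesis using True by (intro bexI[of _ "\<lambda>_. 0"]) (auto simp: measure_def intro!: antisym)
next
  case False
  obtain \<phi> :: "'a \<Rightarrow> real" and \<theta> E where
    \<phi>: "\<phi> \<in> borel_measurable M" and \<theta>: "\<theta> \<in> measurable borel M" and E: "E \<in> sets borel" "E \<subseteq> {0<..<1}" "emeasure lborel E = 1"
    and E2: "\<And>u. u \<in> E \<Longrightarrow> \<theta> u \<in> D \<and> \<phi> (\<theta> u) = u"
    and eq: "\<And>B. B \<in> sets M \<Longrightarrow> emeasure M (D \<inter> B) = emeasure M D * emeasure lborel (E \<inter> \<theta> -` B)"
    by (rule interval_iso[OF M(1) prob_space_axioms M(2) D False]) (rule that)
  have "measure M (D \<inter> (\<phi> -` {a<..b} \<inter> space M)) = measure M D * (b - a)" if ab: "0 \<le> a" "a \<le> b" "b \<le> 1" for a b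
  proof -
    have "emeasure M (D \<inter> (\<phi> -` {a<..b} \<inter> space M)) = emeasure M D * emeasure lborel (E \<inter> \<theta> -` (\<phi> -` {a<..b} \<inter> space M))"
      using \<phi> by (intro eq measurable_sets) auto
    also have "E \<inter> \<theta> -` (\<phi> -` {a<..b} \<inter> space M) = E \<inter> {a<..b}"
      using E2 measurable_space[OF \<theta>] by auto
    also have "emeasure lborel (E \<inter> {a<..b}) = emeasure lborel {a<..b}"
    proof -
      have "emeasure lborel ({0<..<1} - E) = emeasure lborel {0<..<1::real} - emeasure lborel E"
        using E by (intro emeasure_Diff) auto
      then have "{0<..<1} - E \<in> null_sets lborel" using E by (intro null_setsI) auto
      \<comment> \<open>\<open>E\<close> lies in the open interval while \<open>b\<close> may equal
        1, so the endpoint is discarded together with the null remainder.\<close>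
      then have "({0<..<1} - E) \<union> {1} \<in> null_sets lborel" by (intro null_sets.Un) auto
      then have "emeasure lborel ({a<..b} - (({0<..<1} - E) \<union> {1})) = emeasure lborel {a<..b}"
        by (intro emeasure_Diff_null_set) auto
      moreover have "emeasure lborel ({a<..b} - (({0<..<1} - E) \<union> {1})) \<le> emeasure lborel (E \<inter> {a<..b})"
        using E ab by (intro emeasure_mono) auto
      moreover have "emeasure lborel (E \<inter> {a<..b}) \<le> emeasure lborel {a<..b}"
        by (intro emeasure_mono) auto
      ultimately show ?thesis by (intro antisym) simp_all
    qed
    finally show ?thesis using ab by (simp add: emeasure_eq_measure ennreal_mult[symmetric])
  qed
  then show ?thesis using \<phi> by blast
qed

text \<open>Cells whose sizes range over a long geometric progression, every size occupying
  nearly the same mass in each of the given sets.  A set may then be mapped onto another one with a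
  constant Jacobian just by shifting sizes.\<close>

lemma geometric_cells:
  assumes M: "standard_borel M" "nonatomic M"
    and S: "finite \<S>" "\<S> \<subseteq> sets M" and pos: "0 < L" "0 < h" "0 < \<epsilon>" "0 < \<kappa>0"
  obtains \<kappa> and I :: "('a set set \<times> nat \<times> nat) set" and D where
    "0 < \<kappa>" "\<kappa> \<le> \<kappa>0" "finite I" "\<And>i. i \<in> I \<Longrightarrow> D i \<in> sets M"
    "\<And>i. i \<in> I \<Longrightarrow> measure M (D i) = \<kappa> * exp (- h * real (fst (snd i)))" "\<And>i. i \<in> I \<Longrightarrow> fst (snd i) < L"
    "disjoint_family_on D I" "\<And>i A. i \<in> I \<Longrightarrow> A \<in> \<S> \<Longrightarrow> D i \<subseteq> A \<or> D i \<inter> A = {}"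
    "\<And>A s. A \<in> \<S> \<Longrightarrow> s < L \<Longrightarrow>
       measure M A / L - \<epsilon> \<le> real (card {i\<in>I. D i \<subseteq> A \<and> fst (snd i) = s}) * (\<kappa> * exp (- h * real s))"
proof -
  \<comment> \<open>Rounding down costs each atom less than one cell per size, of mass at most
    \<open>\<kappa>\<close>, and there are at most \<open>2 ^ card \<S>\<close> atoms; so no set
    loses more than \<open>\<epsilon>\<close> at any size.\<close>
  define \<kappa> where "\<kappa> = min \<kappa>0 (\<epsilon> / 2 ^ card \<S>)"
  have \<kappa>: "0 < \<kappa>" "\<kappa> \<le> \<kappa>0" "2 ^ card \<S> * \<kappa> \<le> \<epsilon>"
    using pos by (auto simp: \<kappa>_def min_def field_simps)
  \<comment> \<open>The atoms of the finite algebra generated by \<open>\<S>\<close>, indexed by the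
    subfamily of sets that contain the point.\<close>
  define C where "C v = {x \<in> space M. {A\<in>\<S>. x \<in> A} = v}" for v
  have C_sets: "C v \<in> sets M" if v: "v \<subseteq> \<S>" for v
  proof -
    have "C v = {x \<in> space M. \<forall>A\<in>\<S>. x \<in> A \<longleftrightarrow> A \<in> v}" using v by (auto simp: C_def)
    also have "\<dots> = space M - (\<Union>A\<in>\<S>. if A \<in> v then space M - A else A)"
      using S(2) sets.sets_into_space by (auto split: if_splits)
    also have "\<dots> \<in> sets M" using S by (intro sets.Diff sets.finite_UN) auto
    finally show ?thesis .
  qed
  have "\<forall>v\<in>Pow \<S>. \<exists>\<phi>. \<phi> \<in> borel_measurable M \<and> (\<forall>a b. 0 \<le> a \<and> a \<le> b \<and> b \<le> 1 \<longrightarrow>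
       measure M (C v \<inter> (\<phi> -` {a<..b::real} \<inter> space M)) = measure M (C v) * (b - a))"
    using interval_slices[OF M C_sets] by (intro ballI) blast
  from bchoice[OF this] obtain \<phi> where \<phi>': "\<forall>v\<in>Pow \<S>. \<phi> v \<in> borel_measurable M \<and> (\<forall>a b. 0 \<le> a \<and> a \<le> b \<and> b \<le> 1 \<longrightarrow>
       measure M (C v \<inter> (\<phi> v -` {a<..b::real} \<inter> space M)) = measure M (C v) * (b - a))" ..
  have \<phi>: "\<phi> v \<in> borel_measurable M" "0 \<le> a \<Longrightarrow> a \<le> b \<Longrightarrow> b \<le> 1 \<Longrightarrow>
       measure M (C v \<inter> (\<phi> v -` {a<..b::real} \<inter> space M)) = measure M (C v) * (b - a)" if "v \<subseteq> \<S>" for v a b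
    using \<phi>' that by auto
  define w where "w s = \<kappa> * exp (- h * real s)" for s
  have w: "0 < w s" "w s \<le> \<kappa>" for s using \<kappa>(1) pos by (auto simp: w_def)
  \<comment> \<open>Every one of the \<open>L\<close> sizes is allotted the fraction
    \<open>1 / L\<close> of the atom; this many whole cells of mass \<open>w s\<close> fit into
    it.\<close>
  define n where "n v s = nat \<lfloor>measure M (C v) / (L * w s)\<rfloor>" for v s
  have n_le: "real (n v s) * w s \<le> measure M (C v) / L" for v s
  proof -
    have "real (n v s) \<le> measure M (C v) / (L * w s)" using w[of s] pos by (simp add: n_def)
    then show ?thesis using w[of s] pos by (simp add: field_simps)
  qed
  have n_ge: "measure M (C v) / L - \<kappa> \<le> real (n v s) * w s" for v s
  proof -
    have "measure M (C v) / (L * w s) - 1 \<le> real (n v s)" unfolding n_def by linarith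
    then have "(measure M (C v) / (L * w s) - 1) * w s \<le> real (n v s) * w s" using w[of s] by (intro mult_right_mono) auto
    moreover have "(measure M (C v) / (L * w s) - 1) * w s = measure M (C v) / L - w s"
      using w[of s] pos by (simp add: field_simps)
    ultimately show ?thesis using w[of s] by linarith
  qed
  define \<delta> where "\<delta> v s = w s / measure M (C v)" for v s
  define I where "I = (SIGMA v:Pow \<S>. SIGMA s:{..<L}. {..<n v s})"
  \<comment> \<open>Size \<open>s\<close> owns the slot from \<open>s / L\<close> to
    \<open>(s + 1) / L\<close> of the coordinate and fills it from the left with intervals of length
    \<open>\<delta> v s\<close>, each of which cuts mass \<open>w s\<close> out of the atom.\<close>
  define iv where "iv v s j = {real s / L + real j * \<delta> v s <.. real s / L + real (Suc j) * \<delta> v s}" for v s j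
  define D where "D i = (case i of (v, s, j) \<Rightarrow> C v \<inter> (\<phi> v -` iv v s j \<inter> space M))" for i
  have Cpos: "0 < measure M (C v)" if "j < n v s" for v s j
  proof (rule ccontr)
    assume "\<not> 0 < measure M (C v)"
    then have "measure M (C v) = 0" by (simp add: less_le)
    then show False using that by (simp add: n_def)
  qed
  have \<delta>: "0 < \<delta> v s" "real (Suc j) * \<delta> v s \<le> 1 / L" if "j < n v s" for v s j
  proof -
    show "0 < \<delta> v s" using Cpos[OF that] w[of s] by (simp add: \<delta>_def)
    have "real (Suc j) * w s \<le> real (n v s) * w s" using that w[of s] by (intro mult_right_mono) auto
    also have "\<dots> \<le> measure M (C v) / L" by (rule n_le)
    finally show "real (Suc j) * \<delta> v s \<le> 1 / L" using Cpos[OF that] by (simp add: \<delta>_def field_simps)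
  qed
  have iv_sub: "iv v s j \<subseteq> {real s / L <.. real (Suc s) / L}" if "j < n v s" for v s j
  proof
    fix x assume "x \<in> iv v s j"
    then have x: "real s / L + real j * \<delta> v s < x" "x \<le> real s / L + real (Suc j) * \<delta> v s" by (auto simp: iv_def)
    have "0 \<le> real j * \<delta> v s" using \<delta>(1)[OF that] by simp
    moreover have "real (Suc s) / L = real s / L + 1 / L" by (simp add: add_divide_distrib)
    ultimately show "x \<in> {real s / L <.. real (Suc s) / L}" using x \<delta>(2)[OF that] by (simp only: greaterThanAtMost_iff) linarith
  qed
  have disj_s: "s = s'" if "x \<in> {real s / L <.. real (Suc s) / L}" "x \<in> {real s' / L <.. real (Suc s') / L}" for s s' x
  proof -
    have "real s / L < real (Suc s') / L" "real s' / L < real (Suc s) / L" using that by auto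
    then have "real s < real (Suc s')" "real s' < real (Suc s)" using pos by (auto simp: divide_less_cancel)
    then show ?thesis by linarith
  qed
  have disj_j: "j = j'" if j: "x \<in> iv v s j" "x \<in> iv v s j'" and d: "0 < \<delta> v s" for v s j j' x
  proof -
    have "real j * \<delta> v s < real (Suc j') * \<delta> v s" "real j' * \<delta> v s < real (Suc j) * \<delta> v s"
      using j unfolding iv_def greaterThanAtMost_iff by linarith+
    then have "real j < real (Suc j')" "real j' < real (Suc j)" using d by (auto simp only: mult_less_cancel_right_pos)
    then show ?thesis by linarith
  qed
  have D_meas: "measure M (D (v, s, j)) = w s" if v: "v \<subseteq> \<S>" and s: "s < L" and j: "j < n v s" for v s j
  proof -
    let ?a = "real s / L + real j * \<delta> v s" and ?b = "real s / L + real (Suc j) * \<delta> v s"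
    have "measure M (D (v, s, j)) = measure M (C v) * (?b - ?a)"
      unfolding D_def prod.case iv_def
    proof (rule \<phi>(2)[OF v])
      show "0 \<le> ?a" using \<delta>(1)[OF j] by simp
      show "?a \<le> ?b" using \<delta>(1)[OF j] by (simp add: mult_right_mono)
      have "real s / L + 1 / L = real (Suc s) / L" by (simp add: add_divide_distrib)
      also have "\<dots> \<le> 1" using s by simp
      finally show "?b \<le> 1" using \<delta>(2)[OF j] by linarith
    qed
    also have "?b - ?a = \<delta> v s" by (simp add: algebra_simps)
    finally show ?thesis using Cpos[OF j] by (simp add: \<delta>_def)
  qed
  have fin: "finite I" unfolding I_def using S(1) by (intro finite_SigmaI) auto
  have DC: "D (v, s, j) \<subseteq> C v" for v s j by (auto simp: D_def)
  show ?thesis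
  proof (rule that)
    show "0 < \<kappa>" "\<kappa> \<le> \<kappa>0" "finite I" by fact+
    show "D i \<in> sets M" if "i \<in> I" for i
    proof -
      obtain v s j where i: "i = (v, s, j)" "v \<subseteq> \<S>" using \<open>i \<in> I\<close> by (auto simp: I_def)
      have "\<phi> v -` iv v s j \<inter> space M \<in> sets M" using \<phi>(1)[OF i(2)] by (intro measurable_sets) (auto simp: iv_def)
      then show ?thesis using C_sets[OF i(2)] by (auto simp: i D_def)
    qed
    show "measure M (D i) = \<kappa> * exp (- h * real (fst (snd i)))" if "i \<in> I" for i
      using that D_meas by (auto simp: I_def w_def)
    show "fst (snd i) < L" if "i \<in> I" for i using that by (auto simp: I_def)
    show "disjoint_family_on D I"
      unfolding disjoint_family_on_def
    proof (intro ballI impI)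
      fix i i' assume ii: "i \<in> I" "i' \<in> I" "i \<noteq> i'"
      obtain v s j v' s' j' where i: "i = (v, s, j)" "i' = (v', s', j')" "j < n v s" "j' < n v' s'"
        using ii(1,2) by (auto simp: I_def)
      show "D i \<inter> D i' = {}"
      proof (rule ccontr)
        assume "D i \<inter> D i' \<noteq> {}"
        then obtain x where x: "x \<in> D i" "x \<in> D i'" by blast
        then have "v = v'" by (auto simp: i D_def C_def)
        moreover have xi: "\<phi> v x \<in> iv v s j" "\<phi> v x \<in> iv v s' j'" using x \<open>v = v'\<close> by (auto simp: i D_def)
        moreover have "s = s'"
        proof (rule disj_s)
          show "\<phi> v x \<in> {real s / L <.. real (Suc s) / L}" by (rule subsetD[OF iv_sub[OF i(3)] xi(1)])
          show "\<phi> v x \<in> {real s' / L <.. real (Suc s') / L}"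
            using i(4) \<open>v = v'\<close> by (intro subsetD[OF iv_sub xi(2)]) simp
        qed
        moreover have "j = j'"
        proof (rule disj_j[OF xi(1) _ \<delta>(1)[OF i(3)]])
          show "\<phi> v x \<in> iv v s j'" using xi(2) \<open>s = s'\<close> by simp
        qed
        ultimately show False using ii(3) i by simp
      qed
    qed
    show "D i \<subseteq> A \<or> D i \<inter> A = {}" if "i \<in> I" "A \<in> \<S>" for i A
    proof -
      obtain v s j where i: "i = (v, s, j)" by (cases i)
      show ?thesis using DC[of v s j] that(2) by (auto simp: i C_def)
    qed
    fix A s assume A: "A \<in> \<S>" and s: "s < L"
    let ?V = "{v. v \<subseteq> \<S> \<and> A \<in> v}"
    have finV: "finite ?V" using S(1) by (intro finite_subset[of ?V "Pow \<S>"]) auto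
    have cV: "card ?V \<le> 2 ^ card \<S>"
      using card_mono[of "Pow \<S>" ?V] S(1) by (auto simp: card_Pow)
    have "A \<subseteq> (\<Union>v\<in>?V. C v)"
    proof
      fix x assume x: "x \<in> A"
      then have "x \<in> C {B\<in>\<S>. x \<in> B}" using S(2) A sets.sets_into_space by (auto simp: C_def)
      moreover have "{B\<in>\<S>. x \<in> B} \<in> ?V" using x A by blast
      ultimately show "x \<in> (\<Union>v\<in>?V. C v)" by blast
    qed
    then have "measure M A \<le> measure M (\<Union>v\<in>?V. C v)" using finV C_sets by (intro finite_measure_mono sets.finite_UN) auto
    also have "\<dots> \<le> (\<Sum>v\<in>?V. measure M (C v))" using finV C_sets by (intro finite_measure_subadditive_finite) auto
    finally have "measure M A / L \<le> (\<Sum>v\<in>?V. measure M (C v)) / L" using pos by (intro divide_right_mono) auto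
    also have "\<dots> = (\<Sum>v\<in>?V. measure M (C v) / L - \<kappa>) + real (card ?V) * \<kappa>"
      by (simp add: sum_subtractf sum_divide_distrib)
    also have "real (card ?V) * \<kappa> \<le> \<epsilon>"
    proof -
      have "real (card ?V) \<le> real (2 ^ card \<S>)" using cV by (simp only: of_nat_le_iff)
      then have "real (card ?V) \<le> 2 ^ card \<S>" by simp
      then have "real (card ?V) * \<kappa> \<le> 2 ^ card \<S> * \<kappa>" using \<kappa>(1) by (intro mult_right_mono) auto
      then show ?thesis using \<kappa>(3) by linarith
    qed
    also have "(\<Sum>v\<in>?V. measure M (C v) / L - \<kappa>) \<le> (\<Sum>v\<in>?V. real (n v s) * w s)"
      by (intro sum_mono n_ge)
    also have "\<dots> = real (card (SIGMA v:?V. {..<n v s})) * w s"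
      using finV by (simp add: card_SigmaI sum_distrib_right)
    also have "card (SIGMA v:?V. {..<n v s}) = card ((\<lambda>(v, j). (v, s, j)) ` (SIGMA v:?V. {..<n v s}))"
      by (rule card_image[symmetric]) (auto simp: inj_on_def)
    also have "\<dots> \<le> card {i\<in>I. D i \<subseteq> A \<and> fst (snd i) = s}"
    proof (rule card_mono)
      show "finite {i\<in>I. D i \<subseteq> A \<and> fst (snd i) = s}" using fin by auto
      show "(\<lambda>(v, j). (v, s, j)) ` (SIGMA v:?V. {..<n v s}) \<subseteq> {i\<in>I. D i \<subseteq> A \<and> fst (snd i) = s}"
      proof
        fix i assume "i \<in> (\<lambda>(v, j). (v, s, j)) ` (SIGMA v:?V. {..<n v s})"
        then obtain v j where i: "i = (v, s, j)" "v \<subseteq> \<S>" "A \<in> v" "j < n v s" by auto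
        have "D i \<subseteq> A" using DC[of v s j] i(3) by (auto simp: i(1) C_def)
        then show "i \<in> {i\<in>I. D i \<subseteq> A \<and> fst (snd i) = s}" using i s by (simp add: I_def)
      qed
    qed
    finally show "measure M A / L - \<epsilon> \<le> real (card {i\<in>I. D i \<subseteq> A \<and> fst (snd i) = s}) * (\<kappa> * exp (- h * real s))"
      using w[of s] by (simp add: w_def mult_right_mono)
  qed
qed

text \<open>On the target of a good cell inside \<open>A\<close> the automorphism \<open>T\<close>
  has the constant Jacobian \<open>measure M (D i) / measure M (D (p i))\<close>, and
  \<open>g\<close> has at least this Jacobian, so the overlap integrated over the target is at least
  \<open>measure M (D i)\<close>. The good cells outside \<open>A\<close> bound
  \<open>measure M A\<close> from above, and together the two estimates leave only the mass not
  covered by good cells.\<close>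

lemma cells_l2dist:
  assumes T: "T \<in> nonsingular_automorphisms M" and g: "g \<in> nonsingular_automorphisms M"
    and I: "finite I" and D: "\<And>i. i \<in> I \<Longrightarrow> D i \<in> sets M" "\<And>i. i \<in> I \<Longrightarrow> 0 < measure M (D i)" "disjoint_family_on D I"
    and p: "p permutes I"
    and inv: "AE x in M. \<forall>i\<in>I. x \<in> D (p i) \<longrightarrow> the_inv_into (space M) T x \<in> D i"
    and dens: "\<And>i. i \<in> I \<Longrightarrow> AE x in M. x \<in> D (p i) \<longrightarrow> koopman_density T x = measure M (D i) / measure M (D (p i))"
    and G: "G \<subseteq> I" and A: "A \<in> sets M" and split: "\<And>i. i \<in> G \<Longrightarrow> D i \<subseteq> A \<or> D i \<inter> A = {}"
    and jac: "\<And>i y. i \<in> G \<Longrightarrow> y \<in> D (p i) \<Longrightarrow> measure M (D i) / measure M (D (p i)) \<le> koopman_density g y"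
    and gA: "\<And>i y. i \<in> G \<Longrightarrow> D i \<subseteq> A \<Longrightarrow> y \<in> D (p i) \<Longrightarrow> the_inv_into (space M) g y \<in> A"
  shows "(l2dist (koopman_fun T (indicator A)) (koopman_fun g (indicator A)))\<^sup>2 \<le> 2 * (1 - (\<Sum>i\<in>G. measure M (D i)))"
proof -
  define ov where "ov x = sqrt (koopman_density T x * koopman_density g x) *
        (indicator A (the_inv_into (space M) T x) * indicator A (the_inv_into (space M) g x))" for x
  have ov: "integrable M ov"
    "(l2dist (koopman_fun T (indicator A)) (koopman_fun g (indicator A)))\<^sup>2 = 2 * (measure M A - (LINT x|M. ov x))"
    using l2dist_indicators[OF T g A] unfolding ov_def by auto
  define GA where "GA = {i\<in>G. D i \<subseteq> A}"
  have "finite G" using G I by (rule finite_subset)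
  then have finG: "finite G" "finite GA" by (auto simp: GA_def)
  have pI: "p i \<in> I" if "i \<in> I" for i using permutes_in_image[OF p] that by simp
  \<comment> \<open>A step function below the overlap: its value on each target is the geometric
    mean of two copies of the constant Jacobian.\<close>
  define lo where "lo x = (\<Sum>i\<in>GA. measure M (D i) / measure M (D (p i)) * indicator (D (p i)) x)" for x
  have "AE x in M. \<forall>i\<in>I. x \<in> D (p i) \<longrightarrow> koopman_density T x = measure M (D i) / measure M (D (p i))"
    using I dens by (simp add: AE_finite_all)
  then have "AE x in M. lo x \<le> ov x"
    using inv
  proof eventually_elim
    case (elim x)
    show ?case
    proof (cases "\<exists>i\<in>GA. x \<in> D (p i)")
      case True
      then obtain i where i: "i \<in> GA" "x \<in> D (p i)" by blast
      have iI: "i \<in> I" "i \<in> G" "D i \<subseteq> A" using i(1) G by (auto simp: GA_def)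
      have "indicator (D (p j)) x = (if j = i then 1 else 0 :: real)" if "j \<in> GA" for j
      proof (cases "j = i")
        case False
        have "j \<in> I" using that G by (auto simp: GA_def)
        then have "D (p j) \<inter> D (p i) = {}"
          using D(3) pI iI(1) False permutes_inj[OF p] unfolding disjoint_family_on_def by (metis injD)
        then show ?thesis using i(2) False by (auto simp: indicator_def)
      qed (use i in auto)
      then have "lo x = (\<Sum>j\<in>GA. if j = i then measure M (D j) / measure M (D (p j)) else 0)"
        unfolding lo_def by (intro sum.cong) auto
      also have "\<dots> = measure M (D i) / measure M (D (p i))" using finG(2) i(1) by simp
      finally have lo: "lo x = measure M (D i) / measure M (D (p i))" (is "_ = ?r") .
      have r: "0 \<le> ?r" by simp
      have "the_inv_into (space M) T x \<in> A" using elim(2) iI i(2) by blast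
      moreover have "the_inv_into (space M) g x \<in> A" using gA[OF iI(2,3) i(2)] .
      moreover have "koopman_density T x = ?r" using elim(1) iI(1) i(2) by blast
      ultimately have "ov x = sqrt (?r * koopman_density g x)" by (simp add: ov_def)
      also have "\<dots> \<ge> sqrt (?r * ?r)" using jac[OF iI(2) i(2)] r by (intro real_sqrt_le_mono mult_left_mono)
      finally have "sqrt (?r * ?r) \<le> ov x" .
      then show ?thesis unfolding lo real_sqrt_abs2 abs_of_nonneg[OF r] .
    next
      case False
      then have "lo x = 0" unfolding lo_def by (intro sum.neutral) auto
      then show ?thesis by (simp add: ov_def koopman_density_nonneg)
    qed
  qed
  moreover have GAI: "i \<in> I" if "i \<in> GA" for i using that G by (auto simp: GA_def)
  have ind_int: "integrable M (indicator (D (p i)) :: 'a \<Rightarrow> real)" if "i \<in> GA" for i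
    using D(1)[OF pI[OF GAI[OF that]]] by (intro integrable_real_indicator) (auto simp: less_top[symmetric])
  have lo_int: "integrable M lo" unfolding lo_def using ind_int by (intro Bochner_Integration.integrable_sum integrable_mult_right)
  ultimately have "(LINT x|M. lo x) \<le> (LINT x|M. ov x)" using ov(1) lo_int by (intro integral_mono_AE)
  moreover have "(LINT x|M. lo x) = (\<Sum>i\<in>GA. measure M (D i))"
  proof -
    have "(LINT x|M. lo x) = (\<Sum>i\<in>GA. measure M (D i) / measure M (D (p i)) * measure M (D (p i)))"
      unfolding lo_def using ind_int D(1)[OF pI[OF GAI]] by (subst Bochner_Integration.integral_sum) auto
    also have "\<dots> = (\<Sum>i\<in>GA. measure M (D i))"
      using D(2)[OF pI[OF GAI]] by (intro sum.cong) (auto simp: less_le)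
    finally show ?thesis .
  qed
  \<comment> \<open>By \<open>split\<close>, the good cells not contained in \<open>A\<close> are
    disjoint from it.\<close>
  moreover have "(\<Sum>i\<in>G - GA. measure M (D i)) \<le> 1 - measure M A"
  proof -
    have "(\<Sum>i\<in>G - GA. measure M (D i)) = measure M (\<Union>i\<in>G - GA. D i)"
      using finG(1) D(1,3) G by (intro finite_measure_finite_Union[symmetric]) (auto intro: disjoint_family_on_mono)
    also have "\<dots> \<le> measure M (space M - A)"
    proof (rule finite_measure_mono)
      show "(\<Union>i\<in>G - GA. D i) \<subseteq> space M - A"
      proof
        fix x assume "x \<in> (\<Union>i\<in>G - GA. D i)"
        then obtain i where i: "i \<in> G" "\<not> D i \<subseteq> A" "x \<in> D i" by (auto simp: GA_def)
        have iI: "i \<in> I" using i(1) G by blast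
        have "x \<notin> A" using split[OF i(1)] i(2,3) by blast
        then show "x \<in> space M - A" using sets.sets_into_space[OF D(1)[OF iI]] i(3) by blast
      qed
    qed (use A in auto)
    also have "\<dots> = 1 - measure M A" using A by (rule prob_compl)
    finally show ?thesis .
  qed
  moreover have "(\<Sum>i\<in>G. measure M (D i)) = (\<Sum>i\<in>G - GA. measure M (D i)) + (\<Sum>i\<in>GA. measure M (D i))"
    using finG by (intro sum.subset_diff) (auto simp: GA_def)
  ultimately show ?thesis unfolding ov(2) by simp
qed


lemma koopman_level_measure:
  assumes g: "g \<in> nonsingular_automorphisms M" and B: "B \<in> sets M" and c: "0 \<le> c"
    and le: "\<And>y. y \<in> B \<Longrightarrow> koopman_density g y \<le> c"
  shows "measure M (g -` B \<inter> space M) \<le> c * measure M B"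
proof -
  note [measurable] = nsaD(2)[OF g] B
  have "emeasure M (g -` B \<inter> space M) = (\<integral>\<^sup>+x. indicator (g -` B \<inter> space M) x \<partial>M)"
    by (rule nn_integral_indicator[symmetric]) measurable
  also have "\<dots> = (\<integral>\<^sup>+x. indicator B (g x) \<partial>M)" by (intro nn_integral_cong) (auto simp: indicator_def)
  also have "\<dots> = (\<integral>\<^sup>+x. ennreal (koopman_density g x) * indicator B x \<partial>M)"
    by (rule nn_integral_koopman_density[OF g, symmetric]) simp
  also have "\<dots> \<le> (\<integral>\<^sup>+x. ennreal c * indicator B x \<partial>M)"
    by (intro nn_integral_mono) (auto simp: indicator_def intro!: ennreal_leI le)
  also have "\<dots> = ennreal c * emeasure M B" by (rule nn_integral_cmult_indicator) simp
  finally show ?thesis using c by (simp add: emeasure_eq_measure ennreal_mult[symmetric])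
qed

text \<open>The Jacobian is almost everywhere a positive real, so its logarithmic level is finite
  and the sets of bounded level increase to a conull set. The bound holds for all larger
  \<open>J'\<close> too, so that finitely many automorphisms can share one \<open>J\<close>.\<close>

lemma koopman_levels_exhaust:
  assumes g: "g \<in> nonsingular_automorphisms M" and e: "0 < (e::real)"
  shows "\<exists>J::nat. \<forall>J'\<ge>J. 1 - e \<le> measure M {x \<in> space M. 0 < koopman_density g (g x) \<and> \<bar>\<lfloor>ln (koopman_density g (g x)) / h\<rfloor>\<bar> \<le> int J'}"
proof -
  note [measurable] = nsaD(2)[OF g]
  define U where "U J = {x \<in> space M. 0 < koopman_density g (g x) \<and> \<bar>\<lfloor>ln (koopman_density g (g x)) / h\<rfloor>\<bar> \<le> int J}" for J
  have "\<bar>\<lfloor>z\<rfloor>\<bar> \<le> int J \<longleftrightarrow> - real J \<le> z \<and> z < real J + 1" for z :: real and J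
  proof -
    have "- int J \<le> \<lfloor>z\<rfloor> \<longleftrightarrow> - real J \<le> z" by (simp add: le_floor_iff)
    moreover have "\<lfloor>z\<rfloor> \<le> int J \<longleftrightarrow> z < real J + 1" by (simp add: floor_le_iff)
    ultimately show ?thesis unfolding abs_le_iff by linarith
  qed
  then have "U J = {x \<in> space M. 0 < koopman_density g (g x) \<and>
      - real J \<le> ln (koopman_density g (g x)) / h \<and> ln (koopman_density g (g x)) / h < real J + 1}" for J
    by (simp add: U_def)
  then have U: "U J \<in> sets M" for J by simp
  have "incseq U" unfolding incseq_def U_def by auto
  then have "(\<lambda>J. measure M (U J)) \<longlonglongrightarrow> measure M (\<Union>J. U J)"
    using U by (intro finite_Lim_measure_incseq) auto
  moreover have "measure M (\<Union>J. U J) = 1"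
  proof -
    have "(\<Union>J. U J) = {x \<in> space M. 0 < koopman_density g (g x)}"
    proof (intro equalityI subsetI)
      fix x assume x: "x \<in> {x \<in> space M. 0 < koopman_density g (g x)}"
      then have "x \<in> U (nat \<bar>\<lfloor>ln (koopman_density g (g x)) / h\<rfloor>\<bar>)" by (simp add: U_def)
      then show "x \<in> (\<Union>J. U J)" by blast
    qed (auto simp: U_def)
    moreover have "AE x in M. 0 < koopman_density g (g x)" by (rule nsa_AE[OF g koopman_density_pos[OF g]])
    ultimately show ?thesis by (simp add: prob_Collect_eq_1)
  qed
  ultimately have "\<forall>\<^sub>F J in sequentially. 1 - e < measure M (U J)"
    using e by (intro order_tendstoD(1)[of _ 1]) auto
  then obtain J where "\<And>J'. J \<le> J' \<Longrightarrow> 1 - e < measure M (U J')" by (auto simp: eventually_sequentially)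
  then show ?thesis unfolding U_def by (intro exI[of _ J]) (auto intro: less_imp_le)
qed

text \<open>A shift by at most \<open>J\<close> pushes at most \<open>J\<close> exponents off one
  end of the progression; \<open>max 0 (- k)\<close> is the first exponent that stays in
  range.\<close>

lemma card_shift_range:
  assumes "\<bar>k\<bar> \<le> int J" "J \<le> L"
  shows "L - J \<le> card {s::nat. s < L \<and> 0 \<le> int s + k \<and> int s + k < int L}"
proof -
  have "(\<lambda>r. nat (int r + max 0 (- k))) ` {..<L - J} \<subseteq> {s::nat. s < L \<and> 0 \<le> int s + k \<and> int s + k < int L}"
    using assms by auto
  moreover have "finite {s::nat. s < L \<and> 0 \<le> int s + k \<and> int s + k < int L}" by simp
  ultimately have "card ((\<lambda>r. nat (int r + max 0 (- k))) ` {..<L - J}) \<le> card {s::nat. s < L \<and> 0 \<le> int s + k \<and> int s + k < int L}"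
    by (intro card_mono)
  moreover have "card ((\<lambda>r. nat (int r + max 0 (- k))) ` {..<L - J}) = L - J"
    by (subst card_image) (auto simp: inj_on_def)
  ultimately show ?thesis by simp
qed

text \<open>A source cell of exponent \<open>r\<close> with a label of level \<open>k\<close> wants
  a target of exponent \<open>r + k\<close>, since the quotient of their masses is
  \<open>exp (h * k)\<close>. Three losses appear in the bound: \<open>exp (- h)\<close> is the
  width of a Jacobian level, \<open>J / L\<close> accounts for exponents shifted out of range, and
  the last term collects the counting errors over all labels and exponents.\<close>

lemma cell_matching:
  fixes s :: "'i \<Rightarrow> nat" and A B :: "int \<times> 'b \<Rightarrow> 'a set"
  assumes fin: "finite I" "finite Lab" and h: "0 < h" and \<kappa>: "0 < \<kappa>" and L: "0 < L" "J \<le> L" and \<epsilon>: "0 < \<epsilon>"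
    and Lab: "\<And>l. l \<in> Lab \<Longrightarrow> \<bar>fst l\<bar> \<le> int J"
    and D: "\<And>i. i \<in> I \<Longrightarrow> D i \<noteq> {}" "\<And>i. i \<in> I \<Longrightarrow> s i < L"
    and disj: "disjoint_family_on A Lab" "disjoint_family_on B Lab"
    and cntA: "\<And>l t. l \<in> Lab \<Longrightarrow> t < L \<Longrightarrow> mA l / L - \<epsilon> \<le> real (card {i\<in>I. D i \<subseteq> A l \<and> s i = t}) * (\<kappa> * exp (- h * real t))"
    and cntB: "\<And>l t. l \<in> Lab \<Longrightarrow> t < L \<Longrightarrow> mB l / L - \<epsilon> \<le> real (card {i\<in>I. D i \<subseteq> B l \<and> s i = t}) * (\<kappa> * exp (- h * real t))"
    and AB: "\<And>l. l \<in> Lab \<Longrightarrow> mA l \<le> exp (h * (real_of_int (fst l) + 1)) * mB l" and mA: "\<And>l. l \<in> Lab \<Longrightarrow> 0 \<le> mA l"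
  shows "\<exists>p G. p permutes I \<and> G \<subseteq> I \<and>
     (\<forall>i\<in>G. \<exists>l\<in>Lab. D i \<subseteq> A l \<and> D (p i) \<subseteq> B l \<and> int (s (p i)) = int (s i) + fst l) \<and>
     exp (- h) * (1 - real J / real L) * (\<Sum>l\<in>Lab. mA l) - real (card Lab) * real L * exp (h * real J) * \<epsilon>
      \<le> (\<Sum>i\<in>G. \<kappa> * exp (- h * real (s i)))"
proof -
  \<comment> \<open>Labels are sets so that a cell contained in no \<open>A l\<close> also receives
    a value, the empty set; by disjointness all other labels are singletons. A source records the
    exponent it needs, a target the one it has.\<close>
  define sl where "sl i = {(l, t). l \<in> Lab \<and> D i \<subseteq> A l \<and> t = int (s i) + fst l}" for i
  define tl where "tl i = {(l, t). l \<in> Lab \<and> D i \<subseteq> B l \<and> t = int (s i)}" for i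
  have sl: "sl i = {(l, t)} \<longleftrightarrow> D i \<subseteq> A l \<and> t = int (s i) + fst l" if i: "i \<in> I" and l: "l \<in> Lab" for i l t
  proof -
    have uniq: "l' = l" if "l' \<in> Lab" "D i \<subseteq> A l'" "D i \<subseteq> A l" for l'
    proof (rule ccontr)
      assume "l' \<noteq> l"
      from disjoint_family_onD[OF disj(1) that(1) l this] have "A l' \<inter> A l = {}" .
      moreover have "D i \<subseteq> A l' \<inter> A l" using that(2,3) by (rule Int_greatest)
      ultimately have "D i = {}" by simp
      then show False using D(1)[OF i] by simp
    qed
    show ?thesis
    proof
      assume "sl i = {(l, t)}"
      then have "(l, t) \<in> sl i" by simp
      then show "D i \<subseteq> A l \<and> t = int (s i) + fst l" by (simp add: sl_def)
    next
      assume a: "D i \<subseteq> A l \<and> t = int (s i) + fst l"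
      have "x = (l, t)" if "x \<in> sl i" for x
      proof -
        obtain l' t' where x: "x = (l', t')" by (cases x)
        have x': "l' \<in> Lab" "D i \<subseteq> A l'" "t' = int (s i) + fst l'" using that unfolding x sl_def by simp_all
        have "l' = l" using uniq[OF x'(1,2)] a by simp
        then show ?thesis using x x'(3) a by simp
      qed
      moreover have "(l, t) \<in> sl i" using a l by (simp add: sl_def)
      ultimately show "sl i = {(l, t)}" by blast
    qed
  qed
  have tl: "tl i = {(l, t)} \<longleftrightarrow> D i \<subseteq> B l \<and> t = int (s i)" if i: "i \<in> I" and l: "l \<in> Lab" for i l t
  proof -
    have uniq: "l' = l" if "l' \<in> Lab" "D i \<subseteq> B l'" "D i \<subseteq> B l" for l'
    proof (rule ccontr)
      assume "l' \<noteq> l"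
      from disjoint_family_onD[OF disj(2) that(1) l this] have "B l' \<inter> B l = {}" .
      moreover have "D i \<subseteq> B l' \<inter> B l" using that(2,3) by (rule Int_greatest)
      ultimately have "D i = {}" by simp
      then show False using D(1)[OF i] by simp
    qed
    show ?thesis
    proof
      assume "tl i = {(l, t)}"
      then have "(l, t) \<in> tl i" by simp
      then show "D i \<subseteq> B l \<and> t = int (s i)" by (simp add: tl_def)
    next
      assume a: "D i \<subseteq> B l \<and> t = int (s i)"
      have "x = (l, t)" if "x \<in> tl i" for x
      proof -
        obtain l' t' where x: "x = (l', t')" by (cases x)
        have x': "l' \<in> Lab" "D i \<subseteq> B l'" "t' = int (s i)" using that unfolding x tl_def by simp_all
        have "l' = l" using uniq[OF x'(1,2)] a by simp
        then show ?thesis using x x'(3) a by simp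
      qed
      moreover have "(l, t) \<in> tl i" using a l by (simp add: tl_def)
      ultimately show "tl i = {(l, t)}" by blast
    qed
  qed
  from label_matching[OF fin(1), of sl tl] obtain p where p: "p permutes I"
    and match: "\<forall>x. min (card {i\<in>I. sl i = x}) (card {i\<in>I. tl i = x}) \<le> card {i\<in>I. sl i = x \<and> tl (p i) = x}"
    by (elim exE conjE)
  have pI: "p i \<in> I" if "i \<in> I" for i using permutes_in_image[OF p] that by simp
  define R where "R l = {r. r < L \<and> 0 \<le> int r + fst l \<and> int r + fst l < int L}" for l :: "int \<times> 'b"
  define H where "H l r = {i\<in>I. sl i = {(l, int r + fst l)} \<and> tl (p i) = {(l, int r + fst l)}}" for l r
  define G where "G = (\<Union>(l, r)\<in>(SIGMA l:Lab. R l). H l r)"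
  have finR: "finite (R l)" for l unfolding R_def by auto
  have Hs: "s i = r" "D i \<subseteq> A l" "D (p i) \<subseteq> B l" "int (s (p i)) = int (s i) + fst l" "i \<in> I" if "i \<in> H l r" "l \<in> Lab" for i l r
  proof -
    have i: "i \<in> I" "sl i = {(l, int r + fst l)}" "tl (p i) = {(l, int r + fst l)}"
      using that(1) by (simp_all add: H_def)
    note a = iffD1[OF sl[OF i(1) that(2)] i(2)] and b = iffD1[OF tl[OF pI[OF i(1)] that(2)] i(3)]
    show "s i = r" "D i \<subseteq> A l" "D (p i) \<subseteq> B l" "int (s (p i)) = int (s i) + fst l" "i \<in> I"
      using a b i(1) by simp_all
  qed
  have lower: "exp (- h) * mA l / L - exp (h * real J) * \<epsilon> \<le> real (card (H l r)) * (\<kappa> * exp (- h * real r))"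
    if l: "l \<in> Lab" and r: "r \<in> R l" for l r
  proof -
    define k where "k = fst l"
    define t where "t = nat (int r + k)"
    have t: "int t = int r + k" "t < L" "r < L" using r by (auto simp: R_def t_def k_def)
    have rt: "real t = real r + real_of_int k" using t(1) by (metis of_int_add of_int_of_nat_eq)
    have kJ: "real_of_int k \<le> real J" using Lab[OF l] by (simp add: k_def)
    have eqA: "{i\<in>I. sl i = {(l, int r + fst l)}} = {i\<in>I. D i \<subseteq> A l \<and> s i = r}"
    proof -
      have "sl i = {(l, int r + fst l)} \<longleftrightarrow> D i \<subseteq> A l \<and> s i = r" if "i \<in> I" for i
        unfolding sl[OF that l] by auto
      then show ?thesis by blast
    qed
    have eqB: "{i\<in>I. tl i = {(l, int r + fst l)}} = {i\<in>I. D i \<subseteq> B l \<and> s i = t}"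
    proof -
      have "tl i = {(l, int r + fst l)} \<longleftrightarrow> D i \<subseteq> B l \<and> s i = t" if "i \<in> I" for i
        unfolding tl[OF that l] using t(1) by (auto simp: k_def)
      then show ?thesis by blast
    qed
    let ?w = "\<kappa> * exp (- h * real r)"
    have w: "0 < ?w" using \<kappa> by simp
    have eJ: "1 \<le> exp (h * real J)" using h by simp
    have eh: "exp (- h) \<le> 1" using h by simp
    have a: "exp (- h) * mA l / L - exp (h * real J) * \<epsilon> \<le> real (card {i\<in>I. D i \<subseteq> A l \<and> s i = r}) * ?w"
    proof -
      have "exp (- h) * (mA l / L) \<le> 1 * (mA l / L)" using eh mA[OF l] by (intro mult_right_mono) auto
      moreover have "1 * \<epsilon> \<le> exp (h * real J) * \<epsilon>" using eJ \<epsilon> by (intro mult_right_mono) auto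
      ultimately show ?thesis using cntA[OF l t(3)] by simp
    qed
    \<comment> \<open>Target cells of exponent \<open>t\<close> are counted in units of the source
      mass \<open>?w\<close>, which multiplies their mass by \<open>exp (h * k)\<close>. The level
      bound \<open>AB\<close> costs at most \<open>exp (h * (k + 1))\<close> in the other direction,
      so a factor \<open>exp (- h)\<close> remains; the counting error is scaled by at most
      \<open>exp (h * J)\<close>.\<close>
    have b: "exp (- h) * mA l / L - exp (h * real J) * \<epsilon> \<le> real (card {i\<in>I. D i \<subseteq> B l \<and> s i = t}) * ?w"
    proof -
      have "exp (- h) * mA l \<le> exp (- h) * (exp (h * (real_of_int k + 1)) * mB l)"
        using AB[OF l] by (intro mult_left_mono) (auto simp: k_def)
      also have "\<dots> = exp (h * k) * mB l" by (simp add: mult.assoc[symmetric] exp_add[symmetric] algebra_simps)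
      finally have 1: "exp (- h) * mA l / L \<le> exp (h * k) * mB l / L" using L(1) by (intro divide_right_mono) auto
      have "exp (h * k) * \<epsilon> \<le> exp (h * real J) * \<epsilon>" using h kJ \<epsilon> by (intro mult_right_mono) auto
      then have "exp (- h) * mA l / L - exp (h * real J) * \<epsilon> \<le> exp (h * k) * (mB l / L - \<epsilon>)"
        using 1 by (simp add: right_diff_distrib)
      also have "\<dots> \<le> exp (h * k) * (real (card {i\<in>I. D i \<subseteq> B l \<and> s i = t}) * (\<kappa> * exp (- h * real t)))"
        using cntB[OF l t(2)] by (intro mult_left_mono) auto
      also have "\<dots> = real (card {i\<in>I. D i \<subseteq> B l \<and> s i = t}) * (\<kappa> * (exp (h * k) * exp (- h * real t)))"
        by (simp only: mult_ac)
      also have "exp (h * k) * exp (- h * real t) = exp (- h * real r)"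
        unfolding exp_add[symmetric] rt by (simp add: algebra_simps)
      finally show ?thesis .
    qed
    have "real (min (card {i\<in>I. D i \<subseteq> A l \<and> s i = r}) (card {i\<in>I. D i \<subseteq> B l \<and> s i = t})) * ?w \<le> real (card (H l r)) * ?w"
      using match[rule_format, of "{(l, int r + fst l)}"] w unfolding eqA eqB H_def by (intro mult_right_mono) auto
    moreover have "exp (- h) * mA l / L - exp (h * real J) * \<epsilon>
       \<le> real (min (card {i\<in>I. D i \<subseteq> A l \<and> s i = r}) (card {i\<in>I. D i \<subseteq> B l \<and> s i = t})) * ?w"
      using a b by (simp add: min_def)
    ultimately show ?thesis by linarith
  qed
  have "(\<Sum>i\<in>G. \<kappa> * exp (- h * real (s i))) = (\<Sum>x\<in>(SIGMA l:Lab. R l). \<Sum>i\<in>(case x of (l, r) \<Rightarrow> H l r). \<kappa> * exp (- h * real (s i)))"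
    unfolding G_def
  proof (rule sum.UNION_disjoint)
    show "finite (SIGMA l:Lab. R l)" using fin finR by auto
    show "\<forall>x\<in>(SIGMA l:Lab. R l). finite (case x of (l, r) \<Rightarrow> H l r)" using fin by (auto simp: H_def)
    show "\<forall>x\<in>(SIGMA l:Lab. R l). \<forall>y\<in>(SIGMA l:Lab. R l). x \<noteq> y \<longrightarrow> (case x of (l, r) \<Rightarrow> H l r) \<inter> (case y of (l, r) \<Rightarrow> H l r) = {}"
      by (auto simp: H_def)
  qed
  also have "\<dots> = (\<Sum>x\<in>(SIGMA l:Lab. R l). real (card (H (fst x) (snd x))) * (\<kappa> * exp (- h * real (snd x))))"
  proof (rule sum.cong)
    fix x assume "x \<in> (SIGMA l:Lab. R l)"
    then obtain l r where x: "x = (l, r)" "l \<in> Lab" by auto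
    have "(\<Sum>i\<in>H l r. \<kappa> * exp (- h * real (s i))) = (\<Sum>i\<in>H l r. \<kappa> * exp (- h * real r))"
      using Hs(1)[OF _ x(2)] by (intro sum.cong) auto
    then show "(\<Sum>i\<in>(case x of (l, r) \<Rightarrow> H l r). \<kappa> * exp (- h * real (s i))) = real (card (H (fst x) (snd x))) * (\<kappa> * exp (- h * real (snd x)))"
      by (simp add: x)
  qed simp
  also have "\<dots> \<ge> (\<Sum>x\<in>(SIGMA l:Lab. R l). exp (- h) * mA (fst x) / L - exp (h * real J) * \<epsilon>)"
    using lower by (intro sum_mono) auto
  finally have 1: "(\<Sum>x\<in>(SIGMA l:Lab. R l). exp (- h) * mA (fst x) / L - exp (h * real J) * \<epsilon>) \<le> (\<Sum>i\<in>G. \<kappa> * exp (- h * real (s i)))" .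
  have "(\<Sum>x\<in>(SIGMA l:Lab. R l). exp (- h) * mA (fst x) / L - exp (h * real J) * \<epsilon>)
     = (\<Sum>l\<in>Lab. \<Sum>r\<in>R l. exp (- h) * mA l / L - exp (h * real J) * \<epsilon>)"
    using fin finR by (subst sum.Sigma) (auto simp: case_prod_beta)
  also have "\<dots> \<ge> (\<Sum>l\<in>Lab. exp (- h) * (1 - real J / real L) * mA l - real L * exp (h * real J) * \<epsilon>)"
  proof (rule sum_mono)
    fix l assume l: "l \<in> Lab"
    have c1: "real L - real J \<le> real (card (R l))"
      using card_shift_range[OF Lab[OF l] L(2)] L(2) unfolding R_def by linarith
    have "card (R l) \<le> card {..<L}" by (rule card_mono) (auto simp: R_def)
    then have c2: "real (card (R l)) \<le> real L" by simp
    have "(real L - real J) * (exp (- h) * mA l / L) \<le> real (card (R l)) * (exp (- h) * mA l / L)"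
      using c1 mA[OF l] by (intro mult_right_mono) auto
    moreover have "real (card (R l)) * (exp (h * real J) * \<epsilon>) \<le> real L * (exp (h * real J) * \<epsilon>)"
      using c2 \<epsilon> by (intro mult_right_mono) auto
    moreover have "(real L - real J) * (exp (- h) * mA l / L) = exp (- h) * (1 - real J / real L) * mA l"
      using L(1) by (simp add: field_simps)
    ultimately show "exp (- h) * (1 - real J / real L) * mA l - real L * exp (h * real J) * \<epsilon>
       \<le> (\<Sum>r\<in>R l. exp (- h) * mA l / L - exp (h * real J) * \<epsilon>)"
      by (simp only: sum_constant right_diff_distrib mult.assoc)
  qed
  also have "(\<Sum>l\<in>Lab. exp (- h) * (1 - real J / real L) * mA l - real L * exp (h * real J) * \<epsilon>)
     = exp (- h) * (1 - real J / real L) * (\<Sum>l\<in>Lab. mA l) - real (card Lab) * real L * exp (h * real J) * \<epsilon>"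
    by (simp add: sum_subtractf sum_distrib_left)
  finally have 2: "exp (- h) * (1 - real J / real L) * (\<Sum>l\<in>Lab. mA l) - real (card Lab) * real L * exp (h * real J) * \<epsilon>
      \<le> (\<Sum>i\<in>G. \<kappa> * exp (- h * real (s i)))" using 1 by linarith
  have "\<forall>i\<in>G. \<exists>l\<in>Lab. D i \<subseteq> A l \<and> D (p i) \<subseteq> B l \<and> int (s (p i)) = int (s i) + fst l"
  proof
    fix i assume "i \<in> G"
    then obtain l r where "l \<in> Lab" "i \<in> H l r" by (auto simp: G_def)
    then show "\<exists>l\<in>Lab. D i \<subseteq> A l \<and> D (p i) \<subseteq> B l \<and> int (s (p i)) = int (s i) + fst l" using Hs by blast
  qed
  moreover have "G \<subseteq> I" by (auto simp: G_def H_def)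
  ultimately show ?thesis using p 2 by blast
qed

text \<open>One family of cells is adapted to all level sets of all members of \<open>C\<close> at
  once. The permutation found for \<open>g\<close> is good for every automorphism that moves the
  cells in this way with constant Jacobians, which separates the combinatorial choice from the
  construction of such automorphisms.\<close>

lemma cell_approximation:
  assumes M: "standard_borel M" "nonatomic M" and C: "finite C" "C \<subseteq> nonsingular_automorphisms M"
    and \<A>: "finite \<A>" "\<A> \<subseteq> sets M" and \<eta>: "0 < \<eta>" and \<kappa>0: "0 < \<kappa>0"
  obtains I :: "('a set set \<times> nat \<times> nat) set" and D where
    "finite I" "\<And>i. i \<in> I \<Longrightarrow> D i \<in> sets M" "\<And>i. i \<in> I \<Longrightarrow> 0 < measure M (D i)" "\<And>i. i \<in> I \<Longrightarrow> measure M (D i) \<le> \<kappa>0"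
    "disjoint_family_on D I"
    "\<And>g. g \<in> C \<Longrightarrow> \<exists>p. p permutes I \<and> (\<forall>T\<in>nonsingular_automorphisms M.
        (AE x in M. \<forall>i\<in>I. x \<in> D (p i) \<longrightarrow> the_inv_into (space M) T x \<in> D i) \<longrightarrow>
        (\<forall>i\<in>I. AE x in M. x \<in> D (p i) \<longrightarrow> koopman_density T x = measure M (D i) / measure M (D (p i))) \<longrightarrow>
        (\<forall>A\<in>\<A>. l2dist (koopman_fun T (indicator A)) (koopman_fun g (indicator A)) < \<eta>))"
proof -
  \<comment> \<open>Each of four sources of loss is kept to \<open>e\<close>: level width, ends of
    the progression, unbounded levels, and counting errors. Good cells then have mass at least
    \<open>(1 - e)^3 - e\<close>, which is at least \<open>1 - 4 * e\<close>, and the squared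
    distance is at most \<open>8 * e\<close>, which is below \<open>\<eta>^2\<close>.\<close>
  define e where "e = min (1/2) (\<eta>\<^sup>2 / 16)"
  have e: "0 < e" "e \<le> 1/2" "e \<le> \<eta>\<^sup>2 / 16" using \<eta> by (auto simp: e_def)
  define h where "h = - ln (1 - e)"
  have h: "0 < h" "exp (- h) = 1 - e" using e by (auto simp: h_def ln_less_zero)
  have "\<forall>g\<in>C. \<exists>J::nat. \<forall>J'\<ge>J. 1 - e \<le> measure M {x \<in> space M. 0 < koopman_density g (g x) \<and> \<bar>\<lfloor>ln (koopman_density g (g x)) / h\<rfloor>\<bar> \<le> int J'}"
    using C(2) e(1) by (intro ballI koopman_levels_exhaust) auto
  from bchoice[OF this] obtain Jg :: "('a \<Rightarrow> 'a) \<Rightarrow> nat" where Jg: "\<forall>g\<in>C. \<forall>J'\<ge>Jg g. 1 - e \<le> measure M {x \<in> space M. 0 < koopman_density g (g x) \<and> \<bar>\<lfloor>ln (koopman_density g (g x)) / h\<rfloor>\<bar> \<le> int J'}" ..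
  define J where "J = Max (insert 0 (Jg ` C))"
  have J: "1 - e \<le> measure M {x \<in> space M. 0 < koopman_density g (g x) \<and> \<bar>\<lfloor>ln (koopman_density g (g x)) / h\<rfloor>\<bar> \<le> int J}" if "g \<in> C" for g
    using Jg that C(1) by (auto simp: J_def)
  \<comment> \<open>Long enough for the at most \<open>J\<close> exponents without partner to be a
    fraction at most \<open>e\<close> of the progression.\<close>
  define L where "L = nat \<lceil>real J / e\<rceil> + 1"
  have L: "0 < L" "real J / real L \<le> e" "J \<le> L"
  proof -
    show L0: "0 < L" by (simp add: L_def)
    have "real J / e \<le> real L" unfolding L_def by linarith
    then have JL: "real J \<le> e * real L" using e by (simp add: field_simps)
    then show "real J / real L \<le> e" using L0 by (simp add: field_simps)
    have "e * real L \<le> 1 * real L" using e by (intro mult_right_mono) auto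
    then show "J \<le> L" using JL by simp
  qed
  define Lab where "Lab = {- int J..int J} \<times> Pow \<A>"
  have Lab: "finite Lab" "Lab \<noteq> {}" using \<A>(1) by (auto simp: Lab_def)
  \<comment> \<open>Labels are read off at the target point: the logarithm of the Jacobian of
    \<open>g\<close> there, rounded down to a multiple of \<open>h\<close>, and the members of
    \<open>\<A>\<close> that contain the source point. \<open>A g l\<close> is the corresponding set
    of sources.\<close>
  define B where "B g l = {y \<in> space M. 0 < koopman_density g y \<and> \<lfloor>ln (koopman_density g y) / h\<rfloor> = fst l \<and>
     (\<forall>A\<in>\<A>. the_inv_into (space M) g y \<in> A \<longleftrightarrow> A \<in> snd l)}" for g and l :: "int \<times> 'a set set"
  define A where "A g l = g -` B g l \<inter> space M" for g l
  have BD: "y \<in> space M" "0 < koopman_density g y" "\<lfloor>ln (koopman_density g y) / h\<rfloor> = fst l"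
      "A \<in> \<A> \<Longrightarrow> the_inv_into (space M) g y \<in> A \<longleftrightarrow> A \<in> snd l" if "y \<in> B g l" for g l y A
    using that unfolding B_def mem_Collect_eq by blast+
  have B_sets: "B g l \<in> sets M" if g: "g \<in> nonsingular_automorphisms M" for g l
  proof -
    note [measurable] = nsaD(3)[OF g]
    have "B g l = {y \<in> space M. 0 < koopman_density g y \<and> \<lfloor>ln (koopman_density g y) / h\<rfloor> = fst l} \<inter>
        (space M - (\<Union>A\<in>\<A>. if A \<in> snd l then space M - (the_inv_into (space M) g -` A \<inter> space M) else the_inv_into (space M) g -` A \<inter> space M))"
      by (auto simp: B_def split: if_splits)
    also have "\<dots> \<in> sets M"
    proof (intro sets.Int sets.Diff sets.finite_UN \<A>(1) sets.top)
      show "{y \<in> space M. 0 < koopman_density g y \<and> \<lfloor>ln (koopman_density g y) / h\<rfloor> = fst l} \<in> sets M"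
        unfolding floor_eq_iff by measurable
      show "(if A \<in> snd l then space M - (the_inv_into (space M) g -` A \<inter> space M) else the_inv_into (space M) g -` A \<inter> space M) \<in> sets M"
        if "A \<in> \<A>" for A
        using measurable_sets[OF nsaD(3)[OF g], of A] \<A>(2) that by auto
    qed
    finally show ?thesis .
  qed
  have A_sets: "A g l \<in> sets M" if g: "g \<in> nonsingular_automorphisms M" for g l
    unfolding A_def using nsaD(2)[OF g] B_sets[OF g] by (rule measurable_sets)
  define \<S> where "\<S> = (\<Union>g\<in>C. B g ` Lab \<union> A g ` Lab)"
  have S: "finite \<S>" "\<S> \<subseteq> sets M" using C Lab A_sets B_sets by (auto simp: \<S>_def)
  \<comment> \<open>Makes the error term of \<open>cell_matching\<close> equal to
    \<open>e\<close>.\<close>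
  define \<epsilon> where "\<epsilon> = e / (real (card Lab) * real L * exp (h * real J))"
  have cL: "0 < real (card Lab)" using Lab by (simp add: card_gt_0_iff)
  have \<epsilon>: "0 < \<epsilon>" "real (card Lab) * real L * exp (h * real J) * \<epsilon> = e"
    using cL L(1) e(1) by (auto simp: \<epsilon>_def)
  obtain \<kappa> and I :: "('a set set \<times> nat \<times> nat) set" and D where
    \<kappa>: "0 < \<kappa>" "\<kappa> \<le> \<kappa>0" and I: "finite I" and D: "\<And>i. i \<in> I \<Longrightarrow> D i \<in> sets M"
    and Dm: "\<And>i. i \<in> I \<Longrightarrow> measure M (D i) = \<kappa> * exp (- h * real (fst (snd i)))" and DL: "\<And>i. i \<in> I \<Longrightarrow> fst (snd i) < L"
    and disj: "disjoint_family_on D I" and split: "\<And>i A. i \<in> I \<Longrightarrow> A \<in> \<S> \<Longrightarrow> D i \<subseteq> A \<or> D i \<inter> A = {}"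
    and cnt: "\<And>A s. A \<in> \<S> \<Longrightarrow> s < L \<Longrightarrow>
       measure M A / L - \<epsilon> \<le> real (card {i\<in>I. D i \<subseteq> A \<and> fst (snd i) = s}) * (\<kappa> * exp (- h * real s))"
    by (rule geometric_cells[OF M S L(1) h(1) \<epsilon>(1) \<kappa>0]) (rule that)
  have Dpos: "0 < measure M (D i)" if "i \<in> I" for i using Dm[OF that] \<kappa>(1) by simp
  have Dne: "D i \<noteq> {}" if "i \<in> I" for i using Dpos[OF that] by auto
  show ?thesis
  proof (rule that[OF I D Dpos _ disj])
    show "measure M (D i) \<le> \<kappa>0" if "i \<in> I" for i
    proof -
      have "\<kappa> * exp (- h * real (fst (snd i))) \<le> \<kappa> * 1" using \<kappa>(1) h(1) by (intro mult_left_mono) auto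
      then show ?thesis using Dm[OF that] \<kappa>(2) by simp
    qed
    fix g assume gC: "g \<in> C"
    then have g: "g \<in> nonsingular_automorphisms M" using C(2) by blast
    have AS: "A g l \<in> \<S>" "B g l \<in> \<S>" if "l \<in> Lab" for l using gC that by (auto simp: \<S>_def)
    have disjB: "disjoint_family_on (B g) Lab"
    proof (unfold disjoint_family_on_def, intro ballI impI)
      fix l l' assume l: "l \<in> Lab" "l' \<in> Lab" "l \<noteq> l'"
      show "B g l \<inter> B g l' = {}"
      proof (rule ccontr)
        assume "B g l \<inter> B g l' \<noteq> {}"
        then obtain y where y: "y \<in> B g l" "y \<in> B g l'" by blast
        have "fst l = fst l'" using BD(3)[OF y(1)] BD(3)[OF y(2)] by simp
        moreover have "snd l = snd l'"
        proof (rule Set.set_eqI)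
          have "snd l \<subseteq> \<A>" "snd l' \<subseteq> \<A>" using l(1,2) by (auto simp: Lab_def)
          then show "A \<in> snd l \<longleftrightarrow> A \<in> snd l'" for A
            using BD(4)[OF y(1), of A] BD(4)[OF y(2), of A] by blast
        qed
        ultimately show False using l(3) by (simp add: prod_eq_iff)
      qed
    qed
    have disjA: "disjoint_family_on (A g) Lab"
      using disjB unfolding disjoint_family_on_def A_def by blast
    have AB: "measure M (A g l) \<le> exp (h * (real_of_int (fst l) + 1)) * measure M (B g l)" for l
      unfolding A_def
    proof (rule koopman_level_measure[OF g B_sets[OF g]])
      fix y assume y: "y \<in> B g l"
      have "ln (koopman_density g y) / h < real_of_int (fst l) + 1" using BD(3)[OF y] by linarith
      then have "ln (koopman_density g y) < (real_of_int (fst l) + 1) * h"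
        by (simp only: pos_divide_less_eq[OF h(1)])
      then have "exp (ln (koopman_density g y)) \<le> exp (h * (real_of_int (fst l) + 1))"
        unfolding exp_le_cancel_iff by (simp only: mult.commute less_imp_le)
      moreover have "0 < koopman_density g y" by (rule BD(2)[OF y])
      ultimately show "koopman_density g y \<le> exp (h * (real_of_int (fst l) + 1))" by simp
    qed simp
    have tot: "1 - e \<le> (\<Sum>l\<in>Lab. measure M (A g l))"
    proof -
      have sub: "{x \<in> space M. 0 < koopman_density g (g x) \<and> \<bar>\<lfloor>ln (koopman_density g (g x)) / h\<rfloor>\<bar> \<le> int J} \<subseteq> (\<Union>l\<in>Lab. A g l)"
      proof
        fix x assume x: "x \<in> {x \<in> space M. 0 < koopman_density g (g x) \<and> \<bar>\<lfloor>ln (koopman_density g (g x)) / h\<rfloor>\<bar> \<le> int J}"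
        let ?l = "(\<lfloor>ln (koopman_density g (g x)) / h\<rfloor>, {A\<in>\<A>. x \<in> A})"
        have "?l \<in> Lab" using x by (auto simp: Lab_def)
        moreover have "x \<in> A g ?l" using x nsaD(5,7)[OF g, of x] by (simp add: A_def B_def)
        ultimately show "x \<in> (\<Union>l\<in>Lab. A g l)" by blast
      qed
      have "1 - e \<le> measure M (\<Union>l\<in>Lab. A g l)"
        by (rule order_trans[OF J[OF gC] finite_measure_mono[OF sub]]) (use Lab(1) A_sets[OF g] in auto)
      also have "\<dots> \<le> (\<Sum>l\<in>Lab. measure M (A g l))"
        using Lab(1) A_sets[OF g] by (intro finite_measure_subadditive_finite) auto
      finally show ?thesis .
    qed
    have "\<exists>p G. p permutes I \<and> G \<subseteq> I \<and>
     (\<forall>i\<in>G. \<exists>l\<in>Lab. D i \<subseteq> A g l \<and> D (p i) \<subseteq> B g l \<and> int (fst (snd (p i))) = int (fst (snd i)) + fst l) \<and>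
     exp (- h) * (1 - real J / real L) * (\<Sum>l\<in>Lab. measure M (A g l)) - real (card Lab) * real L * exp (h * real J) * \<epsilon>
      \<le> (\<Sum>i\<in>G. \<kappa> * exp (- h * real (fst (snd i))))"
    proof (rule cell_matching[where mB = "\<lambda>l. measure M (B g l)"])
      show "\<And>l. l \<in> Lab \<Longrightarrow> \<bar>fst l\<bar> \<le> int J" by (auto simp: Lab_def)
    qed (use I Lab h \<kappa> L \<epsilon> Dne DL disjA disjB cnt AS AB in auto)
    then obtain p G where p: "p permutes I" and G: "G \<subseteq> I"
      and GL: "\<forall>i\<in>G. \<exists>l\<in>Lab. D i \<subseteq> A g l \<and> D (p i) \<subseteq> B g l \<and> int (fst (snd (p i))) = int (fst (snd i)) + fst l"
      and mass: "exp (- h) * (1 - real J / real L) * (\<Sum>l\<in>Lab. measure M (A g l)) - real (card Lab) * real L * exp (h * real J) * \<epsilon>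
      \<le> (\<Sum>i\<in>G. \<kappa> * exp (- h * real (fst (snd i))))"
      by (elim exE conjE)
    have pI: "p i \<in> I" if "i \<in> I" for i using permutes_in_image[OF p] that by simp
    have "1 - 4 * e \<le> (1 - e) * (1 - e) * (1 - e) - e"
    proof -
      have "(1 - e) * (1 - e) * (1 - e) - e - (1 - 4 * e) = e * e * (3 - e)" by (simp add: algebra_simps)
      moreover have "0 \<le> e * e * (3 - e)" using e by simp
      ultimately show ?thesis by linarith
    qed
    also have "(1 - e) * (1 - e) * (1 - e) \<le> exp (- h) * (1 - real J / real L) * (\<Sum>l\<in>Lab. measure M (A g l))"
      unfolding h(2) using e L(2) tot by (intro mult_mono) auto
    finally have mass': "1 - 4 * e \<le> (\<Sum>i\<in>G. measure M (D i))"
      using mass \<epsilon>(2) G Dm by (simp add: subset_eq)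
    show "\<exists>p. p permutes I \<and> (\<forall>T\<in>nonsingular_automorphisms M.
        (AE x in M. \<forall>i\<in>I. x \<in> D (p i) \<longrightarrow> the_inv_into (space M) T x \<in> D i) \<longrightarrow>
        (\<forall>i\<in>I. AE x in M. x \<in> D (p i) \<longrightarrow> koopman_density T x = measure M (D i) / measure M (D (p i))) \<longrightarrow>
        (\<forall>A\<in>\<A>. l2dist (koopman_fun T (indicator A)) (koopman_fun g (indicator A)) < \<eta>))"
    proof (intro exI[of _ p] conjI ballI impI p)
      fix T E assume T: "T \<in> nonsingular_automorphisms M"
        and inv: "AE x in M. \<forall>i\<in>I. x \<in> D (p i) \<longrightarrow> the_inv_into (space M) T x \<in> D i"
        and dens: "\<forall>i\<in>I. AE x in M. x \<in> D (p i) \<longrightarrow> koopman_density T x = measure M (D i) / measure M (D (p i))"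
        and E: "E \<in> \<A>"
      \<comment> \<open>All points of a cell with this label lie in the same members of
        \<open>\<A>\<close>, so the cell is not cut by \<open>E\<close>.\<close>
      have DE: "if E \<in> snd l then D i \<subseteq> E else D i \<inter> E = {}" if "D i \<subseteq> A g l" for i l
      proof -
        have "x \<in> E \<longleftrightarrow> E \<in> snd l" if x: "x \<in> D i" for x
        proof -
          have "g x \<in> B g l" "x \<in> space M" using \<open>D i \<subseteq> A g l\<close> x by (auto simp: A_def)
          then show ?thesis using BD(4)[OF _ E, of "g x" g l] nsaD(7)[OF g] by simp
        qed
        then show ?thesis by auto
      qed
      have "(l2dist (koopman_fun T (indicator E)) (koopman_fun g (indicator E)))\<^sup>2 \<le> 2 * (1 - (\<Sum>i\<in>G. measure M (D i)))"
      proof (rule cells_l2dist[OF T g I D Dpos disj p inv _ G])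
        show "AE x in M. x \<in> D (p i) \<longrightarrow> koopman_density T x = measure M (D i) / measure M (D (p i))" if "i \<in> I" for i
          using dens that by blast
        show "E \<in> sets M" using E \<A>(2) by blast
        fix i assume iG: "i \<in> G"
        then obtain l where l: "D i \<subseteq> A g l" "D (p i) \<subseteq> B g l" "int (fst (snd (p i))) = int (fst (snd i)) + fst l"
          using GL by blast
        have iI: "i \<in> I" using iG G by blast
        show "D i \<subseteq> E \<or> D i \<inter> E = {}" using DE[OF l(1)] by (auto split: if_splits)
        fix y assume y: "y \<in> D (p i)"
        then have yB: "y \<in> B g l" using l(2) by blast
        have rt: "real (fst (snd (p i))) = real (fst (snd i)) + real_of_int (fst l)" using l(3) by (metis of_int_add of_int_of_nat_eq)
        have "measure M (D i) / measure M (D (p i)) = exp (- h * real (fst (snd i)) - (- h * real (fst (snd (p i)))))"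
          unfolding Dm[OF iI] Dm[OF pI[OF iI]] exp_diff using \<kappa>(1) by simp
        also have "- h * real (fst (snd i)) - (- h * real (fst (snd (p i)))) = h * real_of_int (fst l)"
          unfolding rt by (simp add: algebra_simps)
        finally have ratio: "measure M (D i) / measure M (D (p i)) = exp (h * real_of_int (fst l))" .
        \<comment> \<open>Levels are rounded down, so the cell map has at most the Jacobian of
          \<open>g\<close>, the direction required by \<open>cells_l2dist\<close>.\<close>
        have "real_of_int (fst l) \<le> ln (koopman_density g y) / h" using BD(3)[OF yB] by linarith
        then have "real_of_int (fst l) * h \<le> ln (koopman_density g y)"
          by (simp only: pos_le_divide_eq[OF h(1)])
        then have "exp (h * real_of_int (fst l)) \<le> exp (ln (koopman_density g y))"
          unfolding exp_le_cancel_iff by (simp only: mult.commute)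
        then show "measure M (D i) / measure M (D (p i)) \<le> koopman_density g y"
          unfolding ratio using BD(2)[OF yB] by simp
        assume iE: "D i \<subseteq> E"
        have "E \<in> snd l" using DE[OF l(1)] iE Dne[OF iI] by (auto split: if_splits)
        then show "the_inv_into (space M) g y \<in> E" using BD(4)[OF yB E] by simp
      qed
      also have "\<dots> \<le> 8 * e" using mass' by simp
      also have "\<dots> < \<eta>\<^sup>2" using e \<eta> zero_less_power[OF \<eta>, of 2] by linarith
      finally show "l2dist (koopman_fun T (indicator E)) (koopman_fun g (indicator E)) < \<eta>"
        by (rule power2_less_imp_less) (use \<eta> in simp)
    qed
  qed
qed

end

section \<open>Levy groups and extreme amenability\<close>

text \<open>The products \<open>k\<close> times the inverse of \<open>g\<close> or \<open>a\<close>
  express closeness in the uniformity of right-invariant metrics, for which \<open>d a k\<close> is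
  the distance from the identity to that product. A single \<open>\<epsilon>\<close> serves both as
  the threshold for large sets and as the permitted defect.\<close>

definition finite_concentration :: "('g, 'm) monoid_scheme \<Rightarrow> 'g topology \<Rightarrow> bool" where
  "finite_concentration G T \<longleftrightarrow> (\<forall>C V \<epsilon>. finite C \<and> C \<subseteq> carrier G \<and> openin T V \<and> \<one>\<^bsub>G\<^esub> \<in> V \<and> 0 < \<epsilon> \<longrightarrow>
     (\<exists>K. subgroup K G \<and> finite K \<and> (\<forall>g\<in>C. \<exists>k\<in>K. k \<otimes>\<^bsub>G\<^esub> inv\<^bsub>G\<^esub> g \<in> V) \<and>
        (\<forall>A\<subseteq>K. \<epsilon> * real (card K) \<le> real (card A) \<longrightarrow>
           (1 - \<epsilon>) * real (card K) \<le> real (card {k\<in>K. \<exists>a\<in>A. k \<otimes>\<^bsub>G\<^esub> inv\<^bsub>G\<^esub> a \<in> V}))))"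

lemma topological_group_right_translation:
  assumes "topological_group G T" "openin T V" "g \<in> carrier G"
  shows "openin T {k \<in> carrier G. k \<otimes>\<^bsub>G\<^esub> g \<in> V}"
proof -
  have top: "topspace T = carrier G" and m: "continuous_map (prod_topology T T) T (\<lambda>(x, y). x \<otimes>\<^bsub>G\<^esub> y)"
    using assms(1) by (auto simp: topological_group_def)
  have "continuous_map T (prod_topology T T) (\<lambda>k. (k, g))"
    using assms(3) top by (intro continuous_map_pairedI) auto
  from continuous_map_compose[OF this m] have "continuous_map T T (\<lambda>k. k \<otimes>\<^bsub>G\<^esub> g)" by (simp add: o_def)
  from openin_continuous_map_preimage[OF this assms(2)] show ?thesis by (simp add: top)
qed

lemma topological_group_left_translation:
  assumes "topological_group G T" "openin T V" "g \<in> carrier G"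
  shows "openin T {k \<in> carrier G. g \<otimes>\<^bsub>G\<^esub> k \<in> V}"
proof -
  have top: "topspace T = carrier G" and m: "continuous_map (prod_topology T T) T (\<lambda>(x, y). x \<otimes>\<^bsub>G\<^esub> y)"
    using assms(1) by (auto simp: topological_group_def)
  have "continuous_map T (prod_topology T T) (\<lambda>k. (g, k))"
    using assms(3) top by (intro continuous_map_pairedI) auto
  from continuous_map_compose[OF this m] have "continuous_map T T (\<lambda>k. g \<otimes>\<^bsub>G\<^esub> k)" by (simp add: o_def)
  from openin_continuous_map_preimage[OF this assms(2)] show ?thesis by (simp add: top)
qed

lemma continuous_action_nbhd:
  assumes "continuous_map (prod_topology T X) X (\<lambda>(g, x). \<phi> g x)" "g \<in> topspace T" "x \<in> topspace X"
    and "openin X P" "\<phi> g x \<in> P"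
  shows "\<exists>U W. openin T U \<and> g \<in> U \<and> openin X W \<and> x \<in> W \<and> (\<forall>h\<in>U. \<forall>y\<in>W. \<phi> h y \<in> P)"
proof -
  have o: "openin (prod_topology T X) {z \<in> topspace (prod_topology T X). (\<lambda>(g, x). \<phi> g x) z \<in> P}"
    by (rule openin_continuous_map_preimage[OF assms(1,4)])
  have "(g, x) \<in> {z \<in> topspace (prod_topology T X). (\<lambda>(g, x). \<phi> g x) z \<in> P}" using assms by simp
  then have "\<exists>U W. openin T U \<and> openin X W \<and> g \<in> U \<and> x \<in> W \<and>
      U \<times> W \<subseteq> {z \<in> topspace (prod_topology T X). (\<lambda>(g, x). \<phi> g x) z \<in> P}"
    using o[unfolded openin_prod_topology_alt, rule_format, of g x] by simp
  then obtain U W where UW: "openin T U" "openin X W" "g \<in> U" "x \<in> W"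
      "U \<times> W \<subseteq> {z \<in> topspace (prod_topology T X). (\<lambda>(g, x). \<phi> g x) z \<in> P}"
    by (elim exE conjE)
  have "\<phi> h y \<in> P" if "h \<in> U" "y \<in> W" for h y
    using subsetD[OF UW(5), of "(h, y)"] that by simp
  then show ?thesis using UW(1-4) by blast
qed

lemma extremely_amenableI:
  assumes tg: "topological_group G T" and conc: "finite_concentration G T"
  shows "extremely_amenable TYPE('x) G T"
  unfolding extremely_amenable_def
proof (intro conjI allI impI tg)
  fix X :: "'x topology" and \<phi>
  assume X: "compact_space X \<and> Hausdorff_space X \<and> topspace X \<noteq> {} \<and> group_action G (topspace X) \<phi> \<and>
        continuous_map (prod_topology T X) X (\<lambda>(g, x). \<phi> g x)"
  then have cpt: "compact_space X" and haus: "Hausdorff_space X" and ne: "topspace X \<noteq> {}"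
    and ga: "group_action G (topspace X) \<phi>" and cont: "continuous_map (prod_topology T X) X (\<lambda>(g, x). \<phi> g x)" by auto
  interpret group_action G "topspace X" \<phi> by (rule ga)
  interpret group G using tg by (simp add: topological_group_def)
  have top: "topspace T = carrier G" using tg by (simp add: topological_group_def)
  note comp = composition_rule
  have im: "\<phi> g x \<in> topspace X" if "g \<in> carrier G" "x \<in> topspace X" for g x
    using element_image[OF that] by blast
  have one: "\<phi> \<one>\<^bsub>G\<^esub> x = x" if "x \<in> topspace X" for x
    using id_eq_one that by (metis restrict_apply')
  show "\<exists>x\<in>topspace X. \<forall>g\<in>carrier G. \<phi> g x = x"
  proof (rule ccontr)
    assume nofix: "\<not> (\<exists>x\<in>topspace X. \<forall>g\<in>carrier G. \<phi> g x = x)"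
    \<comment> \<open>The three group elements near the identity absorb three errors:
      \<open>u\<close> that of replacing the given element by one of the finite subgroup,
      \<open>v\<close> and \<open>v'\<close> those of passing from the enlarged set back to the
      original one.\<close>
    define sep where "sep g V W \<longleftrightarrow> g \<in> carrier G \<and> openin T V \<and> \<one>\<^bsub>G\<^esub> \<in> V \<and> openin X W \<and>
       (\<forall>u\<in>V. \<forall>v\<in>V. \<forall>v'\<in>V. \<forall>y\<in>W. \<forall>y'\<in>W. \<phi> u (\<phi> g (\<phi> v y)) \<noteq> \<phi> v' y')" for g V W
    have "\<exists>g V W. x \<in> W \<and> sep g V W" if x: "x \<in> topspace X" for x
    proof -
      obtain g where g: "g \<in> carrier G" "\<phi> g x \<noteq> x" using nofix x by blast
      note gx = im[OF g(1) x]
      have "\<exists>P Q. openin X P \<and> openin X Q \<and> x \<in> P \<and> \<phi> g x \<in> Q \<and> disjnt P Q"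
        using haus x gx g(2) unfolding Hausdorff_space_def by metis
      then obtain P Q where PQ: "openin X P" "openin X Q" "x \<in> P" "\<phi> g x \<in> Q" "disjnt P Q" by (elim exE conjE)
      obtain V1 W1 where 1: "openin T V1" "\<one>\<^bsub>G\<^esub> \<in> V1" "openin X W1" "x \<in> W1" "\<forall>h\<in>V1. \<forall>y\<in>W1. \<phi> h y \<in> P"
        using continuous_action_nbhd[OF cont _ x PQ(1), of "\<one>\<^bsub>G\<^esub>"] one[OF x] PQ(3) top by auto
      obtain V2 W2 where 2: "openin T V2" "\<one>\<^bsub>G\<^esub> \<in> V2" "openin X W2" "\<phi> g x \<in> W2" "\<forall>h\<in>V2. \<forall>y\<in>W2. \<phi> h y \<in> Q"
        using continuous_action_nbhd[OF cont _ gx PQ(2), of "\<one>\<^bsub>G\<^esub>"] one[OF gx] PQ(4) top by auto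
      obtain V3 W3 where 3: "openin T V3" "g \<in> V3" "openin X W3" "x \<in> W3" "\<forall>h\<in>V3. \<forall>y\<in>W3. \<phi> h y \<in> W2"
        using continuous_action_nbhd[OF cont _ x 2(3,4)] g(1) top by auto
      let ?V4 = "{k \<in> carrier G. g \<otimes>\<^bsub>G\<^esub> k \<in> V3}"
      have V4: "openin T ?V4" by (rule topological_group_left_translation[OF tg 3(1) g(1)])
      have "sep g (V1 \<inter> V2 \<inter> ?V4) (W1 \<inter> W3)"
        unfolding sep_def
      proof (intro conjI ballI)
        show "openin T (V1 \<inter> V2 \<inter> ?V4)" using 1 2 V4 by (intro openin_Int)
        show "openin X (W1 \<inter> W3)" using 1 3 by (intro openin_Int)
        fix u v v' y y' assume a: "u \<in> V1 \<inter> V2 \<inter> ?V4" "v \<in> V1 \<inter> V2 \<inter> ?V4" "v' \<in> V1 \<inter> V2 \<inter> ?V4" "y \<in> W1 \<inter> W3" "y' \<in> W1 \<inter> W3"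
        have yX: "y \<in> topspace X" using a(4) openin_subset[OF 1(3)] by blast
        have "\<phi> g (\<phi> v y) = \<phi> (g \<otimes>\<^bsub>G\<^esub> v) y" using a(2) comp[OF yX g(1), of v] by simp
        then have "\<phi> g (\<phi> v y) \<in> W2" using a(2,4) 3(5) by simp
        then have inQ: "\<phi> u (\<phi> g (\<phi> v y)) \<in> Q" using a(1) 2(5) by simp
        have inP: "\<phi> v' y' \<in> P" using a(3,5) 1(5) by simp
        show "\<phi> u (\<phi> g (\<phi> v y)) \<noteq> \<phi> v' y'"
        proof
          assume "\<phi> u (\<phi> g (\<phi> v y)) = \<phi> v' y'"
          then have "\<phi> v' y' \<in> P \<inter> Q" using inP inQ by simp
          then show False using PQ(5) unfolding disjnt_def by blast
        qed
      qed (use g 1 2 3 in auto)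
      then show ?thesis using 1(4) 3(4) by (intro exI[of _ g] exI[of _ "V1 \<inter> V2 \<inter> ?V4"] exI[of _ "W1 \<inter> W3"]) simp
    qed
    then have "\<forall>x\<in>topspace X. \<exists>g. \<exists>V W. x \<in> W \<and> sep g V W" by (intro ballI)
    from bchoice[OF this] obtain g where "\<forall>x\<in>topspace X. \<exists>V W. x \<in> W \<and> sep (g x) V W" ..
    from bchoice[OF this] obtain V where "\<forall>x\<in>topspace X. \<exists>W. x \<in> W \<and> sep (g x) (V x) W" ..
    from bchoice[OF this] obtain W where "\<forall>x\<in>topspace X. x \<in> W x \<and> sep (g x) (V x) (W x)" ..
    then have gVW: "x \<in> W x" "sep (g x) (V x) (W x)" if "x \<in> topspace X" for x using that by auto
    have "compactin X (topspace X)" using cpt by (simp add: compact_space_def)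
    moreover have "\<forall>U\<in>W ` topspace X. openin X U" using gVW(2) by (auto simp: sep_def)
    moreover have "topspace X \<subseteq> \<Union>(W ` topspace X)" using gVW(1) by blast
    ultimately have "\<exists>\<F>. finite \<F> \<and> \<F> \<subseteq> W ` topspace X \<and> topspace X \<subseteq> \<Union>\<F>" unfolding compactin_def by blast
    then obtain \<F> where F: "finite \<F>" "\<F> \<subseteq> W ` topspace X" "topspace X \<subseteq> \<Union>\<F>" by blast
    obtain Y where Y: "Y \<subseteq> topspace X" "finite Y" "\<F> = W ` Y" using finite_subset_image[OF F(1,2)] by blast
    have Yne: "Y \<noteq> {}" using F(3) Y(3) ne by blast
    define m where "m = card Y"
    have m: "1 \<le> m" using Yne Y(2) by (simp add: m_def Suc_leI card_gt_0_iff)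
    \<comment> \<open>Since \<open>m * \<epsilon> \<le> 1\<close>, one of \<open>m\<close> covering
      sets must contain a proportion \<open>\<epsilon>\<close> of the orbit; since
      \<open>\<epsilon> \<le> 1/3\<close>, its enlargement has proportion at least 2/3.\<close>
    define \<epsilon> where "\<epsilon> = 1 / (real m + 2)"
    have \<epsilon>: "0 < \<epsilon>" "\<epsilon> \<le> 1/3" "real m * \<epsilon> \<le> 1" using m by (auto simp: \<epsilon>_def field_simps)
    have opV: "openin T (\<Inter>(V ` Y))" using Y Yne gVW(2) by (intro openin_Inter) (auto simp: sep_def)
    have oneV: "\<one>\<^bsub>G\<^esub> \<in> \<Inter>(V ` Y)" using Y gVW(2) by (auto simp: sep_def)
    have "finite (g ` Y) \<and> g ` Y \<subseteq> carrier G" using Y gVW(2) by (auto simp: sep_def)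
    then have "\<exists>K. subgroup K G \<and> finite K \<and> (\<forall>h\<in>g ` Y. \<exists>k\<in>K. k \<otimes>\<^bsub>G\<^esub> inv\<^bsub>G\<^esub> h \<in> \<Inter>(V ` Y)) \<and>
        (\<forall>A\<subseteq>K. \<epsilon> * real (card K) \<le> real (card A) \<longrightarrow>
           (1 - \<epsilon>) * real (card K) \<le> real (card {k\<in>K. \<exists>a\<in>A. k \<otimes>\<^bsub>G\<^esub> inv\<^bsub>G\<^esub> a \<in> \<Inter>(V ` Y)}))"
      using conc[unfolded finite_concentration_def, rule_format, of "g ` Y" "\<Inter>(V ` Y)" \<epsilon>] opV oneV \<epsilon>(1) by simp
    then obtain K where K: "subgroup K G" "finite K" and near: "\<forall>h\<in>g ` Y. \<exists>k\<in>K. k \<otimes>\<^bsub>G\<^esub> inv\<^bsub>G\<^esub> h \<in> \<Inter>(V ` Y)"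
      and cK: "\<forall>A\<subseteq>K. \<epsilon> * real (card K) \<le> real (card A) \<longrightarrow>
           (1 - \<epsilon>) * real (card K) \<le> real (card {k\<in>K. \<exists>a\<in>A. k \<otimes>\<^bsub>G\<^esub> inv\<^bsub>G\<^esub> a \<in> \<Inter>(V ` Y)})"
      by (elim exE conjE)
    have KG: "k \<in> carrier G" if "k \<in> K" for k using subgroup.mem_carrier[OF K(1) that] .
    have cpos: "0 < real (card K)" using K subgroup.one_closed[OF K(1)] by (auto simp: card_gt_0_iff)
    obtain x0 where x0: "x0 \<in> topspace X" using ne by blast
    define A where "A x = {h\<in>K. \<phi> h x0 \<in> W x}" for x
    have "\<exists>x\<in>Y. \<epsilon> * real (card K) \<le> real (card (A x))"
    proof (rule ccontr)
      assume "\<not> ?thesis"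
      then have lt: "real (card (A x)) < \<epsilon> * real (card K)" if "x \<in> Y" for x using that by force
      have "K \<subseteq> (\<Union>x\<in>Y. A x)" using im[OF KG x0] F(3) Y(3) by (auto simp: A_def)
      then have "card K \<le> card (\<Union>x\<in>Y. A x)" using Y(2) K(2) by (intro card_mono finite_UN_I) (auto simp: A_def)
      also have "\<dots> \<le> (\<Sum>x\<in>Y. card (A x))" by (rule card_UN_le[OF Y(2)])
      finally have "real (card K) \<le> (\<Sum>x\<in>Y. real (card (A x)))" by (metis of_nat_mono of_nat_sum)
      also have "\<dots> < (\<Sum>x\<in>Y. \<epsilon> * real (card K))" using Y(2) Yne lt by (intro sum_strict_mono)
      also have "\<dots> = (real m * \<epsilon>) * real (card K)" by (simp add: m_def)
      also have "\<dots> \<le> 1 * real (card K)" using \<epsilon>(3) by (intro mult_right_mono) auto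
      finally show False by simp
    qed
    then obtain x where x: "x \<in> Y" "\<epsilon> * real (card K) \<le> real (card (A x))" by blast
    define B where "B = {k\<in>K. \<exists>a\<in>A x. k \<otimes>\<^bsub>G\<^esub> inv\<^bsub>G\<^esub> a \<in> \<Inter>(V ` Y)}"
    have BK: "B \<subseteq> K" by (auto simp: B_def)
    have "A x \<subseteq> K" by (auto simp: A_def)
    then have B: "(1 - \<epsilon>) * real (card K) \<le> real (card B)" using cK x(2) unfolding B_def by blast
    have "(2/3) * real (card K) \<le> (1 - \<epsilon>) * real (card K)" using \<epsilon>(2) by (intro mult_right_mono) auto
    then have Bbig: "real (card K) < 2 * real (card B)" using B cpos by linarith
    obtain k where k: "k \<in> K" "k \<otimes>\<^bsub>G\<^esub> inv\<^bsub>G\<^esub> (g x) \<in> \<Inter>(V ` Y)" using near x(1) by blast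
    let ?kB = "(\<lambda>b. k \<otimes>\<^bsub>G\<^esub> b) ` B"
    have "?kB \<inter> B \<noteq> {}"
    proof
      assume dis: "?kB \<inter> B = {}"
      have "inj_on (\<lambda>b. k \<otimes>\<^bsub>G\<^esub> b) B" using KG k(1) BK by (intro inj_onI) (simp add: subset_eq)
      then have "card ?kB = card B" by (rule card_image)
      moreover have "?kB \<union> B \<subseteq> K" using BK subgroup.m_closed[OF K(1) k(1)] by blast
      then have "card (?kB \<union> B) \<le> card K" using K(2) by (intro card_mono)
      moreover have "card (?kB \<union> B) = card ?kB + card B"
        using dis K(2) BK finite_subset by (intro card_Un_disjoint) blast+
      ultimately show False using Bbig by linarith
    qed
    then obtain b where b: "b \<in> B" "k \<otimes>\<^bsub>G\<^esub> b \<in> B" by blast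
    obtain a where a: "a \<in> A x" "b \<otimes>\<^bsub>G\<^esub> inv\<^bsub>G\<^esub> a \<in> V x" using b(1) x(1) unfolding B_def by blast
    obtain a' where a': "a' \<in> A x" "k \<otimes>\<^bsub>G\<^esub> b \<otimes>\<^bsub>G\<^esub> inv\<^bsub>G\<^esub> a' \<in> V x" using b(2) x(1) unfolding B_def by blast
    define u where "u = k \<otimes>\<^bsub>G\<^esub> inv\<^bsub>G\<^esub> (g x)"
    define v where "v = b \<otimes>\<^bsub>G\<^esub> inv\<^bsub>G\<^esub> a"
    define v' where "v' = k \<otimes>\<^bsub>G\<^esub> b \<otimes>\<^bsub>G\<^esub> inv\<^bsub>G\<^esub> a'"
    have xX: "x \<in> topspace X" using x(1) Y(1) by blast
    have gx: "g x \<in> carrier G" using gVW(2)[OF xX] by (simp add: sep_def)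
    have cs: "k \<in> carrier G" "b \<in> carrier G" "a \<in> carrier G" "a' \<in> carrier G"
      using KG k(1) b(1) BK a(1) a'(1) by (auto simp: A_def)
    have uvc: "u \<in> carrier G" "v \<in> carrier G" "v' \<in> carrier G" using cs gx by (auto simp: u_def v_def v'_def)
    have V: "u \<in> V x" "v \<in> V x" "v' \<in> V x" using k(2) x(1) a(2) a'(2) by (auto simp: u_def v_def v'_def)
    have Wy: "\<phi> a x0 \<in> W x" "\<phi> a' x0 \<in> W x" using a(1) a'(1) by (auto simp: A_def)
    \<comment> \<open>The product \<open>k\<close> times \<open>b\<close> is factored in two ways,
      through \<open>g x\<close> and \<open>a\<close> on one side and through \<open>a'\<close> on
      the other. Applied to \<open>x0\<close>, the two factorisations give the coincidence forbidden
      by \<open>sep\<close>.\<close>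
    have e1: "u \<otimes>\<^bsub>G\<^esub> (g x \<otimes>\<^bsub>G\<^esub> (v \<otimes>\<^bsub>G\<^esub> a)) = k \<otimes>\<^bsub>G\<^esub> b"
    proof -
      have "v \<otimes>\<^bsub>G\<^esub> a = b" using cs by (simp add: v_def m_assoc)
      moreover have "u \<otimes>\<^bsub>G\<^esub> g x = k" using cs gx by (simp add: u_def m_assoc)
      ultimately show ?thesis using m_assoc[OF uvc(1) gx cs(2)] by simp
    qed
    have e2: "v' \<otimes>\<^bsub>G\<^esub> a' = k \<otimes>\<^bsub>G\<^esub> b" using cs by (simp add: v'_def m_assoc)
    have "\<phi> u (\<phi> (g x) (\<phi> v (\<phi> a x0))) = \<phi> (k \<otimes>\<^bsub>G\<^esub> b) x0"
      unfolding e1[symmetric] using cs gx uvc by (simp add: comp[OF x0] m_closed)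
    also have "\<dots> = \<phi> v' (\<phi> a' x0)" unfolding e2[symmetric] by (rule comp[OF x0 uvc(3) cs(4)])
    finally show False using gVW(2)[OF xX] V Wy unfolding sep_def by blast
  qed
qed

lemma eventually_net_filter:
  assumes "directed_index I preceq"
  shows "eventually P (net_filter I preceq) \<longleftrightarrow> (\<exists>i\<in>I. \<forall>j\<in>I. preceq i j \<longrightarrow> P j)"
proof -
  have tr: "preceq i k" if "i \<in> I" "j \<in> I" "k \<in> I" "preceq i j" "preceq j k" for i j k
    using assms that unfolding directed_index_def transp_on_def by blast
  have "eventually P (net_filter I preceq) \<longleftrightarrow> (\<exists>i\<in>I. eventually P (principal {j \<in> I. preceq i j}))"
    unfolding net_filter_def
  proof (rule eventually_INF_base)
    show "I \<noteq> {}" using assms by (simp add: directed_index_def)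
    fix i j assume ij: "i \<in> I" "j \<in> I"
    then obtain k where k: "k \<in> I" "preceq i k" "preceq j k" using assms unfolding directed_index_def by blast
    have "{l \<in> I. preceq k l} \<subseteq> {l \<in> I. preceq i l} \<inter> {l \<in> I. preceq j l}" using tr ij k by blast
    then show "\<exists>k\<in>I. principal {l \<in> I. preceq k l} \<le> inf (principal {l \<in> I. preceq i l}) (principal {l \<in> I. preceq j l})"
      using k(1) by (intro bexI[of _ k]) simp_all
  qed
  then show ?thesis by (auto simp: eventually_principal)
qed

lemma sets_borel_of_finite:
  assumes "Hausdorff_space T" "finite K" "K \<subseteq> topspace T"
  shows "sets (borel_of (subtopology T K)) = Pow K"
proof -
  have top: "topspace (subtopology T K) = K" using assms(3) by auto
  have "t1_space (subtopology T K)" using assms(1) by (intro Hausdorff_imp_t1_space Hausdorff_space_subtopology)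
  then have eq: "subtopology T K = discrete_topology K" using finite_t1_space_imp_discrete_topology[OF top assms(2)] by simp
  have "Pow K \<subseteq> sets (borel_of (discrete_topology K))" using openin_borel_of[of "discrete_topology K"] by auto
  moreover have "sets (borel_of (discrete_topology K)) \<subseteq> Pow K"
    using sets.space_closed[of "borel_of (discrete_topology K)"] by (simp add: space_borel_of)
  ultimately show ?thesis unfolding eq by blast
qed

text \<open>At the index \<open>(C, n)\<close> stands a finite subgroup witnessing concentration for
  \<open>C\<close>, the \<open>n\<close>-th basic neighbourhood and \<open>1 / (n + 1)\<close>. Its
  Haar measure is normalized counting measure, because a finite Hausdorff space is discrete. The net
  is fixed before any right-invariant metric is considered.\<close>

lemma levy_groupI:
  fixes G :: "('g, 'm) monoid_scheme"
  assumes tg: "topological_group G T" and metr: "metrizable_space T" and conc: "finite_concentration G T"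
  shows "levy_group G T"
proof -
  interpret group G using tg by (simp add: topological_group_def)
  have top: "topspace T = carrier G" using tg by (simp add: topological_group_def)
  have haus: "Hausdorff_space T" using metr by (rule metrizable_imp_Hausdorff_space)
  obtain D0 where D0: "Metric_space (carrier G) D0" "Metric_space.mtopology (carrier G) D0 = T"
  proof -
    obtain X d where Xd: "Metric_space X d" "T = Metric_space.mtopology X d" using metr by (auto simp: metrizable_space_def)
    then have "X = carrier G" using Metric_space.topspace_mtopology[OF Xd(1)] top by simp
    then show ?thesis using that Xd by blast
  qed
  interpret D: Metric_space "carrier G" D0 by (rule D0)
  \<comment> \<open>A decreasing countable base at the identity, taken from an arbitrary compatible
    metric.\<close>
  define V where "V n = D.mball \<one>\<^bsub>G\<^esub> (1 / real (Suc n))" for n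
  have V: "openin T (V n)" "\<one>\<^bsub>G\<^esub> \<in> V n" for n unfolding V_def using D0(2) by auto
  have V_mono: "V n \<subseteq> V m" if "m \<le> n" for m n
    unfolding V_def using that by (intro D.mball_subset_concentric) (simp add: frac_le)
  have V_base: "\<exists>n. V n \<subseteq> U" if U: "openin T U" "\<one>\<^bsub>G\<^esub> \<in> U" for U
  proof -
    obtain r where r: "0 < r" "D.mball \<one>\<^bsub>G\<^esub> r \<subseteq> U"
      using U unfolding D0(2)[symmetric] D.openin_mtopology by blast
    obtain n where "inverse (real (Suc n)) < r" using reals_Archimedean[OF r(1)] by blast
    then have "V n \<subseteq> D.mball \<one>\<^bsub>G\<^esub> r" unfolding V_def by (intro D.mball_subset_concentric) (simp add: inverse_eq_divide)
    then show ?thesis using r(2) by blast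
  qed
  define I :: "('g set \<times> nat) set" where "I = {(C, n). finite C \<and> C \<subseteq> carrier G}"
  define preceq :: "'g set \<times> nat \<Rightarrow> 'g set \<times> nat \<Rightarrow> bool" where "preceq = (\<lambda>\<alpha> \<beta>. fst \<alpha> \<subseteq> fst \<beta> \<and> snd \<alpha> \<le> snd \<beta>)"
  have dir: "directed_index I preceq"
    unfolding directed_index_def
  proof (intro conjI ballI)
    show "I \<noteq> {}" by (auto simp: I_def)
    show "reflp_on I preceq" by (auto simp: reflp_on_def preceq_def)
    show "transp_on I preceq" by (auto simp: transp_on_def preceq_def)
    fix \<alpha> \<beta> assume "\<alpha> \<in> I" "\<beta> \<in> I"
    then show "\<exists>\<gamma>\<in>I. preceq \<alpha> \<gamma> \<and> preceq \<beta> \<gamma>"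
      by (intro bexI[of _ "(fst \<alpha> \<union> fst \<beta>, max (snd \<alpha>) (snd \<beta>))"]) (auto simp: I_def preceq_def)
  qed
  define good where "good \<alpha> K \<longleftrightarrow> subgroup K G \<and> finite K \<and> (\<forall>g\<in>fst \<alpha>. \<exists>k\<in>K. k \<otimes>\<^bsub>G\<^esub> inv\<^bsub>G\<^esub> g \<in> V (snd \<alpha>)) \<and>
        (\<forall>A\<subseteq>K. (1 / real (Suc (snd \<alpha>))) * real (card K) \<le> real (card A) \<longrightarrow>
           (1 - 1 / real (Suc (snd \<alpha>))) * real (card K) \<le> real (card {k\<in>K. \<exists>a\<in>A. k \<otimes>\<^bsub>G\<^esub> inv\<^bsub>G\<^esub> a \<in> V (snd \<alpha>)}))"
    for \<alpha> :: "'g set \<times> nat" and K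
  have "\<forall>\<alpha>\<in>I. \<exists>K. good \<alpha> K"
  proof
    fix \<alpha> :: "'g set \<times> nat" assume "\<alpha> \<in> I"
    then have "finite (fst \<alpha>)" "fst \<alpha> \<subseteq> carrier G" by (auto simp: I_def)
    then show "\<exists>K. good \<alpha> K"
      using conc[unfolded finite_concentration_def, rule_format, of "fst \<alpha>" "V (snd \<alpha>)" "1 / real (Suc (snd \<alpha>))"] V
      unfolding good_def by simp
  qed
  from bchoice[OF this] obtain K where K': "\<forall>\<alpha>\<in>I. good \<alpha> (K \<alpha>)" ..
  have K: "subgroup (K \<alpha>) G" "finite (K \<alpha>)" "\<forall>g\<in>fst \<alpha>. \<exists>k\<in>K \<alpha>. k \<otimes>\<^bsub>G\<^esub> inv\<^bsub>G\<^esub> g \<in> V (snd \<alpha>)"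
    "\<forall>A\<subseteq>K \<alpha>. (1 / real (Suc (snd \<alpha>))) * real (card (K \<alpha>)) \<le> real (card A) \<longrightarrow>
           (1 - 1 / real (Suc (snd \<alpha>))) * real (card (K \<alpha>)) \<le> real (card {k\<in>K \<alpha>. \<exists>a\<in>A. k \<otimes>\<^bsub>G\<^esub> inv\<^bsub>G\<^esub> a \<in> V (snd \<alpha>)})"
    if "\<alpha> \<in> I" for \<alpha> using K' that unfolding good_def by blast+
  have KG: "K \<alpha> \<subseteq> carrier G" if "\<alpha> \<in> I" for \<alpha> using subgroup.subset[OF K(1)[OF that]] .
  have Kne: "K \<alpha> \<noteq> {}" if "\<alpha> \<in> I" for \<alpha> using subgroup.one_closed[OF K(1)[OF that]] by blast
  have cpos: "0 < real (card (K \<alpha>))" if "\<alpha> \<in> I" for \<alpha> using Kne[OF that] K(2)[OF that] by (simp add: card_gt_0_iff)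
  define \<mu> where "\<mu> \<alpha> = uniform_count_measure (K \<alpha>)" for \<alpha>
  have \<mu>_prob: "prob_space (\<mu> \<alpha>)" if "\<alpha> \<in> I" for \<alpha>
    unfolding \<mu>_def using K(2) Kne that by (intro prob_space_uniform_count_measure)
  have \<mu>_sets: "sets (\<mu> \<alpha>) = Pow (K \<alpha>)" for \<alpha> by (simp add: \<mu>_def sets_uniform_count_measure)
  have haar: "normalized_haar (G\<lparr>carrier := K \<alpha>\<rparr>) (subtopology T (K \<alpha>)) (\<mu> \<alpha>)" if \<alpha>: "\<alpha> \<in> I" for \<alpha>
    unfolding normalized_haar_def
  proof (intro conjI ballI)
    show "prob_space (\<mu> \<alpha>)" by (rule \<mu>_prob[OF \<alpha>])
    show "sets (\<mu> \<alpha>) = sets (borel_of (subtopology T (K \<alpha>)))"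
      unfolding \<mu>_sets using sets_borel_of_finite[OF haus K(2)[OF \<alpha>]] KG[OF \<alpha>] top by simp
    fix h A assume h: "h \<in> carrier (G\<lparr>carrier := K \<alpha>\<rparr>)" and A: "A \<in> sets (\<mu> \<alpha>)"
    have hK: "h \<in> K \<alpha>" and AK: "A \<subseteq> K \<alpha>" using h A by (auto simp: \<mu>_sets)
    have eq: "h <#\<^bsub>G\<lparr>carrier := K \<alpha>\<rparr>\<^esub> A = (\<lambda>a. h \<otimes>\<^bsub>G\<^esub> a) ` A" by (auto simp: l_coset_def)
    have "inj_on (\<lambda>a. h \<otimes>\<^bsub>G\<^esub> a) A" using hK AK KG[OF \<alpha>] by (intro inj_onI) (simp add: subset_eq)
    then have "card ((\<lambda>a. h \<otimes>\<^bsub>G\<^esub> a) ` A) = card A" by (rule card_image)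
    moreover have "(\<lambda>a. h \<otimes>\<^bsub>G\<^esub> a) ` A \<subseteq> K \<alpha>" using AK subgroup.m_closed[OF K(1)[OF \<alpha>] hK] by blast
    ultimately show "emeasure (\<mu> \<alpha>) (h <#\<^bsub>G\<lparr>carrier := K \<alpha>\<rparr>\<^esub> A) = emeasure (\<mu> \<alpha>) A"
      unfolding eq \<mu>_def using AK K(2)[OF \<alpha>] by (simp add: emeasure_uniform_count_measure)
  qed
  define \<nu> where "\<nu> \<alpha> = distr (\<mu> \<alpha>) (borel_of T) (\<lambda>x. x)" for \<alpha>
  have id_meas: "(\<lambda>x. x) \<in> measurable (\<mu> \<alpha>) (borel_of T)" if \<alpha>: "\<alpha> \<in> I" for \<alpha>
    using KG[OF \<alpha>] top by (intro measurableI) (auto simp: \<mu>_def space_uniform_count_measure sets_uniform_count_measure space_borel_of)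
  have \<nu>_prob: "prob_space (\<nu> \<alpha>)" if "\<alpha> \<in> I" for \<alpha>
    unfolding \<nu>_def by (rule prob_space.prob_space_distr[OF \<mu>_prob id_meas]) (rule that)+
  have \<nu>_meas: "measure (\<nu> \<alpha>) A = real (card (A \<inter> K \<alpha>)) / real (card (K \<alpha>))" if \<alpha>: "\<alpha> \<in> I" and A: "A \<in> sets (borel_of T)" for \<alpha> A
    unfolding \<nu>_def using measure_distr[OF id_meas[OF \<alpha>] A] K(2)[OF \<alpha>]
    by (simp add: \<mu>_def space_uniform_count_measure measure_uniform_count_measure)
  have main: "levy_family I preceq (\<lambda>_. carrier G) (\<lambda>_. d) \<nu> \<and>
           (\<forall>C \<epsilon>. finite C \<and> C \<subseteq> carrier G \<and> \<epsilon> > 0 \<longrightarrow>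
              (\<exists>\<alpha>\<in>I. \<forall>\<beta>\<in>I. preceq \<alpha> \<beta> \<longrightarrow> (\<forall>g\<in>C. (INF h\<in>K \<beta>. d g h) < \<epsilon>)))"
    if d: "compatible_right_invariant_metric G T d" for d
  proof -
    interpret E: Metric_space "carrier G" d using d by (simp add: compatible_right_invariant_metric_def)
    have Etop: "E.mtopology = T" and rinv: "\<And>x y z. x \<in> carrier G \<Longrightarrow> y \<in> carrier G \<Longrightarrow> z \<in> carrier G \<Longrightarrow> d (x \<otimes>\<^bsub>G\<^esub> z) (y \<otimes>\<^bsub>G\<^esub> z) = d x y"
      using d by (auto simp: compatible_right_invariant_metric_def)
    \<comment> \<open>Right-invariance moves every distance to the identity, where compatibility
      compares \<open>d\<close> with the neighbourhoods \<open>V n\<close>.\<close>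
    have d1: "d a k = d \<one>\<^bsub>G\<^esub> (k \<otimes>\<^bsub>G\<^esub> inv\<^bsub>G\<^esub> a)" if "a \<in> carrier G" "k \<in> carrier G" for a k
      using rinv[of a k "inv\<^bsub>G\<^esub> a"] that by simp
    have ex_n: "\<exists>n. \<forall>m\<ge>n. V m \<subseteq> E.mball \<one>\<^bsub>G\<^esub> \<epsilon>" if "0 < \<epsilon>" for \<epsilon>
    proof -
      have "openin T (E.mball \<one>\<^bsub>G\<^esub> \<epsilon>)" unfolding Etop[symmetric] by (rule E.openin_mball)
      moreover have "\<one>\<^bsub>G\<^esub> \<in> E.mball \<one>\<^bsub>G\<^esub> \<epsilon>" using that by simp
      ultimately obtain n where n: "V n \<subseteq> E.mball \<one>\<^bsub>G\<^esub> \<epsilon>" using V_base by blast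
      show ?thesis by (intro exI[of _ n] allI impI subset_trans[OF V_mono n])
    qed
    have near: "d a k < \<epsilon>" if "k \<otimes>\<^bsub>G\<^esub> inv\<^bsub>G\<^esub> a \<in> V m" "V m \<subseteq> E.mball \<one>\<^bsub>G\<^esub> \<epsilon>" "a \<in> carrier G" "k \<in> carrier G" for a k m \<epsilon>
    proof -
      have "k \<otimes>\<^bsub>G\<^esub> inv\<^bsub>G\<^esub> a \<in> E.mball \<one>\<^bsub>G\<^esub> \<epsilon>" using that by blast
      then show ?thesis using d1[OF that(3,4)] by simp
    qed
    show ?thesis
    proof (intro conjI allI impI)
      fix C :: "'g set" and \<epsilon> :: real assume C: "finite C \<and> C \<subseteq> carrier G \<and> \<epsilon> > 0"
      then obtain n where n: "\<forall>m\<ge>n. V m \<subseteq> E.mball \<one>\<^bsub>G\<^esub> \<epsilon>" using ex_n by blast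
      show "\<exists>\<alpha>\<in>I. \<forall>\<beta>\<in>I. preceq \<alpha> \<beta> \<longrightarrow> (\<forall>g\<in>C. (INF h\<in>K \<beta>. d g h) < \<epsilon>)"
      proof (intro bexI[of _ "(C, n)"] ballI impI)
        fix \<beta> g assume \<beta>: "\<beta> \<in> I" "preceq (C, n) \<beta>" and g: "g \<in> C"
        then obtain k where k: "k \<in> K \<beta>" "k \<otimes>\<^bsub>G\<^esub> inv\<^bsub>G\<^esub> g \<in> V (snd \<beta>)"
          using K(3)[OF \<beta>(1)] by (auto simp: preceq_def)
        have "(INF h\<in>K \<beta>. d g h) \<le> d g k"
          by (rule cINF_lower[OF _ k(1)]) (auto intro!: bdd_belowI[of _ 0])
        also have "\<dots> < \<epsilon>"
          using n \<beta>(2) C g k(1) KG[OF \<beta>(1)] by (intro near[OF k(2)]) (auto simp: preceq_def)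
        finally show "(INF h\<in>K \<beta>. d g h) < \<epsilon>" .
      qed (use C in \<open>auto simp: I_def\<close>)
    next
      show "levy_family I preceq (\<lambda>_. carrier G) (\<lambda>_. d) \<nu>"
        unfolding levy_family_def
      proof (intro conjI allI impI ballI dir)
        fix \<alpha> assume \<alpha>: "\<alpha> \<in> I"
        show "mm_space (carrier G) d (\<nu> \<alpha>)"
          unfolding mm_space_def using \<nu>_prob[OF \<alpha>] E.Metric_space_axioms by (simp add: \<nu>_def Etop)
      next
        fix A and \<epsilon> :: real
        assume A: "(\<forall>\<alpha>\<in>I. A \<alpha> \<in> sets (\<nu> \<alpha>)) \<and> 0 < Liminf (net_filter I preceq) (\<lambda>\<alpha>. ereal (measure (\<nu> \<alpha>) (A \<alpha>)))" and \<epsilon>: "0 < \<epsilon>"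
        have As: "A \<alpha> \<in> sets (borel_of T)" if "\<alpha> \<in> I" for \<alpha> using A that by (simp add: \<nu>_def)
        have AG: "A \<alpha> \<subseteq> carrier G" if "\<alpha> \<in> I" for \<alpha> using sets.sets_into_space[OF As[OF that]] by (simp add: space_borel_of top)
        obtain c where c: "0 < ereal c" "ereal c < Liminf (net_filter I preceq) (\<lambda>\<alpha>. ereal (measure (\<nu> \<alpha>) (A \<alpha>)))"
          using ereal_dense2 A by blast
        have "\<forall>\<^sub>F \<alpha> in net_filter I preceq. ereal c < ereal (measure (\<nu> \<alpha>) (A \<alpha>))" using c(2) by (rule less_LiminfD)
        then obtain \<alpha>0 where \<alpha>0: "\<alpha>0 \<in> I" "\<forall>\<beta>\<in>I. preceq \<alpha>0 \<beta> \<longrightarrow> c < measure (\<nu> \<beta>) (A \<beta>)"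
          unfolding eventually_net_filter[OF dir] by auto
        obtain n where n: "\<forall>m\<ge>n. V m \<subseteq> E.mball \<one>\<^bsub>G\<^esub> \<epsilon>" using ex_n[OF \<epsilon>] by blast
        let ?N = "\<lambda>\<alpha>. metric_nbhd (carrier G) d (A \<alpha>) \<epsilon>"
        have N_sets: "?N \<alpha> \<in> sets (borel_of T)" if \<alpha>: "\<alpha> \<in> I" for \<alpha>
        proof -
          have "?N \<alpha> = (\<Union>a\<in>A \<alpha>. E.mball a \<epsilon>)" using AG[OF \<alpha>] unfolding metric_nbhd_def E.mball_def by blast
          also have "openin E.mtopology (\<Union>a\<in>A \<alpha>. E.mball a \<epsilon>)" by (rule openin_Union) auto
          finally show ?thesis unfolding Etop by (rule openin_borel_of)
        qed
        show "((\<lambda>\<alpha>. measure (\<nu> \<alpha>) (?N \<alpha>)) \<longlongrightarrow> 1) (net_filter I preceq)"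
        proof (rule tendstoI)
          fix e :: real assume e: "0 < e"
          \<comment> \<open>Beyond this level the tolerance \<open>\<delta>\<close> lies below the
            eventual lower bound \<open>c\<close>, so the sets are large enough to concentrate, and
            below the required accuracy \<open>e\<close>.\<close>
          have "0 < min c e" using c(1) e by simp
          from reals_Archimedean[OF this] obtain n' where n': "inverse (real (Suc n')) < min c e" by blast
          show "\<forall>\<^sub>F \<alpha> in net_filter I preceq. dist (measure (\<nu> \<alpha>) (?N \<alpha>)) 1 < e"
            unfolding eventually_net_filter[OF dir]
          proof (intro bexI[of _ "(fst \<alpha>0, max (snd \<alpha>0) (max n n'))"] ballI impI)
            show "(fst \<alpha>0, max (snd \<alpha>0) (max n n')) \<in> I" using \<alpha>0(1) by (auto simp: I_def)
            fix \<beta> assume \<beta>: "\<beta> \<in> I" "preceq (fst \<alpha>0, max (snd \<alpha>0) (max n n')) \<beta>"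
            then have l0: "preceq \<alpha>0 \<beta>" and ln: "n \<le> snd \<beta>" "n' \<le> snd \<beta>" by (auto simp: preceq_def)
            define \<delta> where "\<delta> = 1 / real (Suc (snd \<beta>))"
            have "\<delta> \<le> inverse (real (Suc n'))" unfolding \<delta>_def using ln(2) by (simp add: inverse_eq_divide frac_le)
            then have \<delta>: "\<delta> < c" "\<delta> < e" using n' by auto
            let ?A = "A \<beta> \<inter> K \<beta>"
            have large: "\<delta> * real (card (K \<beta>)) \<le> real (card ?A)"
            proof -
              have "c < real (card ?A) / real (card (K \<beta>))" using \<alpha>0(2)[rule_format, OF \<beta>(1) l0] unfolding \<nu>_meas[OF \<beta>(1) As[OF \<beta>(1)]] .
              then have "c * real (card (K \<beta>)) < real (card ?A)" using cpos[OF \<beta>(1)] by (simp add: field_simps)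
              moreover have "\<delta> * real (card (K \<beta>)) \<le> c * real (card (K \<beta>))" using \<delta>(1) by (intro mult_right_mono) auto
              ultimately show ?thesis by linarith
            qed
            have big: "(1 - \<delta>) * real (card (K \<beta>)) \<le> real (card {k\<in>K \<beta>. \<exists>a\<in>?A. k \<otimes>\<^bsub>G\<^esub> inv\<^bsub>G\<^esub> a \<in> V (snd \<beta>)})"
              by (rule K(4)[OF \<beta>(1), rule_format, of ?A, folded \<delta>_def, OF _ large]) simp
            have "{k\<in>K \<beta>. \<exists>a\<in>?A. k \<otimes>\<^bsub>G\<^esub> inv\<^bsub>G\<^esub> a \<in> V (snd \<beta>)} \<subseteq> ?N \<beta> \<inter> K \<beta>"
            proof
              fix k assume "k \<in> {k\<in>K \<beta>. \<exists>a\<in>?A. k \<otimes>\<^bsub>G\<^esub> inv\<^bsub>G\<^esub> a \<in> V (snd \<beta>)}"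
              then obtain a where k: "k \<in> K \<beta>" "a \<in> A \<beta>" "k \<otimes>\<^bsub>G\<^esub> inv\<^bsub>G\<^esub> a \<in> V (snd \<beta>)" by blast
              have "d a k < \<epsilon>" using near[OF k(3)] n ln(1) AG[OF \<beta>(1)] KG[OF \<beta>(1)] k by blast
              then show "k \<in> ?N \<beta> \<inter> K \<beta>" using k KG[OF \<beta>(1)] by (auto simp: metric_nbhd_def)
            qed
            then have "card {k\<in>K \<beta>. \<exists>a\<in>?A. k \<otimes>\<^bsub>G\<^esub> inv\<^bsub>G\<^esub> a \<in> V (snd \<beta>)} \<le> card (?N \<beta> \<inter> K \<beta>)"
              using K(2)[OF \<beta>(1)] by (intro card_mono) auto
            then have "(1 - \<delta>) * real (card (K \<beta>)) \<le> real (card (?N \<beta> \<inter> K \<beta>))" using big by linarith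
            then have "1 - \<delta> \<le> measure (\<nu> \<beta>) (?N \<beta>)"
              using \<nu>_meas[OF \<beta>(1) N_sets[OF \<beta>(1)]] cpos[OF \<beta>(1)] by (simp add: pos_le_divide_eq)
            moreover have "measure (\<nu> \<beta>) (?N \<beta>) \<le> 1" by (rule prob_space.prob_le_1[OF \<nu>_prob[OF \<beta>(1)]])
            ultimately show "dist (measure (\<nu> \<beta>) (?N \<beta>)) 1 < e" using \<delta>(2) by (simp add: dist_real_def)
          qed
        qed
      qed
    qed
  qed
  show ?thesis
    unfolding levy_group_def
  proof (intro conjI tg metr exI[of _ I] exI[of _ preceq] exI[of _ K] exI[of _ \<mu>] dir ballI allI impI)
    fix \<alpha> assume \<alpha>: "\<alpha> \<in> I"
    show "subgroup (K \<alpha>) G" by (rule K(1)[OF \<alpha>])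
    show "compactin T (K \<alpha>)" using K(2)[OF \<alpha>] KG[OF \<alpha>] top by (intro finite_imp_compactin) auto
    show "normalized_haar (G\<lparr>carrier := K \<alpha>\<rparr>) (subtopology T (K \<alpha>)) (\<mu> \<alpha>)" by (rule haar[OF \<alpha>])
  next
    fix d assume d: "compatible_right_invariant_metric G T d"
    show "levy_family I preceq (\<lambda>_. carrier G) (\<lambda>_. d) (\<lambda>\<alpha>. distr (\<mu> \<alpha>) (borel_of T) (\<lambda>x. x))"
      using main[OF d] unfolding \<nu>_def by blast
    fix C and \<epsilon> :: real assume "finite C \<and> C \<subseteq> carrier G \<and> 0 < \<epsilon>"
    then show "\<exists>\<alpha>\<in>I. \<forall>\<beta>\<in>I. preceq \<alpha> \<beta> \<longrightarrow> (\<forall>g\<in>C. (INF h\<in>K \<beta>. d g h) < \<epsilon>)"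
      using main[OF d] by blast
  qed
qed

section \<open>Finite concentration for the automorphism group\<close>

context prob_space
begin

text \<open>Outside \<open>E\<close> the Jacobian is 1 and the inverse fixes every point, so the
  overlap is at least the mass of \<open>A - E\<close>. Moving little mass therefore means being
  close to the identity, whatever the Jacobians inside \<open>E\<close> are.\<close>

lemma l2dist_fixing:
  assumes T: "T \<in> nonsingular_automorphisms M" and E: "E \<in> sets M" and A: "A \<in> sets M"
    and fix_out: "\<And>x. x \<in> space M \<Longrightarrow> x \<notin> E \<Longrightarrow> T x = x"
  shows "(l2dist (koopman_fun T (indicator A)) (indicator A))\<^sup>2 \<le> 2 * measure M E"
proof -
  define ov where "ov x = sqrt (koopman_density T x * koopman_density id x) *
        (indicator A (the_inv_into (space M) T x) * indicator A (the_inv_into (space M) id x))" for x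
  have ov: "integrable M ov"
    "(l2dist (koopman_fun T (indicator A)) (koopman_fun id (indicator A)))\<^sup>2 = 2 * (measure M A - (LINT x|M. ov x))"
    using l2dist_indicators[OF T nsa_id A] unfolding ov_def by auto
  have "l2dist (koopman_fun T (indicator A)) (indicator A) = l2dist (koopman_fun T (indicator A)) (koopman_fun id (indicator A))"
    using koopman_fun_id[of "indicator A"] T A
    by (intro l2dist_cong koopman_fun_sq nsa_id sq_indicator) auto
  then have eq: "(l2dist (koopman_fun T (indicator A)) (indicator A))\<^sup>2 = 2 * (measure M A - (LINT x|M. ov x))"
    using ov(2) by simp
  have "AE x in M. x \<in> space M - E \<longrightarrow> koopman_density T x = 1"
  proof (rule koopman_density_const[OF T])
    show "space M - E \<in> sets M" using E by auto
    fix B assume B: "B \<in> sets M" "B \<subseteq> space M - E"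
    \<comment> \<open>Injectivity keeps points of \<open>E\<close> from entering the complement of
      \<open>E\<close>: a point whose image is fixed is itself equal to that image.\<close>
    have "T -` B \<inter> space M = B"
    proof (intro equalityI subsetI)
      fix x assume x: "x \<in> T -` B \<inter> space M"
      then have "T x \<in> space M" "T x \<notin> E" using B(2) by auto
      then have "T (T x) = T x" by (rule fix_out)
      then have "the_inv_into (space M) T (T (T x)) = the_inv_into (space M) T (T x)" by simp
      then have "T x = x" using nsaD(7)[OF T \<open>T x \<in> space M\<close>] nsaD(7)[OF T, of x] x by simp
      then show "x \<in> B" using x by simp
    next
      fix x assume x: "x \<in> B"
      then have "x \<in> space M" "x \<notin> E" using B(2) by auto
      then show "x \<in> T -` B \<inter> space M" using fix_out[of x] x by simp
    qed
    then show "emeasure M (T -` B \<inter> space M) = ennreal 1 * emeasure M B" by simp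
  qed simp
  then have "AE x in M. indicator (A - E) x \<le> ov x"
    using koopman_density_id AE_space
  proof eventually_elim
    case (elim x)
    show ?case
    proof (cases "x \<in> A - E")
      case True
      have "T x = x" using True fix_out[OF elim(3)] by simp
      then have "the_inv_into (space M) T x = x" using nsaD(7)[OF T elim(3)] by simp
      moreover have "the_inv_into (space M) id x = x" using nsaD(7)[OF nsa_id elim(3)] by simp
      ultimately show ?thesis using True elim by (simp add: ov_def)
    qed (simp add: ov_def koopman_density_nonneg)
  qed
  moreover have "integrable M (indicator (A - E) :: 'a \<Rightarrow> real)"
    using A E by (intro integrable_real_indicator) (auto simp: less_top[symmetric])
  ultimately have "(LINT x|M. indicator (A - E) x) \<le> (LINT x|M. ov x)" using ov(1) by (intro integral_mono_AE)
  then have "measure M (A - E) \<le> (LINT x|M. ov x)" using A E by simp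
  moreover have "measure M A \<le> measure M ((A - E) \<union> E)" using A E by (intro finite_measure_mono) auto
  moreover have "measure M ((A - E) \<union> E) \<le> measure M (A - E) + measure M E"
    using A E by (intro measure_subadditive) auto
  ultimately have "measure M A - (LINT x|M. ov x) \<le> measure M E" by linarith
  then show ?thesis unfolding eq by simp
qed

lemma finite_concentration_Aut_star:
  assumes M: "standard_borel M" "nonatomic M"
  shows "finite_concentration (Aut_star M) (strong_topology M)"
  unfolding finite_concentration_def
proof (intro allI impI)
  let ?G = "Aut_star M" and ?T = "strong_topology M"
  interpret G: group ?G by (rule group_Aut_star)
  fix C V and \<epsilon> :: real
  assume *: "finite C \<and> C \<subseteq> carrier ?G \<and> openin ?T V \<and> \<one>\<^bsub>?G\<^esub> \<in> V \<and> 0 < \<epsilon>"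
  then have C: "finite C" "C \<subseteq> carrier ?G" and V: "openin ?T V" "\<one>\<^bsub>?G\<^esub> \<in> V" and \<epsilon>: "0 < \<epsilon>" by auto
  obtain F1 \<epsilon>1 where F1: "finite F1" "F1 \<subseteq> sets M" "0 < \<epsilon>1" "strong_nbhd \<one>\<^bsub>?G\<^esub> (indicator ` F1) \<epsilon>1 \<subseteq> V"
    by (rule strong_nbhd_base_sets[OF V]) (rule that)
  let ?W = "\<lambda>g. {k \<in> carrier ?G. k \<otimes>\<^bsub>?G\<^esub> inv\<^bsub>?G\<^esub> g \<in> V}"
  have "\<forall>g\<in>C. \<exists>z. finite (fst z) \<and> fst z \<subseteq> sets M \<and> 0 < snd z \<and> strong_nbhd g (indicator ` fst z) (snd z) \<subseteq> ?W g"
  proof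
    fix g assume "g \<in> C"
    then have g: "g \<in> carrier ?G" using C(2) by blast
    have o: "openin ?T (?W g)"
      by (rule topological_group_right_translation[OF topological_group_strong_topology V(1)]) (use g in simp)
    have gW: "g \<in> ?W g" using g V(2) by simp
    obtain F e where "finite F" "F \<subseteq> sets M" "0 < e" "strong_nbhd g (indicator ` F) e \<subseteq> ?W g"
      by (rule strong_nbhd_base_sets[OF o gW]) (rule that)
    then show "\<exists>z. finite (fst z) \<and> fst z \<subseteq> sets M \<and> 0 < snd z \<and> strong_nbhd g (indicator ` fst z) (snd z) \<subseteq> ?W g"
      by (intro exI[of _ "(F, e)"]) simp
  qed
  from bchoice[OF this] obtain z where z: "\<forall>g\<in>C. finite (fst (z g)) \<and> fst (z g) \<subseteq> sets M \<and> 0 < snd (z g) \<and>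
      strong_nbhd g (indicator ` fst (z g)) (snd (z g)) \<subseteq> ?W g" ..
  define \<A> where "\<A> = (\<Union>g\<in>C. fst (z g))"
  define \<eta> where "\<eta> = Min (insert 1 ((\<lambda>g. snd (z g)) ` C))"
  have \<A>: "finite \<A>" "\<A> \<subseteq> sets M" using z C(1) by (auto simp: \<A>_def)
  have \<eta>: "0 < \<eta>" "\<And>g. g \<in> C \<Longrightarrow> \<eta> \<le> snd (z g)" using z C(1) by (auto simp: \<eta>_def)
  \<comment> \<open>By \<open>l2dist_fixing\<close>, moving mass less than \<open>t\<close> changes
    an indicator by less than the root of \<open>2 * t\<close>, which is below
    \<open>\<epsilon>1\<close>.\<close>
  define t where "t = \<epsilon>1\<^sup>2 / 4"
  have t: "0 < t" "2 * t < \<epsilon>1\<^sup>2" using F1(3) by (auto simp: t_def)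
  \<comment> \<open>The squared masses of cells of mass at most \<open>\<kappa>0\<close> add up to
    at most \<open>\<kappa>0\<close>, as their total mass is at most 1; this is the smallness that
    \<open>permutations_concentration\<close> needs.\<close>
  define \<kappa>0 where "\<kappa>0 = \<epsilon> * t\<^sup>2 / 36"
  have \<kappa>0: "0 < \<kappa>0" using \<epsilon> t by (simp add: \<kappa>0_def)
  have repC: "finite (rep ` C)" "rep ` C \<subseteq> nonsingular_automorphisms M" using C rep_Aut_star(1) by auto
  obtain I :: "('a set set \<times> nat \<times> nat) set" and D where
    I: "finite I" and D: "\<And>i. i \<in> I \<Longrightarrow> D i \<in> sets M" and Dpos: "\<And>i. i \<in> I \<Longrightarrow> 0 < measure M (D i)"
    and D\<kappa>: "\<And>i. i \<in> I \<Longrightarrow> measure M (D i) \<le> \<kappa>0" and disj: "disjoint_family_on D I"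
    and approx: "\<And>g. g \<in> rep ` C \<Longrightarrow> \<exists>p. p permutes I \<and> (\<forall>T\<in>nonsingular_automorphisms M.
        (AE x in M. \<forall>i\<in>I. x \<in> D (p i) \<longrightarrow> the_inv_into (space M) T x \<in> D i) \<longrightarrow>
        (\<forall>i\<in>I. AE x in M. x \<in> D (p i) \<longrightarrow> koopman_density T x = measure M (D i) / measure M (D (p i))) \<longrightarrow>
        (\<forall>A\<in>\<A>. l2dist (koopman_fun T (indicator A)) (koopman_fun g (indicator A)) < \<eta>))"
    by (rule cell_approximation[OF M repC \<A> \<eta>(1) \<kappa>0]) (rule that)
  obtain T :: "('a set set \<times> nat \<times> nat \<Rightarrow> 'a set set \<times> nat \<times> nat) \<Rightarrow> 'a \<Rightarrow> 'a" where
    T: "\<And>p. p permutes I \<Longrightarrow> T p \<in> nonsingular_automorphisms M"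
    and T_comp: "\<And>p q x. p permutes I \<Longrightarrow> q permutes I \<Longrightarrow> x \<in> space M \<Longrightarrow> T (q \<circ> p) x = T q (T p x)"
    and T_fix: "\<And>p x. p permutes I \<Longrightarrow> x \<in> space M \<Longrightarrow> \<forall>i\<in>I. x \<in> D i \<longrightarrow> p i = i \<Longrightarrow> T p x = x"
    and T_inv: "\<And>p. p permutes I \<Longrightarrow> AE x in M. \<forall>i\<in>I. x \<in> D (p i) \<longrightarrow> the_inv_into (space M) (T p) x \<in> D i"
    and T_dens: "\<And>p i. p permutes I \<Longrightarrow> i \<in> I \<Longrightarrow>
        AE x in M. x \<in> D (p i) \<longrightarrow> koopman_density (T p) x = measure M (D i) / measure M (D (p i))"
    by (rule cell_permutations[OF M I D Dpos disj], assumption, assumption) (rule that)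
  define \<Phi> where "\<Phi> p = aut_class M (T p)" for p
  let ?P = "{p. p permutes I}"
  have \<Phi>_carrier: "\<Phi> p \<in> carrier ?G" if "p permutes I" for p unfolding \<Phi>_def by (rule aut_class_carrier[OF T[OF that]])
  have \<Phi>_comp: "\<Phi> (q \<circ> p) = \<Phi> q \<otimes>\<^bsub>?G\<^esub> \<Phi> p" if p: "p permutes I" and q: "q permutes I" for p q
  proof -
    have "\<Phi> q \<otimes>\<^bsub>?G\<^esub> \<Phi> p = aut_class M (T q \<circ> T p)" unfolding \<Phi>_def by (rule aut_class_mult[OF T[OF q] T[OF p]])
    also have "\<dots> = \<Phi> (q \<circ> p)" unfolding \<Phi>_def
      using T_comp[OF p q] by (subst aut_class_eq_iff) (auto intro!: nsa_comp T p q permutes_compose)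
    finally show ?thesis by simp
  qed
  have \<Phi>_id: "\<Phi> id = \<one>\<^bsub>?G\<^esub>"
    unfolding aut_class_one \<Phi>_def using T_fix[OF permutes_id] T[OF permutes_id] nsa_id by (subst aut_class_eq_iff) auto
  have \<Phi>_inv: "inv\<^bsub>?G\<^esub> (\<Phi> p) = \<Phi> (Hilbert_Choice.inv p)" if p: "p permutes I" for p
  proof (rule G.inv_equality)
    have "Hilbert_Choice.inv p \<circ> p = id" by (rule permutes_inv_o(2)[OF p])
    then show "\<Phi> (Hilbert_Choice.inv p) \<otimes>\<^bsub>?G\<^esub> \<Phi> p = \<one>\<^bsub>?G\<^esub>"
      using \<Phi>_comp[OF p permutes_inv[OF p]] \<Phi>_id by simp
  qed (use p permutes_inv[OF p] \<Phi>_carrier in auto)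
  \<comment> \<open>If two permutations had the same class, some cell would be pulled back almost
    everywhere into two disjoint cells and would be null. Injectivity turns proportions in
    \<open>K\<close> into proportions of permutations.\<close>
  have \<Phi>_inj: "inj_on \<Phi> ?P"
  proof (rule inj_onI)
    fix p q assume "p \<in> ?P" "q \<in> ?P" and eq: "\<Phi> p = \<Phi> q"
    then have p: "p permutes I" and q: "q permutes I" by auto
    have ae: "AE x in M. the_inv_into (space M) (T p) x = the_inv_into (space M) (T q) x"
      using eq unfolding \<Phi>_def aut_class_eq_iff[OF T[OF p] T[OF q]] by (rule koopman_density_cong(2)[OF T[OF p] T[OF q]])
    show "p = q"
    proof (rule ccontr)
      assume "p \<noteq> q"
      then obtain i where i: "p i \<noteq> q i" unfolding fun_eq_iff by blast
      have iI: "i \<in> I"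
      proof (rule ccontr)
        assume "i \<notin> I"
        then have "p i = i" "q i = i" using permutes_not_in[OF p] permutes_not_in[OF q] by blast+
        then show False using i by simp
      qed
      have pi: "p i \<in> I" using permutes_in_image[OF p] iI by simp
      define j where "j = Hilbert_Choice.inv q (p i)"
      have qj: "q j = p i" unfolding j_def by (rule permutes_inverses(1)[OF q])
      have jI: "j \<in> I" unfolding j_def using permutes_in_image[OF permutes_inv[OF q]] pi by simp
      have "j \<noteq> i"
      proof
        assume "j = i"
        then show False using i qj by simp
      qed
      then have dj: "D i \<inter> D j = {}" using disj iI jI unfolding disjoint_family_on_def by simp
      have "AE x in M. x \<notin> D (p i)"
        using ae T_inv[OF p] T_inv[OF q]
      proof eventually_elim
        case (elim x)
        show ?case
        proof
          assume x: "x \<in> D (p i)"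
          have "the_inv_into (space M) (T p) x \<in> D i" using elim(2) iI x by blast
          moreover have "the_inv_into (space M) (T q) x \<in> D j" using elim(3) jI x qj by simp
          ultimately show False using elim(1) dj by auto
        qed
      qed
      then have "D (p i) \<in> null_sets M" using AE_iff_null_sets[OF D[OF pi]] by simp
      then have "measure M (D (p i)) = 0" by (rule measure_eq_0_null_sets)
      then show False using Dpos[OF pi] by simp
    qed
  qed
  define K where "K = \<Phi> ` ?P"
  have finP: "finite ?P" by (rule finite_permutations[OF I])
  have sub: "subgroup K ?G"
  proof (rule subgroup.intro)
    show "K \<subseteq> carrier ?G" using \<Phi>_carrier by (auto simp: K_def)
    show "\<one>\<^bsub>?G\<^esub> \<in> K" unfolding K_def \<Phi>_id[symmetric] by (intro imageI CollectI permutes_id)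
    show "x \<otimes>\<^bsub>?G\<^esub> y \<in> K" if xy: "x \<in> K" "y \<in> K" for x y
    proof -
      obtain p q where pq: "p permutes I" "q permutes I" "x = \<Phi> p" "y = \<Phi> q" using xy by (auto simp: K_def)
      have "x \<otimes>\<^bsub>?G\<^esub> y = \<Phi> (p \<circ> q)" unfolding pq(3,4) by (rule \<Phi>_comp[OF pq(2,1), symmetric])
      then show ?thesis unfolding K_def using permutes_compose[OF pq(2,1)] by blast
    qed
    show "inv\<^bsub>?G\<^esub> x \<in> K" if x: "x \<in> K" for x
    proof -
      obtain p where p: "p permutes I" "x = \<Phi> p" using x by (auto simp: K_def)
      then show ?thesis unfolding K_def using \<Phi>_inv[OF p(1)] permutes_inv[OF p(1)] by blast
    qed
  qed
  have cardK: "real (card K) = fact (card I)"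
    unfolding K_def card_image[OF \<Phi>_inj] using card_permutations[OF refl I] by simp
  have near: "\<exists>k\<in>K. k \<otimes>\<^bsub>?G\<^esub> inv\<^bsub>?G\<^esub> g \<in> V" if g: "g \<in> C" for g
  proof -
    have gc: "g \<in> carrier ?G" using g C(2) by blast
    obtain p where p: "p permutes I" and ap: "\<forall>T\<in>nonsingular_automorphisms M.
        (AE x in M. \<forall>i\<in>I. x \<in> D (p i) \<longrightarrow> the_inv_into (space M) T x \<in> D i) \<longrightarrow>
        (\<forall>i\<in>I. AE x in M. x \<in> D (p i) \<longrightarrow> koopman_density T x = measure M (D i) / measure M (D (p i))) \<longrightarrow>
        (\<forall>A\<in>\<A>. l2dist (koopman_fun T (indicator A)) (koopman_fun (rep g) (indicator A)) < \<eta>)"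
      using approx[OF imageI[OF g]] by (elim exE conjE)
    have le: "\<forall>A\<in>\<A>. l2dist (koopman_fun (T p) (indicator A)) (koopman_fun (rep g) (indicator A)) < \<eta>"
      using ap[rule_format, OF T[OF p] T_inv[OF p]] T_dens[OF p] by blast
    have "\<Phi> p \<in> strong_nbhd g (indicator ` fst (z g)) (snd (z g))"
      unfolding strong_nbhd_def
    proof (intro CollectI conjI \<Phi>_carrier p ballI)
      fix f :: "'a \<Rightarrow> complex" assume "f \<in> indicator ` fst (z g)"
      then obtain A where A: "A \<in> fst (z g)" "f = indicator A" by blast
      have A\<A>: "A \<in> \<A>" using A(1) g by (auto simp: \<A>_def)
      then have As: "A \<in> sets M" using \<A>(2) by blast
      have "l2dist (act (\<Phi> p) f) (act g f) = l2dist (koopman_fun (T p) f) (act g f)"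
        unfolding \<Phi>_def A(2)
        by (intro l2dist_cong act_sq aut_class_carrier T p sq_indicator As gc koopman_fun_sq act_aut_class AE_I2 refl)
      also have "\<dots> < \<eta>" unfolding act_def A(2) using le A\<A> by blast
      finally show "l2dist (act (\<Phi> p) f) (act g f) < snd (z g)" using \<eta>(2)[OF g] by simp
    qed
    then have "\<Phi> p \<in> ?W g" using z g by blast
    then show ?thesis using p unfolding K_def by blast
  qed
  have small: "\<Phi> r \<in> V" if r: "r permutes I" and s: "(\<Sum>i\<in>I. if r i \<noteq> i then measure M (D i) else 0) < t" for r
  proof -
    define E where "E = (\<Union>i\<in>{i\<in>I. r i \<noteq> i}. D i)"
    have E: "E \<in> sets M" unfolding E_def using I D by (intro sets.finite_UN) auto
    have "measure M E \<le> (\<Sum>i\<in>{i\<in>I. r i \<noteq> i}. measure M (D i))"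
      unfolding E_def using I D by (intro finite_measure_subadditive_finite) auto
    also have "\<dots> = (\<Sum>i\<in>I. if r i \<noteq> i then measure M (D i) else 0)"
      using I by (simp only: sum.inter_filter)
    finally have mE: "measure M E < t" using s by simp
    have fx: "T r x = x" if "x \<in> space M" "x \<notin> E" for x
      using that by (intro T_fix[OF r]) (auto simp: E_def)
    have "\<Phi> r \<in> strong_nbhd \<one>\<^bsub>?G\<^esub> (indicator ` F1) \<epsilon>1"
      unfolding strong_nbhd_def
    proof (intro CollectI conjI \<Phi>_carrier r ballI)
      fix f :: "'a \<Rightarrow> complex" assume "f \<in> indicator ` F1"
      then obtain A where A: "A \<in> F1" "f = indicator A" by blast
      have As: "A \<in> sets M" using A(1) F1(2) by blast
      have fs: "f \<in> square_integrable M" unfolding A(2) by (rule sq_indicator[OF As])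
      have "l2dist (act (\<Phi> r) f) (act \<one>\<^bsub>?G\<^esub> f) = l2dist (koopman_fun (T r) f) f"
        unfolding \<Phi>_def
        by (intro l2dist_cong act_sq aut_class_carrier T r fs koopman_fun_sq act_aut_class act_one G.one_closed)
      moreover have "(l2dist (koopman_fun (T r) f) f)\<^sup>2 < \<epsilon>1\<^sup>2"
        using l2dist_fixing[OF T[OF r] E As fx] mE t(2) unfolding A(2) by linarith
      ultimately show "l2dist (act (\<Phi> r) f) (act \<one>\<^bsub>?G\<^esub> f) < \<epsilon>1"
        using power2_less_imp_less[of _ \<epsilon>1] F1(3) by simp
    qed
    then show ?thesis using F1(4) by blast
  qed
  have conc: "(1 - \<epsilon>) * real (card K) \<le> real (card {k\<in>K. \<exists>a\<in>A. k \<otimes>\<^bsub>?G\<^esub> inv\<^bsub>?G\<^esub> a \<in> V})"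
    if A: "A \<subseteq> K" "\<epsilon> * real (card K) \<le> real (card A)" for A
  proof -
    \<comment> \<open>The Hamming distance of \<open>p\<close> and \<open>q\<close> is the mass of
      the cells moved by the inverse of \<open>p\<close> composed with \<open>q\<close>, whereas
      \<open>finite_concentration\<close> speaks of \<open>k\<close> times the inverse of
      \<open>a\<close>. Parametrising \<open>K\<close> by inverse permutations makes the two
      agree.\<close>
    define \<Psi> where "\<Psi> p = \<Phi> (Hilbert_Choice.inv p)" for p
    have \<Psi>_inj: "inj_on \<Psi> ?P"
    proof (rule inj_onI)
      fix p q assume pq: "p \<in> ?P" "q \<in> ?P" "\<Psi> p = \<Psi> q"
      then have "Hilbert_Choice.inv p = Hilbert_Choice.inv q"
        unfolding \<Psi>_def using permutes_inv by (intro inj_onD[OF \<Phi>_inj]) auto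
      then have "Hilbert_Choice.inv (Hilbert_Choice.inv p) = Hilbert_Choice.inv (Hilbert_Choice.inv q)" by simp
      then show "p = q" using pq by (simp add: permutes_inv_inv)
    qed
    have \<Psi>_im: "\<Psi> ` ?P = K"
    proof (intro equalityI subsetI)
      fix x assume "x \<in> K"
      then obtain p where p: "p permutes I" "x = \<Phi> p" by (auto simp: K_def)
      then have "x = \<Psi> (Hilbert_Choice.inv p)" by (simp add: \<Psi>_def permutes_inv_inv)
      then show "x \<in> \<Psi> ` ?P" using permutes_inv[OF p(1)] by blast
    qed (auto simp: \<Psi>_def K_def permutes_inv)
    define B where "B = {p\<in>?P. \<Psi> p \<in> A}"
    have imB: "\<Psi> ` B = A" using A(1) \<Psi>_im by (auto simp: B_def)
    have injB: "inj_on \<Psi> B" using \<Psi>_inj by (rule inj_on_subset) (auto simp: B_def)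
    have cB: "card B = card A" using card_image[OF injB] imB by simp
    define w where "w i = (if i \<in> I then measure M (D i) else 0)" for i
    let ?H = "{p. p permutes I \<and> (\<exists>a\<in>B. weighted_hamming w I p a < t)}"
    have "36 * (\<Sum>i\<in>I. (w i)\<^sup>2) \<le> \<epsilon> * t\<^sup>2"
    proof -
      have "(\<Sum>i\<in>I. (w i)\<^sup>2) \<le> (\<Sum>i\<in>I. \<kappa>0 * measure M (D i))"
        using D\<kappa> by (intro sum_mono) (auto simp: w_def power2_eq_square intro!: mult_right_mono)
      also have "\<dots> = \<kappa>0 * measure M (\<Union>i\<in>I. D i)"
        using I D disj by (subst finite_measure_finite_Union) (auto simp: sum_distrib_left)
      also have "\<dots> \<le> \<kappa>0 * 1" using \<kappa>0 by (intro mult_left_mono prob_le_1) auto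
      finally show ?thesis by (simp add: \<kappa>0_def)
    qed
    then have "(1 - \<epsilon>) * fact (card I) \<le> real (card ?H)"
      using A(2) cB cardK \<epsilon> t(1) by (intro permutations_concentration[OF I]) (auto simp: w_def B_def)
    also have "card ?H = card (\<Psi> ` ?H)"
      by (rule card_image[symmetric], rule inj_on_subset[OF \<Psi>_inj]) auto
    also have "\<dots> \<le> card {k\<in>K. \<exists>a\<in>A. k \<otimes>\<^bsub>?G\<^esub> inv\<^bsub>?G\<^esub> a \<in> V}"
    proof (rule card_mono)
      show "finite {k\<in>K. \<exists>a\<in>A. k \<otimes>\<^bsub>?G\<^esub> inv\<^bsub>?G\<^esub> a \<in> V}" using finP by (simp add: K_def)
      show "\<Psi> ` ?H \<subseteq> {k\<in>K. \<exists>a\<in>A. k \<otimes>\<^bsub>?G\<^esub> inv\<^bsub>?G\<^esub> a \<in> V}"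
      proof
        fix x assume "x \<in> \<Psi> ` ?H"
        then obtain p q where p: "p permutes I" "x = \<Psi> p" and q: "q \<in> B" "weighted_hamming w I p q < t" by blast
        have qI: "q permutes I" and qA: "\<Psi> q \<in> A" using q(1) by (auto simp: B_def)
        define r where "r = Hilbert_Choice.inv p \<circ> q"
        have r: "r permutes I" unfolding r_def by (rule permutes_compose[OF qI permutes_inv[OF p(1)]])
        have ri: "r i \<noteq> i \<longleftrightarrow> p i \<noteq> q i" for i
          unfolding r_def using permutes_inv_eq[OF p(1), of "q i" i] by auto
        have "(\<Sum>i\<in>I. if r i \<noteq> i then measure M (D i) else 0) = weighted_hamming w I p q"
          unfolding weighted_hamming_def ri by (intro sum.cong) (auto simp: w_def)
        then have rV: "\<Phi> r \<in> V" using small[OF r] q(2) by simp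
        have "x \<otimes>\<^bsub>?G\<^esub> inv\<^bsub>?G\<^esub> (\<Psi> q) = \<Phi> (Hilbert_Choice.inv p) \<otimes>\<^bsub>?G\<^esub> \<Phi> q"
          using \<Phi>_inv[OF permutes_inv[OF qI]] by (simp add: p(2) \<Psi>_def permutes_inv_inv[OF qI])
        also have "\<dots> = \<Phi> r" unfolding r_def by (rule \<Phi>_comp[OF qI permutes_inv[OF p(1)], symmetric])
        finally have "x \<otimes>\<^bsub>?G\<^esub> inv\<^bsub>?G\<^esub> (\<Psi> q) \<in> V" using rV by simp
        moreover have "x \<in> K" using p \<Psi>_im by blast
        ultimately show "x \<in> {k\<in>K. \<exists>a\<in>A. k \<otimes>\<^bsub>?G\<^esub> inv\<^bsub>?G\<^esub> a \<in> V}" using qA by blast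
      qed
    qed
    finally show ?thesis unfolding cardK by simp
  qed
  show "\<exists>K. subgroup K ?G \<and> finite K \<and> (\<forall>g\<in>C. \<exists>k\<in>K. k \<otimes>\<^bsub>?G\<^esub> inv\<^bsub>?G\<^esub> g \<in> V) \<and>
        (\<forall>A\<subseteq>K. \<epsilon> * real (card K) \<le> real (card A) \<longrightarrow>
           (1 - \<epsilon>) * real (card K) \<le> real (card {k\<in>K. \<exists>a\<in>A. k \<otimes>\<^bsub>?G\<^esub> inv\<^bsub>?G\<^esub> a \<in> V}))"
    using sub finP near conc by (intro exI[of _ K]) (simp add: K_def)
qed

end

theorem theorem2p4:
  fixes M :: "'a measure"
  assumes "standard_borel M" and "prob_space M" and "nonatomic M"
  shows "levy_group (Aut_star M) (strong_topology M) \<and>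
         extremely_amenable TYPE('x) (Aut_star M) (strong_topology M)"
proof -
  interpret prob_space M by fact
  show ?thesis
    using levy_groupI extremely_amenableI topological_group_strong_topology
      metrizable_strong_topology[OF assms(1)] finite_concentration_Aut_star[OF assms(1,3)] by blast
qed

end
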